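(* Let $\omega\subset\mathbb{R}^2$ be an open, bounded, smooth domain. There exists $l_0\in(0,1)$ such that the following holds for every $l\in(0,l_0)$. Let $k\ge1$ be an integer, $\beta\in(0,2)$, and let $v\in\mathcal{C}^2(\bar\omega+\bar B_{2l}(0),\mathbb{R}^k)$, $w\in\mathcal{C}^2(\bar\omega+\bar B_{2l}(0),\mathbb{R}^2)$ and $A\in\mathcal{C}^{0,\beta}(\bar\omega+\bar B_{2l}(0),\mathbb{R}^{2\times2}_{\mathrm{sym}})$ be defined on the closed $2l$-neighbourhood of $\omega$. Further, fix an exponent $\gamma$ and constants $\lambda,M$ satisfying $$\gamma\in(0,1),\qquad \lambda>\frac1l,\qquad M\geq\max\{\|v\|_2,\|w\|_2,1\}.$$ Then there exist $\tilde v\in\mathcal{C}^2(\bar\omega+\bar B_l(0),\mathbb{R}^k)$ and $\tilde w\in\mathcal{C}^2(\bar\omega+\bar B_l(0),\mathbb{R}^2)$, defined on the closed $l$-neighbourhood of $\omega$, such that, denoting $$\mathcal{D}=A-\Big(\frac12(\nabla v)^T\nabla v+\mathrm{sym}\nabla w\Big),\qquad \tilde{\mathcal{D}}=A-\Big(\frac12(\nabla\tilde v)^T\nabla\tilde v+\mathrm{sym}\nabla\tilde w\Big),$$ the following bounds hold: $$\|\tilde v-v\|_1\leq C\lambda^{\gamma/2}\big(\|\mathcal{D}\|_0^{1/2}+lM\big),$$ $$\|\tilde w-w\|_1\leq C\lambda^{\gamma}\big(\|\mathcal{D}\|_0^{1/2}+lM\big)\big(1+\|\mathcal{D}\|_0^{1/2}+lM+\|\nabla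 v\|_0\big),$$ $$\|\nabla^2\tilde v\|_0\leq C\frac{(\lambda l)^J}{l}\lambda^{\gamma/2}\big(\|\mathcal{D}\|_0^{1/2}+lM\big),$$ $$\|\nabla^2\tilde w\|_0\leq C\frac{(\lambda l)^J}{l}\lambda^{\gamma}\big(\|\mathcal{D}\|_0^{1/2}+lM\big)\big(1+\|\mathcal{D}\|_0^{1/2}+lM+\|\nabla v\|_0\big),$$ $$\|\tilde{\mathcal{D}}\|_0\leq C\Big(l^\beta\|A\|_{0,\beta}+\frac{1}{(\lambda l)^S}\lambda^\gamma\big(\|\mathcal{D}\|_0+(lM)^2\big)\Big).$$ The norms of $v,w,A,\mathcal{D}$ are taken on $\bar\omega+\bar B_{2l}(0)$, while those of $\tilde v,\tilde w,\tilde{\mathcal{D}}$ and of the differences $\tilde v-v$, $\tilde w-w$ are taken on $\bar\omega+\bar B_l(0)$. The constants $C$ depend only on $\omega,k,\gamma$. The exponents $S,J$ are the integers given through the least common multiple of $2$ and $k$ by $$\mathrm{lcm}(2,k)=2S=kJ.$$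
   Context: $\mathbb{R}^{2\times2}_{\mathrm{sym}}$ is the space of real symmetric $2\times2$ matrices. $\bar B_r(0)$ is the closed ball of radius $r$ centred at $0$ and $\bar\omega+\bar B_r(0)$ is the Minkowski sum (closed $r$-neighbourhood of $\omega$). $(\nabla v)^T\nabla v$ is the $2\times2$ matrix field with entries $\langle\partial_iv,\partial_jv\rangle$; $\mathrm{sym}\nabla w=\frac12(\nabla w+(\nabla w)^T)$. $\|\cdot\|_m$ denotes the $\mathcal{C}^m$ norm (so $\|\cdot\|_0$ is the sup norm) and $\|\cdot\|_{m,\beta}$ the Hölder $\mathcal{C}^{m,\beta}$ norm on the relevant closed set; functions in these spaces on a closed set are restrictions of functions of the same class on the whole $\mathbb{R}^2$. When $\beta\in(1,2)$, $\mathcal{C}^{0,\beta}$ and $\|\cdot\|_{0,\beta}$ are understood as $\mathcal{C}^{1,\beta-1}$ and $\|\cdot\|_{1,\beta-1}$. *)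

theory Defs
  imports "HOL-Analysis.Analysis"
begin

text \<open>Domains with smooth boundary: locally, after a rigid motion, the strict epigraph of a
  smooth function of one variable.\<close>

definition smooth_boundary :: "(real^2) set \<Rightarrow> bool" where
  "smooth_boundary \<omega> \<longleftrightarrow>
     (\<forall>p \<in> frontier \<omega>. \<exists>r>0. \<exists>(Q :: real^2 \<Rightarrow> real^2) (g :: real \<Rightarrow> real).
        orthogonal_transformation Q \<and>
        (\<forall>n. ((deriv ^^ n) g) differentiable_on UNIV) \<and>
        \<omega> \<inter> ball p r = {x \<in> ball p r. Q x $ 2 > g (Q x $ 1)})"

definition smooth_domain :: "(real^2) set \<Rightarrow> bool" where
  "smooth_domain \<omega> \<longleftrightarrow>
     open \<omega> \<and> connected \<omega> \<and> \<omega> \<noteq> {} \<and> bounded \<omega> \<and> smooth_boundary \<omega>"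

definition closed_nbhd :: "(real^2) set \<Rightarrow> real \<Rightarrow> (real^2) set" where
  "closed_nbhd \<omega> r = {x + y | x y. x \<in> closure \<omega> \<and> y \<in> cball 0 r}"

text \<open>The iterated partial derivative along a list of coordinate directions, taken relative to
  \<open>S\<close>. On \<open>closed_nbhd \<omega> r\<close> with \<open>r > 0\<close> every point lies in a ball of radius \<open>r\<close>
  contained in the set, so the relative derivative of a differentiable function is unique and
  equals that of any differentiable extension to the plane.\<close>

fun pderivs :: "(real^2) set \<Rightarrow> 2 list \<Rightarrow> (real^2 \<Rightarrow> real) \<Rightarrow> real^2 \<Rightarrow> real" where
  "pderivs S [] f = f"
| "pderivs S (i # is) f = (\<lambda>x. frechet_derivative (pderivs S is f) (at x within S) (axis i 1))"

definition C_diff :: "nat \<Rightarrow> (real^2 \<Rightarrow> real) \<Rightarrow> bool" where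
  "C_diff m F \<longleftrightarrow>
     (\<forall>is. length is < m \<longrightarrow> pderivs UNIV is F differentiable_on UNIV) \<and>
     (\<forall>is. length is \<le> m \<longrightarrow> continuous_on UNIV (pderivs UNIV is F))"

definition C_Hoelder :: "nat \<Rightarrow> real \<Rightarrow> (real^2 \<Rightarrow> real) \<Rightarrow> bool" where
  "C_Hoelder m \<alpha> F \<longleftrightarrow> C_diff m F \<and>
     (\<forall>is. length is \<le> m \<longrightarrow> bounded (range (pderivs UNIV is F))) \<and>
     (\<forall>is. length is = m \<longrightarrow>
        (\<exists>H. \<forall>x y. \<bar>pderivs UNIV is F x - pderivs UNIV is F y\<bar> \<le> H * dist x y powr \<alpha>))"

text \<open>Maps with several components are families \<open>f i\<close>, \<open>i \<in> I\<close>, of scalar functions, so that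
  the number of components may be a variable: \<open>I = {..<k}\<close> for maps into \<open>\<real>\<^sup>k\<close>. The functions
  are total, but only their values on \<open>S\<close> matter; spaces on \<open>S\<close> consist of restrictions.\<close>

definition C_on :: "nat \<Rightarrow> (real^2) set \<Rightarrow> 'i set \<Rightarrow> ('i \<Rightarrow> real^2 \<Rightarrow> real) \<Rightarrow> bool" where
  "C_on m S I f \<longleftrightarrow> (\<forall>i\<in>I. \<exists>F. C_diff m F \<and> (\<forall>x\<in>S. F x = f i x))"

definition C_Hoelder_on ::
    "nat \<Rightarrow> real \<Rightarrow> (real^2) set \<Rightarrow> 'i set \<Rightarrow> ('i \<Rightarrow> real^2 \<Rightarrow> real) \<Rightarrow> bool" where
  "C_Hoelder_on m \<alpha> S I f \<longleftrightarrow> (\<forall>i\<in>I. \<exists>F. C_Hoelder m \<alpha> F \<and> (\<forall>x\<in>S. F x = f i x))"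

text \<open>\<open>sup_nabla m S I f\<close> is the sup norm over \<open>S\<close> of the \<open>m\<close>-th gradient, with the Euclidean
  (Frobenius) norm on its values.\<close>

definition sup_nabla :: "nat \<Rightarrow> (real^2) set \<Rightarrow> 'i set \<Rightarrow> ('i \<Rightarrow> real^2 \<Rightarrow> real) \<Rightarrow> real" where
  "sup_nabla m S I f =
     (SUP x\<in>S. L2_set (\<lambda>(i, is). pderivs S is (f i) x) (I \<times> {is. length is = m}))"

definition C_norm :: "nat \<Rightarrow> (real^2) set \<Rightarrow> 'i set \<Rightarrow> ('i \<Rightarrow> real^2 \<Rightarrow> real) \<Rightarrow> real" where
  "C_norm m S I f = (\<Sum>j\<le>m. sup_nabla j S I f)"

definition Hoelder_seminorm ::
    "nat \<Rightarrow> real \<Rightarrow> (real^2) set \<Rightarrow> 'i set \<Rightarrow> ('i \<Rightarrow> real^2 \<Rightarrow> real) \<Rightarrow> real" where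
  "Hoelder_seminorm m \<alpha> S I f =
     Sup {L2_set (\<lambda>(i, is). pderivs S is (f i) x - pderivs S is (f i) y)
            (I \<times> {is. length is = m}) / dist x y powr \<alpha> | x y. x \<in> S \<and> y \<in> S \<and> x \<noteq> y}"

definition Hoelder_norm ::
    "nat \<Rightarrow> real \<Rightarrow> (real^2) set \<Rightarrow> 'i set \<Rightarrow> ('i \<Rightarrow> real^2 \<Rightarrow> real) \<Rightarrow> real" where
  "Hoelder_norm m \<alpha> S I f = C_norm m S I f + Hoelder_seminorm m \<alpha> S I f"

text \<open>\<open>\<C>\<^sup>0\<^sup>,\<^sup>\<beta>\<close> for \<open>0 < \<beta> < 2\<close>, read as \<open>\<C>\<^sup>1\<^sup>,\<^sup>\<beta>\<^sup>-\<^sup>1\<close> when \<open>\<beta> > 1\<close>.\<close>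

definition C0_Hoelder_on ::
    "real \<Rightarrow> (real^2) set \<Rightarrow> 'i set \<Rightarrow> ('i \<Rightarrow> real^2 \<Rightarrow> real) \<Rightarrow> bool" where
  "C0_Hoelder_on \<beta> S I f \<longleftrightarrow>
     (if \<beta> \<le> 1 then C_Hoelder_on 0 \<beta> S I f else C_Hoelder_on 1 (\<beta> - 1) S I f)"

definition C0_Hoelder_norm ::
    "real \<Rightarrow> (real^2) set \<Rightarrow> 'i set \<Rightarrow> ('i \<Rightarrow> real^2 \<Rightarrow> real) \<Rightarrow> real" where
  "C0_Hoelder_norm \<beta> S I f =
     (if \<beta> \<le> 1 then Hoelder_norm 0 \<beta> S I f else Hoelder_norm 1 (\<beta> - 1) S I f)"

definition comps :: "(real^2 \<Rightarrow> real^2) \<Rightarrow> 2 \<Rightarrow> real^2 \<Rightarrow> real" where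
  "comps w = (\<lambda>i x. w x $ i)"

definition entries :: "(real^2 \<Rightarrow> real^2^2) \<Rightarrow> 2 \<times> 2 \<Rightarrow> real^2 \<Rightarrow> real" where
  "entries A = (\<lambda>(i, j) x. A x $ i $ j)"

definition gram :: "nat \<Rightarrow> (real^2) set \<Rightarrow> (nat \<Rightarrow> real^2 \<Rightarrow> real) \<Rightarrow> real^2 \<Rightarrow> real^2^2" where
  "gram k S v x = (\<chi> i j. \<Sum>a<k. pderivs S [i] (v a) x * pderivs S [j] (v a) x)"

definition grad :: "(real^2) set \<Rightarrow> (real^2 \<Rightarrow> real^2) \<Rightarrow> real^2 \<Rightarrow> real^2^2" where
  "grad S w x = (\<chi> i j. pderivs S [j] (comps w i) x)"

definition sym_grad :: "(real^2) set \<Rightarrow> (real^2 \<Rightarrow> real^2) \<Rightarrow> real^2 \<Rightarrow> real^2^2" where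
  "sym_grad S w x = (1/2) *\<^sub>R (grad S w x + transpose (grad S w x))"

definition defect :: "nat \<Rightarrow> (real^2) set \<Rightarrow> (nat \<Rightarrow> real^2 \<Rightarrow> real) \<Rightarrow> (real^2 \<Rightarrow> real^2) \<Rightarrow>
    (real^2 \<Rightarrow> real^2^2) \<Rightarrow> real^2 \<Rightarrow> real^2^2" where
  "defect k S v w A x = A x - ((1/2) *\<^sub>R gram k S v x + sym_grad S w x)"

end

theory Submission
  imports Defs
begin

text \<open>
  Mollify \<open>v\<close>, \<open>w\<close> and \<open>A\<close> at scale \<open>l\<close> by iterated box averages. Up to the mollification error of \<open>A\<close>, which
  is of order \<open>l\<^sup>\<beta>\<close> because the averages are even, the new defect is the mollified old one plus a commutator
  of products of gradients. Both are smooth at scale \<open>l\<close>, of size \<open>\<parallel>\<D>\<parallel> + (l M)\<^sup>2\<close>.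

  Such a defect is removed in \<open>S\<close> rounds. Each round first absorbs the off-diagonal entry into a symmetric
  gradient. Instead of inverting the Laplacian with Schauder estimates, the potential is written as a
  telescoping sum of averages over dyadic scales, which costs only a factor logarithmic in the frequency.
  After adding a large multiple of the identity, the diagonal is the sum of squares of two amplitudes, and
  each of them is cancelled by one Nash-Kuiper corrugation. The corrugations run cyclically through the
  \<open>k\<close> codimensions, so that in \<open>2 S = k J\<close> steps every component of \<open>v\<close> is corrugated \<open>J\<close> times. With
  \<open>\<sigma> = (\<lambda> l)\<^sup>1\<^sup>/\<^sup>2\<close> a round gains \<open>\<sigma>\<^sup>2\<close> in the defect, while the second derivatives of the component
  in use grow by \<open>\<sigma>\<^sup>2\<close>. The accumulated powers of \<open>log \<lambda>\<close> are absorbed in \<open>\<lambda>\<^sup>\<gamma>\<close>.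
\<close>

section \<open>Partial derivatives\<close>

text \<open>A corrugation error contains the Hessian of only the component of \<open>v\<close> in
  use, and this Hessian still has the size left by its last use. The frequency therefore has to jump
  by the square of \<sigma> only once per cycle of \<open>k\<close> steps, which is why codimension
  helps. Removing an off-diagonal entry is an operation of order zero: it is unbounded in the sup
  norm, and nonlocal. The price is one logarithm per round, affordable because the number
  \<open>S\<close> of rounds is fixed by \<open>k\<close>. Nonlocality forces each defect to be
  bounded on the whole plane and compactly supported, while the data are controlled only near the
  closure of \<omega>; cutoffs separate the two regimes. Derivatives are in limited supply. A round
  consumes three orders of the defect, one for the potential and two for the second derivatives of
  the amplitudes in the error. One more order is kept so that the gradients of the amplitudes
  entering \<open>w\<close> are twice differentiable even in the last round. Hence 3S + 1 iterations
  of the box average provide all the smoothness.\<close>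

definition pd :: "2 \<Rightarrow> (real^2 \<Rightarrow> real) \<Rightarrow> real^2 \<Rightarrow> real" where
  "pd i f x = frechet_derivative f (at x) (axis i 1)"

lemma pd_eqI: "(f has_derivative D) (at x) \<Longrightarrow> pd i f x = D (axis i 1)"
  unfolding pd_def using frechet_derivative_at by metis

lemma has_derivative_pd:
  assumes "f differentiable (at x)"
  shows "(f has_derivative (\<lambda>h. \<Sum>i\<in>UNIV. pd i f x * h $ i)) (at x)"
proof -
  let ?D = "frechet_derivative f (at x)"
  have D: "(f has_derivative ?D) (at x)"
    using assms frechet_derivative_works by blast
  then interpret bounded_linear ?D by (rule has_derivative_bounded_linear)
  have "?D h = (\<Sum>i\<in>UNIV. pd i f x * h $ i)" for h
  proof -
    have "?D h = ?D (\<Sum>i\<in>UNIV. (h $ i) *\<^sub>R axis i 1)"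
      using basis_expansion[of h] by (simp add: scalar_mult_eq_scaleR)
    also have "\<dots> = (\<Sum>i\<in>UNIV. pd i f x * h $ i)"
      by (simp add: sum scaleR pd_def mult.commute)
    finally show ?thesis .
  qed
  then have "?D = (\<lambda>h. \<Sum>i\<in>UNIV. pd i f x * h $ i)" by blast
  with D show ?thesis by simp
qed

lemma DERIV_line:
  assumes "f differentiable (at (x + t *\<^sub>R axis i 1))"
  shows "((\<lambda>t. f (x + t *\<^sub>R axis i 1)) has_real_derivative pd i f (x + t *\<^sub>R axis i 1)) (at t)"
proof -
  let ?y = "x + t *\<^sub>R axis i 1"
  let ?D = "frechet_derivative f (at ?y)"
  have D: "(f has_derivative ?D) (at ?y)"
    using assms frechet_derivative_works by blast
  then interpret bounded_linear ?D by (rule has_derivative_bounded_linear)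
  have "((\<lambda>t. x + t *\<^sub>R axis i 1) has_derivative (\<lambda>h. h *\<^sub>R axis i 1)) (at t)"
    by (auto intro!: derivative_eq_intros)
  from diff_chain_at[OF this D]
  have "((\<lambda>t. f (x + t *\<^sub>R axis i 1)) has_derivative (\<lambda>h. ?D (h *\<^sub>R axis i 1))) (at t)"
    by (simp add: o_def)
  then show ?thesis
    by (simp add: has_field_derivative_def scaleR pd_def mult_commute_abs)
qed

lemma pd_const [simp]: "pd i (\<lambda>x. c) = (\<lambda>x. 0)"
  by (rule ext, rule trans[OF pd_eqI[of _ "\<lambda>h. 0"]]) auto

lemma pd_add:
  assumes "f differentiable (at x)" "g differentiable (at x)"
  shows "pd i (\<lambda>x. f x + g x) x = pd i f x + pd i g x"
  using pd_eqI[OF has_derivative_add[OF assms[unfolded frechet_derivative_works]]]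
  by (simp add: pd_def)

lemma pd_diff:
  assumes "f differentiable (at x)" "g differentiable (at x)"
  shows "pd i (\<lambda>x. f x - g x) x = pd i f x - pd i g x"
  using pd_eqI[OF has_derivative_diff[OF assms[unfolded frechet_derivative_works]]]
  by (simp add: pd_def)

lemma pd_mult:
  assumes "f differentiable (at x)" "g differentiable (at x)"
  shows "pd i (\<lambda>x. f x * g x) x = pd i f x * g x + f x * pd i g x"
  using pd_eqI[OF has_derivative_mult[OF assms[unfolded frechet_derivative_works]]]
  by (simp add: pd_def)

lemma pd_cmult:
  assumes "f differentiable (at x)"
  shows "pd i (\<lambda>x. c * f x) x = c * pd i f x"
  using pd_mult[of "\<lambda>x. c" x f i] assms by simp

lemma pd_uminus:
  assumes "f differentiable (at x)"
  shows "pd i (\<lambda>x. - f x) x = - pd i f x"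
  using pd_cmult[OF assms, of i "-1"] by simp

lemma pd_chain:
  assumes "f differentiable (at x)" "(\<phi> has_real_derivative d) (at (f x))"
  shows "pd i (\<lambda>x. \<phi> (f x)) x = d * pd i f x" "(\<lambda>x. \<phi> (f x)) differentiable (at x)"
proof -
  have *: "((\<lambda>x. \<phi> (f x)) has_derivative (\<lambda>h. d * frechet_derivative f (at x) h)) (at x)"
    using diff_chain_at[OF assms(1)[unfolded frechet_derivative_works]
        assms(2)[unfolded has_field_derivative_def]] by (simp add: o_def)
  show "pd i (\<lambda>x. \<phi> (f x)) x = d * pd i f x"
    using pd_eqI[OF *] by (simp add: pd_def)
  show "(\<lambda>x. \<phi> (f x)) differentiable (at x)"
    using * differentiable_def by blast
qed

lemma differentiable_nth [simp]: "(\<lambda>x::real^2. x $ d) differentiable (at x)"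
  by (intro bounded_linear_imp_differentiable bounded_linear_vec_nth)

lemma pd_nth: "pd i (\<lambda>x. x $ d) x = (if i = d then 1 else 0)"
proof -
  have "((\<lambda>x::real^2. x $ d) has_derivative (\<lambda>x. x $ d)) (at x)"
    by (intro bounded_linear_imp_has_derivative bounded_linear_vec_nth)
  from pd_eqI[OF this] show ?thesis by (auto simp: axis_def)
qed

lemma pd_translate:
  assumes "f differentiable (at (x + c))"
  shows "pd i (\<lambda>x. f (x + c)) x = pd i f (x + c)" "(\<lambda>x. f (x + c)) differentiable (at x)"
proof -
  have "((\<lambda>x. x + c) has_derivative (\<lambda>h. h)) (at x)"
    by (auto intro!: derivative_eq_intros)
  from diff_chain_at[OF this assms[unfolded frechet_derivative_works]]
  have *: "((\<lambda>x. f (x + c)) has_derivative frechet_derivative f (at (x + c))) (at x)"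
    by (simp add: o_def)
  show "pd i (\<lambda>x. f (x + c)) x = pd i f (x + c)"
    using pd_eqI[OF *] by (simp add: pd_def)
  show "(\<lambda>x. f (x + c)) differentiable (at x)" using * differentiable_def by blast
qed

lemma pd_cong_open:
  assumes "open W" "x \<in> W" "\<And>y. y \<in> W \<Longrightarrow> f y = g y" "f differentiable (at x)"
  shows "pd i f x = pd i g x"
  unfolding pd_def using frechet_derivative_transform_within_open[OF assms(4,1,2,3)] by simp

text \<open>The criterion for functions of a pair of reals, \<open>has_derivative_partialsI\<close>,
  is carried over along the linear bijection of the plane with pairs. All differentiability
  statements about averages rest on it.\<close>

lemma differentiable_if_continuous_partials:
  fixes f :: "real^2 \<Rightarrow> real"
  assumes p: "\<And>i x. ((\<lambda>t. f (x + t *\<^sub>R axis i 1)) has_real_derivative g i x) (at 0)"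
    and c: "\<And>i. continuous_on UNIV (g i)"
  shows "f differentiable (at x)" "pd i f x = g i x"
proof -
  let ?F = "\<lambda>a b. f (\<chi> i. if i = 1 then a else b)"
  have line: "((\<lambda>t. f (y + t *\<^sub>R axis i 1)) has_real_derivative g i (y + t *\<^sub>R axis i 1)) (at t)" for i y t
  proof -
    have "((\<lambda>s. f ((y + t *\<^sub>R axis i 1) + s *\<^sub>R axis i 1)) has_real_derivative
            g i (y + t *\<^sub>R axis i 1)) (at (t - t))"
      using p[where x = "y + t *\<^sub>R axis i 1" and i = i] by simp
    moreover have D1: "((\<lambda>s. s - t) has_real_derivative 1) (at t)"
      by (auto intro!: derivative_eq_intros)
    ultimately have "((\<lambda>s. f ((y + t *\<^sub>R axis i 1) + (s - t) *\<^sub>R axis i 1)) has_real_derivative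
            g i (y + t *\<^sub>R axis i 1)) (at t)"
      using DERIV_chain2[of "\<lambda>s. f ((y + t *\<^sub>R axis i 1) + s *\<^sub>R axis i 1)"
          "g i (y + t *\<^sub>R axis i 1)" "\<lambda>s. s - t" t 1 UNIV] D1 by simp
    moreover have "(y + t *\<^sub>R axis i 1) + (s - t) *\<^sub>R axis i 1 = y + s *\<^sub>R axis i 1" for s
      by (simp add: algebra_simps)
    ultimately show ?thesis by simp
  qed
  have e1: "(\<chi> i. if i = 1 then a else b) = (\<chi> i. if i = 1 then 0 else b) + a *\<^sub>R axis (1::2) (1::real)" for a b :: real
    by (auto simp: vec_eq_iff axis_def)
  have e2: "(\<chi> i. if i = 1 then a else b) = (\<chi> i. if i = 1 then a else 0) + b *\<^sub>R axis (2::2) (1::real)" for a b :: real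
    unfolding vec_eq_iff forall_2 by (auto simp: axis_def)
  have d1: "((\<lambda>a. ?F a b) has_derivative (\<lambda>h. g 1 (\<chi> i. if i = 1 then a else b) * h)) (at a)" for a b
    using line[of "\<chi> i. if i = 1 then 0 else b" 1 a]
    unfolding e1[symmetric] has_field_derivative_def .
  have d2: "((\<lambda>b. ?F a b) has_derivative blinfun_apply (blinfun_mult_right (g 2 (\<chi> i. if i = 1 then a else b)))) (at b)" for a b
    using line[of "\<chi> i. if i = 1 then a else 0" 2 b]
    unfolding e2[symmetric] has_field_derivative_def by simp
  have "continuous_on UNIV (\<lambda>z::real\<times>real. (\<chi> i. if i = (1::2) then fst z else snd z))"
  proof (rule continuous_on_vec_lambda)
    show "continuous_on UNIV (\<lambda>z::real\<times>real. if i = (1::2) then fst z else snd z)" for i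
      by (cases "i = 1") (auto intro: continuous_on_fst continuous_on_snd continuous_on_id)
  qed
  then have "continuous_on UNIV (\<lambda>z::real\<times>real. g 2 (\<chi> i. if i = (1::2) then fst z else snd z))"
    by (rule continuous_on_compose2[OF c]) auto
  then have "continuous_on UNIV (\<lambda>z::real\<times>real. blinfun_mult_right (g 2 (\<chi> i. if i = (1::2) then fst z else snd z)))"
    by (rule bounded_linear.continuous_on[OF bounded_linear_blinfun_mult_right])
  then have cc: "continuous (at z within UNIV \<times> UNIV) (\<lambda>(a,b). blinfun_mult_right (g 2 (\<chi> i. if i = (1::2) then a else b)))" for z
    unfolding case_prod_unfold UNIV_Times_UNIV using continuous_on_eq_continuous_within by blast
  have D: "((\<lambda>(a,b). ?F a b) has_derivative
      (\<lambda>(ta,tb). g 1 (\<chi> i. if i = 1 then a else b) * ta + blinfun_mult_right (g 2 (\<chi> i. if i = 1 then a else b)) tb))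
      (at (a, b) within UNIV \<times> UNIV)" for a b
    by (rule has_derivative_partialsI[OF _ _ cc]) (use d1 d2 in auto)
  have l: "((\<lambda>x::real^2. (x $ 1, x $ 2)) has_derivative (\<lambda>x. (x $ 1, x $ 2))) (at x)"
    by (intro has_derivative_Pair bounded_linear_imp_has_derivative bounded_linear_vec_nth)
  have v: "(\<chi> i. if i = (1::2) then x $ 1 else x $ 2) = x" for x :: "real^2"
    unfolding vec_eq_iff forall_2 by auto
  have *: "(f has_derivative (\<lambda>h. g 1 x * h $ 1 + g 2 x * h $ 2)) (at x)"
    using diff_chain_at[OF l D[of "x$1" "x$2", simplified]] by (simp add: o_def v)
  then show "f differentiable (at x)" using differentiable_def by blast
  show "pd i f x = g i x"
    using pd_eqI[OF *, of i] exhaust_2[of i] by (auto simp: axis_def)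
qed

section \<open>Derivative bounds at a frequency\<close>

text \<open>Derivatives of order \<open>m \<le> n\<close> are bounded on \<open>U\<close> by \<open>K \<mu>\<^sup>m\<close>, but the regularity is required on the whole
  plane. In particular \<open>bd {} n 0 0\<close> is membership in \<open>C\<^sup>n\<close>.\<close>

fun bd :: "(real^2) set \<Rightarrow> nat \<Rightarrow> real \<Rightarrow> real \<Rightarrow> (real^2 \<Rightarrow> real) \<Rightarrow> bool" where
  "bd U 0 K \<mu> f \<longleftrightarrow> continuous_on UNIV f \<and> (\<forall>x\<in>U. \<bar>f x\<bar> \<le> K)"
| "bd U (Suc n) K \<mu> f \<longleftrightarrow>
     (\<forall>x. f differentiable (at x)) \<and> (\<forall>x\<in>U. \<bar>f x\<bar> \<le> K) \<and> (\<forall>i. bd U n (K * \<mu>) \<mu> (pd i f))"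

lemma bd_bound: "bd U n K \<mu> f \<Longrightarrow> x \<in> U \<Longrightarrow> \<bar>f x\<bar> \<le> K"
  by (cases n) auto

lemma bd_cont: "bd U n K \<mu> f \<Longrightarrow> continuous_on UNIV f"
  by (cases n) (auto simp: continuous_on_eq_continuous_at differentiable_imp_continuous_within)

lemma bd_diff: "bd U n K \<mu> f \<Longrightarrow> 0 < n \<Longrightarrow> f differentiable (at x)"
  by (cases n) auto

lemma bd_pd: "bd U (Suc n) K \<mu> f \<Longrightarrow> bd U n (K * \<mu>) \<mu> (pd i f)"
  by auto

lemma bd_le: "bd U n K \<mu> f \<Longrightarrow> m \<le> n \<Longrightarrow> bd U m K \<mu> f"
proof (induction m arbitrary: n K f)
  case 0
  then show ?case using bd_bound bd_cont by force
next
  case (Suc m)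
  then obtain n' where n: "n = Suc n'" "m \<le> n'" by (cases n) auto
  have "bd U m (K * \<mu>) \<mu> (pd i f)" for i
    using Suc.IH[OF bd_pd[OF Suc.prems(1)[unfolded n(1)]] n(2)] .
  then show ?case using Suc.prems(1) n by auto
qed

lemma bd_mono:
  "bd V n K \<mu> f \<Longrightarrow> U \<subseteq> V \<Longrightarrow> K \<le> K' \<Longrightarrow> 0 \<le> \<mu> \<Longrightarrow> \<mu> \<le> \<mu>' \<Longrightarrow> 0 \<le> K' \<Longrightarrow> bd U n K' \<mu>' f"
proof (induction n arbitrary: K K' f)
  case 0
  then show ?case by force
next
  case (Suc n)
  have 1: "K * \<mu> \<le> K' * \<mu>'" using Suc.prems by (meson mult_left_mono order_trans mult_right_mono)
  have 2: "0 \<le> K' * \<mu>'" using Suc.prems by simp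
  have "bd U n (K' * \<mu>') \<mu>' (pd i f)" for i
    by (rule Suc.IH[OF bd_pd[OF Suc.prems(1)] Suc.prems(2) 1 Suc.prems(4,5) 2])
  then show ?case using Suc.prems by (auto intro: order_trans)
qed

lemma bd_smooth: "bd U n K \<mu> f \<Longrightarrow> bd {} n 0 0 f"
proof (induction n arbitrary: K f)
  case (Suc n)
  show ?case using Suc.IH[OF bd_pd[OF Suc.prems]] Suc.prems by (simp del: split_paired_All)
qed auto

lemma bd_smooth': "bd {} n 0 0 f \<Longrightarrow> bd {} n K \<mu> f"
  by (induction n arbitrary: K f) auto

text \<open>Each of the at most \<open>n\<close> derivatives gives up one factor
  \<open>c\<close>.\<close>

lemma bd_scale_freq:
  "bd U n K (c * \<mu>) f \<Longrightarrow> 1 \<le> c \<Longrightarrow> 0 \<le> K \<Longrightarrow> 0 \<le> \<mu> \<Longrightarrow> bd U n (c^n * K) \<mu> f"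
proof (induction n arbitrary: K f)
  case (Suc n)
  have "bd U n (c^n * (K * (c * \<mu>))) \<mu> (pd i f)" for i
    using Suc by auto
  moreover have "K \<le> c ^ Suc n * K"
    using mult_right_mono[OF one_le_power[OF Suc.prems(2), of "Suc n"] Suc.prems(3)] by simp
  ultimately show ?case using Suc.prems(1)
    by (fastforce simp: algebra_simps)
qed auto

lemma bd_Un: "bd U n K \<mu> f \<Longrightarrow> bd V n K \<mu> f \<Longrightarrow> bd (U \<union> V) n K \<mu> f"
  by (induction n arbitrary: K f) auto

text \<open>Since \<open>U\<close> enters only through pointwise inequalities, a bound may be proved
  by an argument that freezes constants at one point at a time, as the commutator estimate does. The
  second premise supplies the regularity when \<open>U\<close> is empty.\<close>

lemma bd_pointwise: "(\<And>x. x \<in> U \<Longrightarrow> bd {x} n K \<mu> f) \<Longrightarrow> bd {} n K \<mu> f \<Longrightarrow> bd U n K \<mu> f"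
  by (induction n arbitrary: K f) auto

lemma bd_const: "\<bar>c\<bar> \<le> K \<Longrightarrow> 0 \<le> \<mu> \<Longrightarrow> bd U n K \<mu> (\<lambda>x. c)"
proof (induction n arbitrary: K c)
  case (Suc n)
  then have "0 \<le> K * \<mu>" by (simp add: order_trans[OF abs_ge_zero])
  then show ?case using Suc by auto
qed auto

lemma bd_add: "bd U n K \<mu> f \<Longrightarrow> bd U n L \<mu> g \<Longrightarrow> bd U n (K + L) \<mu> (\<lambda>x. f x + g x)"
proof (induction n arbitrary: K L f g)
  case 0
  then show ?case by (auto intro!: continuous_intros) (meson abs_triangle_ineq add_mono order_trans)
next
  case (Suc n)
  have "pd i (\<lambda>x. f x + g x) = (\<lambda>x. pd i f x + pd i g x)" for i
    using Suc.prems by (auto simp: pd_add)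
  then show ?case using Suc
    by (auto simp: distrib_right) (meson abs_triangle_ineq add_mono order_trans)
qed

lemma bd_cmult: "bd U n K \<mu> f \<Longrightarrow> bd U n (\<bar>c\<bar> * K) \<mu> (\<lambda>x. c * f x)"
proof (induction n arbitrary: K f)
  case 0
  then show ?case by (auto intro!: continuous_intros simp: abs_mult mult_left_mono)
next
  case (Suc n)
  have "pd i (\<lambda>x. c * f x) = (\<lambda>x. c * pd i f x)" for i
    using Suc.prems by (auto simp: pd_cmult)
  then show ?case using Suc.prems Suc.IH[OF bd_pd[OF Suc.prems]]
    by (auto simp: abs_mult mult_left_mono mult.assoc)
qed

lemma bd_uminus: "bd U n K \<mu> f \<Longrightarrow> bd U n K \<mu> (\<lambda>x. - f x)"
  using bd_cmult[of U n K \<mu> f "-1"] by simp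

lemma bd_minus: "bd U n K \<mu> f \<Longrightarrow> bd U n L \<mu> g \<Longrightarrow> bd U n (K + L) \<mu> (\<lambda>x. f x - g x)"
  using bd_add[of U n K \<mu> f L "\<lambda>x. - g x"] bd_uminus[of U n L \<mu> g] by simp

text \<open>By the Leibniz rule every differentiation at most doubles the number of terms, each of
  the same size.\<close>

lemma bd_mult: "bd U n K \<mu> f \<Longrightarrow> bd U n L \<mu> g \<Longrightarrow> bd U n (2^n * K * L) \<mu> (\<lambda>x. f x * g x)"
proof (induction n arbitrary: K L f g)
  case 0
  then have "\<bar>f x * g x\<bar> \<le> K * L" if "x \<in> U" for x
    using mult_mono[of "\<bar>f x\<bar>" K "\<bar>g x\<bar>" L] that by (auto simp: abs_mult)
  then show ?case using 0 by (simp add: continuous_on_mult)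
next
  case (Suc n)
  have p: "pd i (\<lambda>x. f x * g x) = (\<lambda>x. pd i f x * g x + f x * pd i g x)" for i
    using Suc.prems by (auto simp: pd_mult)
  have "bd U n (2^n * (K * \<mu>) * L + 2^n * K * (L * \<mu>)) \<mu> (pd i (\<lambda>x. f x * g x))" for i
    unfolding p by (intro bd_add Suc.IH bd_pd[OF Suc.prems(1)] bd_pd[OF Suc.prems(2)]
        bd_le[OF Suc.prems(1)] bd_le[OF Suc.prems(2)]) auto
  moreover have "\<bar>f x * g x\<bar> \<le> 2 ^ Suc n * K * L" if "x \<in> U" for x
  proof -
    have "\<bar>f x\<bar> \<le> K" "\<bar>g x\<bar> \<le> L" using Suc.prems that by auto
    then have "0 \<le> K" "0 \<le> L" "\<bar>f x * g x\<bar> \<le> K * L"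
      using mult_mono[of "\<bar>f x\<bar>" K "\<bar>g x\<bar>" L] by (auto simp: abs_mult)
    moreover have "K * L \<le> 2 ^ Suc n * (K * L)"
      using mult_right_mono[of 1 "2 ^ Suc n" "K * L"] calculation one_le_power[of "2::real" "Suc n"] by simp
    ultimately show ?thesis by (simp add: mult.assoc)
  qed
  moreover have "2 ^ n * (K * \<mu>) * L + 2 ^ n * K * (L * \<mu>) = 2 ^ Suc n * K * L * \<mu>"
    by (simp add: algebra_simps)
  moreover have "(\<lambda>x. f x * g x) differentiable (at x)" for x
    using Suc.prems by (intro differentiable_mult) auto
  ultimately show ?case by (simp only: bd.simps) blast
qed

lemma bd_sum:
  assumes "finite I" "\<And>a. a \<in> I \<Longrightarrow> bd U n (K a) \<mu> (f a)" "0 \<le> \<mu>"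
  shows "bd U n (\<Sum>a\<in>I. K a) \<mu> (\<lambda>x. \<Sum>a\<in>I. f a x)"
  using assms(1,2)
proof (induction I rule: finite_induct)
  case empty
  then show ?case using bd_const[of 0 0, OF _ assms(3)] by simp
next
  case (insert a I)
  have "bd U n (K a + (\<Sum>a\<in>I. K a)) \<mu> (\<lambda>x. f a x + (\<Sum>a\<in>I. f a x))"
    by (rule bd_add[OF insert.prems[OF insertI1] insert.IH[OF insert.prems[OF insertI2]]])
  then show ?case using insert.hyps by simp
qed

lemma bd_translate:
  "bd V n K \<mu> f \<Longrightarrow> (\<And>x. x \<in> U \<Longrightarrow> x + c \<in> V) \<Longrightarrow> bd U n K \<mu> (\<lambda>x. f (x + c))"
proof (induction n arbitrary: K f)
  case 0
  have "continuous_on UNIV (\<lambda>x. f (x + c))"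
    by (rule continuous_on_compose2[of UNIV f]) (use 0 in \<open>auto intro!: continuous_intros\<close>)
  then show ?case using 0 by auto
next
  case (Suc n)
  have p: "pd i (\<lambda>x. f (x + c)) = (\<lambda>x. pd i f (x + c))" for i
    by (rule ext, rule pd_translate(1)) (use Suc.prems(1) in simp)
  moreover have "bd U n (K * \<mu>) \<mu> (\<lambda>x. pd i f (x + c))" for i
    by (rule Suc.IH[OF bd_pd[OF Suc.prems(1)] Suc.prems(2)])
  moreover have "(\<lambda>x. f (x + c)) differentiable (at x)" for x
    using Suc.prems(1) by (intro pd_translate(2)) auto
  ultimately show ?case using Suc.prems by (simp only: bd.simps p) blast
qed

text \<open>The phase is kept general because differentiation shifts it by \<open>pi/2\<close>; with
  it the induction closes, and the cosine is a special case.\<close>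

lemma bd_sin: "0 \<le> \<nu> \<Longrightarrow> 0 \<le> K \<Longrightarrow> bd U n K \<nu> (\<lambda>x. K * sin (\<nu> * x $ d + \<phi>))"
proof (induction n arbitrary: K \<phi>)
  case 0
  then show ?case by (auto intro!: continuous_intros simp: abs_mult mult_left_le)
next
  case (Suc n)
  have l: "((\<lambda>t. K * sin (\<nu> * t + \<phi>)) has_real_derivative K * \<nu> * sin (\<nu> * t + (\<phi> + pi/2))) (at t)" for t
  proof -
    have "sin (\<nu> * t + (\<phi> + pi/2)) = cos (\<nu> * t + \<phi>)"
      using sin_add[of "\<nu> * t + \<phi>" "pi/2"] by (simp add: add.assoc)
    then show ?thesis by (auto intro!: derivative_eq_intros)
  qed
  have p: "pd i (\<lambda>x. K * sin (\<nu> * x $ d + \<phi>)) =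
      (\<lambda>x. if i = d then K * \<nu> * sin (\<nu> * x $ d + (\<phi> + pi/2)) else 0)" for i
    using pd_chain(1)[OF differentiable_nth l] by (auto simp: pd_nth)
  have "bd U n (K * \<nu>) \<nu> (pd i (\<lambda>x. K * sin (\<nu> * x $ d + \<phi>)))" for i
    using Suc.IH[of "K * \<nu>" "\<phi> + pi/2"] Suc.prems
    unfolding p by (cases "i = d") (auto intro: bd_const)
  then show ?case using pd_chain(2)[OF differentiable_nth l] Suc.prems
    by (auto simp: abs_mult mult_left_le)
qed

lemma bd_cos: "0 \<le> \<nu> \<Longrightarrow> 0 \<le> K \<Longrightarrow> bd U n K \<nu> (\<lambda>x. K * cos (\<nu> * x $ d))"
  using bd_sin[of \<nu> K U n d "pi/2"] by (simp add: sin_add)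

text \<open>A derivative lowers the exponent by one and produces a factor \<open>pd i h\<close>, so
  the induction runs over all exponents at once. As \<open>1 + h\<close> stays between 1/2 and 3/2,
  the constant depends on neither \<open>h\<close> nor \<mu>.\<close>

lemma bd_powr_1_plus:
  "\<exists>C\<ge>0. \<forall>h \<mu>. 0 \<le> \<mu> \<longrightarrow> bd UNIV n (1/2) \<mu> h \<longrightarrow> bd UNIV n C \<mu> (\<lambda>x. (1 + h x) powr r)"
proof (induction n arbitrary: r)
  case 0
  have b: "\<bar>(1 + h x) powr r\<bar> \<le> 2 powr \<bar>r\<bar>" if "\<bar>h x\<bar> \<le> 1/2" for h :: "real^2 \<Rightarrow> real" and x
  proof -
    have t: "1/2 \<le> 1 + h x" "1 + h x \<le> 2" using that by auto
    show ?thesis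
    proof (cases "0 \<le> r")
      case True
      then show ?thesis using t by (simp add: powr_mono2)
    next
      case False
      have "(1 + h x) powr r \<le> (1/2) powr r" using t False by (intro powr_mono2') auto
      also have "\<dots> = 2 powr (- r)" by (simp add: powr_minus_divide powr_divide)
      finally show ?thesis using False by simp
    qed
  qed
  have "continuous_on UNIV (\<lambda>x. (1 + h x) powr r)" if "continuous_on UNIV h" "\<forall>x. \<bar>h x\<bar> \<le> 1/2" for h :: "real^2 \<Rightarrow> real"
  proof (intro continuous_intros that ballI)
    fix x show "1 + h x \<noteq> 0" using that(2)[rule_format, of x] by (simp add: abs_le_iff)
  qed
  with b show ?case by (intro exI[of _ "2 powr \<bar>r\<bar>"]) auto
next
  case (Suc n)
  obtain C where C: "C \<ge> 0" "\<And>h \<mu>. 0 \<le> \<mu> \<Longrightarrow> bd UNIV n (1/2) \<mu> h \<Longrightarrow> bd UNIV n C \<mu> (\<lambda>x. (1 + h x) powr (r - 1))"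
    using Suc by blast
  obtain C0 where C0: "C0 \<ge> 0" "\<And>h \<mu>. 0 \<le> \<mu> \<Longrightarrow> bd UNIV n (1/2) \<mu> h \<Longrightarrow> bd UNIV n C0 \<mu> (\<lambda>x. (1 + h x) powr r)"
    using Suc by blast
  let ?C = "C0 + \<bar>r\<bar> * (2^n * C * (1/2))"
  have Cp: "?C \<ge> 0" using C(1) C0(1) by simp
  show ?case
  proof (intro exI[of _ ?C] conjI allI impI Cp)
    fix h \<mu> assume mu: "0 \<le> (\<mu>::real)" and h: "bd UNIV (Suc n) (1/2) \<mu> h"
    have hb: "\<bar>h x\<bar> \<le> 1/2" for x using h by auto
    have pos: "0 < 1 + h x" for x using hb[of x] by (simp add: abs_le_iff)
    have d: "((\<lambda>t. (1 + t) powr r) has_real_derivative r * (1 + h x) powr (r - 1)) (at (h x))" for x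
      using pos[of x] by (auto intro!: derivative_eq_intros)
    have hd: "h differentiable (at x)" for x using h by auto
    have p: "pd i (\<lambda>x. (1 + h x) powr r) = (\<lambda>x. r * ((1 + h x) powr (r - 1) * pd i h x))" for i
      using pd_chain(1)[OF hd d] by (auto simp: mult.assoc)
    have hn: "bd UNIV n (1/2) \<mu> h" using bd_le[OF h] by simp
    have "bd UNIV n (\<bar>r\<bar> * (2^n * C * (1/2 * \<mu>))) \<mu> (pd i (\<lambda>x. (1 + h x) powr r))" for i
      unfolding p using bd_cmult[OF bd_mult[OF C(2)[OF mu hn] bd_pd[OF h]]] .
    then have "bd UNIV n (?C * \<mu>) \<mu> (pd i (\<lambda>x. (1 + h x) powr r))" for i
      by (rule bd_mono) (use mu C0(1) C(1) in \<open>auto simp: algebra_simps\<close>)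
    moreover have "\<bar>(1 + h x) powr r\<bar> \<le> ?C" for x
      using bd_bound[OF C0(2)[OF mu hn], of x] C(1)
      by (smt (verit) UNIV_I mult_nonneg_nonneg abs_ge_zero zero_le_power divide_nonneg_nonneg)
    ultimately show "bd UNIV (Suc n) ?C \<mu> (\<lambda>x. (1 + h x) powr r)"
      using pd_chain(2)[OF hd d] by auto
  qed
qed

text \<open>Openness carries the vanishing over to all derivatives. It is used to continue a product
  with a cutoff by zero.\<close>

lemma bd_zero_open:
  assumes "open W" "\<And>x. x \<in> W \<Longrightarrow> f x = 0" "bd {} n 0 0 f"
  shows "bd W n 0 \<mu> f"
  using assms(2,3)
proof (induction n arbitrary: f)
  case (Suc n)
  have "pd i f x = 0" if "x \<in> W" for i x
    using pd_cong_open[OF assms(1) that, of f "\<lambda>x. 0" i] Suc.prems by auto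
  then have "bd W n 0 \<mu> (pd i f)" for i using Suc by auto
  then show ?case using Suc.prems by auto
qed auto

section \<open>Averages along coordinate directions\<close>

text \<open>The segment is parametrised by the unit interval, so that derivatives pass under an
  integral with fixed limits. The weight \<open>q\<close> is 1 for a box average and
  \<open>1 - s\<close> for the kernel that arises from integration by parts.\<close>

definition av :: "(real \<Rightarrow> real) \<Rightarrow> 2 \<Rightarrow> real \<Rightarrow> real \<Rightarrow> (real^2 \<Rightarrow> real) \<Rightarrow> real^2 \<Rightarrow> real" where
  "av q i a b f x = integral {0..1} (\<lambda>s. q s * f (x + (a + s * b) *\<^sub>R axis i 1))"

lemma av_integrand_cont:
  fixes f :: "real^2 \<Rightarrow> real"
  assumes q: "continuous_on {0..1} q" and f: "continuous_on UNIV f"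
  shows "continuous_on (U \<times> {0..1}) (\<lambda>(x, s). q s * f (x + (a + s * b) *\<^sub>R axis i 1))"
proof -
  have "continuous_on (U \<times> {0..1}) (\<lambda>z. q (snd z))"
    by (rule continuous_on_compose2[OF q]) (auto intro!: continuous_intros)
  moreover have "continuous_on (U \<times> {0..1}) (\<lambda>z::(real^2)\<times>real. f (fst z + (a + snd z * b) *\<^sub>R axis i 1))"
    by (rule continuous_on_compose2[OF f _ subset_UNIV]) (intro continuous_intros)
  ultimately show ?thesis
    by (auto intro!: continuous_on_mult simp: case_prod_unfold)
qed

lemma av_integrable:
  fixes f :: "real^2 \<Rightarrow> real"
  assumes q: "continuous_on {0..1} q" and f: "continuous_on UNIV f"
  shows "(\<lambda>s. q s * f (x + (a + s * b) *\<^sub>R axis i 1)) integrable_on {0..1}"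
proof (rule integrable_continuous_real, intro continuous_on_mult q)
  show "continuous_on {0..1} (\<lambda>s. f (x + (a + s * b) *\<^sub>R axis i 1))"
    by (rule continuous_on_compose2[OF f]) (auto intro!: continuous_intros)
qed

lemma av_cont:
  assumes q: "continuous_on {0..1} q" and f: "continuous_on UNIV f"
  shows "continuous_on UNIV (av q i a b f)"
proof -
  have "continuous_on UNIV (\<lambda>x. integral (cbox 0 1) (\<lambda>s. q s * f (x + (a + s * b) *\<^sub>R axis i 1)))"
    by (rule integral_continuous_on_param) (use av_integrand_cont[OF q f, of UNIV] in simp)
  then show ?thesis by (simp add: av_def[abs_def])
qed

lemma av_line:
  assumes q: "continuous_on {0..1} q" and f: "continuous_on UNIV f"
    and D: "\<And>y. ((\<lambda>t. f (y + t *\<^sub>R axis j 1)) has_real_derivative g y) (at 0)"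
    and g: "continuous_on UNIV g"
  shows "((\<lambda>t. av q i a b f (x + t *\<^sub>R axis j 1)) has_real_derivative av q i a b g x) (at 0)"
proof -
  have line: "((\<lambda>t. f (y + t *\<^sub>R axis j 1)) has_real_derivative g (y + t *\<^sub>R axis j 1)) (at t)" for y t
  proof -
    have D1: "((\<lambda>s. s - t) has_real_derivative 1) (at t)"
      by (auto intro!: derivative_eq_intros)
    have "((\<lambda>s. f ((y + t *\<^sub>R axis j 1) + (s - t) *\<^sub>R axis j 1)) has_real_derivative
            g (y + t *\<^sub>R axis j 1)) (at t)"
      using DERIV_chain2[of "\<lambda>s. f ((y + t *\<^sub>R axis j 1) + s *\<^sub>R axis j 1)"
          "g (y + t *\<^sub>R axis j 1)" "\<lambda>s. s - t" t 1 UNIV] D1 D[of "y + t *\<^sub>R axis j 1"] by simp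
    moreover have "(y + t *\<^sub>R axis j 1) + (s - t) *\<^sub>R axis j 1 = y + s *\<^sub>R axis j 1" for s
      by (simp add: algebra_simps)
    ultimately show ?thesis by simp
  qed
  have c: "continuous_on (UNIV \<times> {0..1}) (\<lambda>(t, s). q s * g (x + t *\<^sub>R axis j 1 + (a + s * b) *\<^sub>R axis i 1))"
  proof -
    have "continuous_on (UNIV \<times> {0..1}) (\<lambda>z. q (snd z))"
      by (rule continuous_on_compose2[OF q]) (auto intro!: continuous_intros)
    moreover have "continuous_on (UNIV \<times> {0..1}) (\<lambda>z::real\<times>real. g (x + fst z *\<^sub>R axis j 1 + (a + snd z * b) *\<^sub>R axis i 1))"
      by (rule continuous_on_compose2[OF g]) (auto intro!: continuous_intros)
    ultimately show ?thesis
      by (auto intro!: continuous_on_mult simp: case_prod_unfold)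
  qed
  have "((\<lambda>t. integral (cbox 0 1) (\<lambda>s. q s * f (x + t *\<^sub>R axis j 1 + (a + s * b) *\<^sub>R axis i 1)))
      has_field_derivative integral (cbox 0 1) (\<lambda>s. q s * g (x + 0 *\<^sub>R axis j 1 + (a + s * b) *\<^sub>R axis i 1))) (at 0 within UNIV)"
  proof (rule leibniz_rule_field_derivative)
    fix t s :: real
    have "((\<lambda>t. q s * f (x + (a + s * b) *\<^sub>R axis i 1 + t *\<^sub>R axis j 1)) has_real_derivative
        q s * g (x + (a + s * b) *\<^sub>R axis i 1 + t *\<^sub>R axis j 1)) (at t)"
      by (rule DERIV_cmult[OF line])
    then show "((\<lambda>t. q s * f (x + t *\<^sub>R axis j 1 + (a + s * b) *\<^sub>R axis i 1)) has_real_derivative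
        q s * g (x + t *\<^sub>R axis j 1 + (a + s * b) *\<^sub>R axis i 1)) (at t within UNIV)"
      by (simp add: ac_simps)
  next
    show "(\<lambda>s. q s * f (x + t *\<^sub>R axis j 1 + (a + s * b) *\<^sub>R axis i 1)) integrable_on cbox 0 1" for t
      using av_integrable[OF q f] by simp
  qed (use c in auto)
  then show ?thesis by (simp add: av_def[abs_def])
qed

lemma av_pd:
  assumes q: "continuous_on {0..1} q" and f: "\<And>x. f differentiable (at x)" "\<And>j. continuous_on UNIV (pd j f)"
  shows "av q i a b f differentiable (at x)" "pd j (av q i a b f) = av q i a b (pd j f)"
proof -
  have c: "continuous_on UNIV f"
    using f(1) by (simp add: continuous_on_eq_continuous_at differentiable_imp_continuous_within)
  have D: "((\<lambda>t. f (y + t *\<^sub>R axis j 1)) has_real_derivative pd j f y) (at 0)" for y j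
    using DERIV_line[of f y 0 j] f(1) by simp
  note * = differentiable_if_continuous_partials[where f = "av q i a b f" and g = "\<lambda>j. av q i a b (pd j f)",
      OF av_line[OF q c D f(2)] av_cont[OF q f(2)]]
  show "av q i a b f differentiable (at x)" "pd j (av q i a b f) = av q i a b (pd j f)"
    using * by auto
qed

lemma av_bound:
  assumes q: "continuous_on {0..1} q" "\<And>s. s \<in> {0..1} \<Longrightarrow> \<bar>q s\<bar> \<le> 1" and f: "continuous_on UNIV f"
    and K: "\<And>s. s \<in> {0..1} \<Longrightarrow> \<bar>f (x + (a + s * b) *\<^sub>R axis i 1)\<bar> \<le> K"
  shows "\<bar>av q i a b f x\<bar> \<le> K"
proof -
  have "0 \<le> K" using K[of 0] by auto
  then have "norm (integral (cbox 0 1) (\<lambda>s. q s * f (x + (a + s * b) *\<^sub>R axis i 1))) \<le> K * Henstock_Kurzweil_Integration.content (cbox 0 (1::real))"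
  proof (rule integrable_bound)
    show "(\<lambda>s. q s * f (x + (a + s * b) *\<^sub>R axis i 1)) integrable_on cbox 0 1"
      using av_integrable[OF q(1) f] by simp
    show "norm (q s * f (x + (a + s * b) *\<^sub>R axis i 1)) \<le> K" if "s \<in> cbox 0 1" for s
      using mult_mono[OF q(2) K, of s s] that by (simp add: abs_mult)
  qed
  then show ?thesis by (simp add: av_def)
qed

lemma av_bd:
  assumes q: "continuous_on {0..1} q" "\<And>s. s \<in> {0..1} \<Longrightarrow> \<bar>q s\<bar> \<le> 1"
    and UV: "\<And>x s. x \<in> U \<Longrightarrow> s \<in> {0..1} \<Longrightarrow> x + (a + s * b) *\<^sub>R axis i 1 \<in> V"
  shows "bd V n K \<mu> f \<Longrightarrow> bd U n K \<mu> (av q i a b f)"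
proof (induction n arbitrary: K f)
  case 0
  then have "continuous_on UNIV f" by simp
  with 0 show ?case using av_cont[OF q(1)] av_bound[OF q] UV by auto
next
  case (Suc n)
  have f: "\<And>x. f differentiable (at x)" "\<And>j. continuous_on UNIV (pd j f)"
    using Suc.prems bd_cont[OF bd_pd[OF Suc.prems]] by auto
  have "bd U n (K * \<mu>) \<mu> (pd j (av q i a b f))" for j
    unfolding av_pd(2)[OF q(1) f] by (rule Suc.IH[OF bd_pd[OF Suc.prems]])
  moreover have "\<bar>av q i a b f x\<bar> \<le> K" if "x \<in> U" for x
    using av_bound[OF q bd_cont[OF Suc.prems]] UV that Suc.prems by auto
  ultimately show ?case using av_pd(1)[OF q(1) f] by auto
qed

lemma av_lin:
  assumes q: "continuous_on {0..1} q" and f: "continuous_on UNIV f" "continuous_on UNIV g"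
  shows "av q i a b (\<lambda>x. c * f x + d * g x) = (\<lambda>x. c * av q i a b f x + d * av q i a b g x)"
proof
  fix x
  have "integral {0..1} (\<lambda>s. q s * (c * f (x + (a + s * b) *\<^sub>R axis i 1) + d * g (x + (a + s * b) *\<^sub>R axis i 1)))
    = integral {0..1} (\<lambda>s. c * (q s * f (x + (a + s * b) *\<^sub>R axis i 1)) + d * (q s * g (x + (a + s * b) *\<^sub>R axis i 1)))"
    by (simp add: algebra_simps)
  also have "\<dots> = c * av q i a b f x + d * av q i a b g x"
    unfolding av_def
    by (subst integral_add) (auto intro!: integrable_on_mult_right av_integrable[OF q] f)
  finally show "av q i a b (\<lambda>x. c * f x + d * g x) x = c * av q i a b f x + d * av q i a b g x"
    by (simp add: av_def)
qed

text \<open>The first identity is the fundamental theorem of calculus on the segment. The second is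
  integration by parts against the weight \<open>1 - s\<close>, which is 1 at the base point and 0
  at the far end.\<close>

lemma av_pd_same:
  assumes f: "\<And>x. f differentiable (at x)" "\<And>j. continuous_on UNIV (pd j f)"
  shows "b * av (\<lambda>_. 1) i a b (pd i f) x = f (x + (a + b) *\<^sub>R axis i 1) - f (x + a *\<^sub>R axis i 1)"
    and "b * av (\<lambda>s. 1 - s) i 0 b (pd i f) x = av (\<lambda>_. 1) i 0 b f x - f x"
proof -
  have c: "continuous_on UNIV f"
    using f(1) by (simp add: continuous_on_eq_continuous_at differentiable_imp_continuous_within)
  have D: "((\<lambda>s. f (x + (a + s * b) *\<^sub>R axis i 1)) has_real_derivative b * pd i f (x + (a + s * b) *\<^sub>R axis i 1)) (at s)" for s a
  proof -
    have "((\<lambda>s. a + s * b) has_real_derivative b) (at s)" by (auto intro!: derivative_eq_intros)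
    from DERIV_chain2[OF DERIV_line[OF f(1)] this] show ?thesis by (simp add: mult.commute)
  qed
  have "((\<lambda>s. b * pd i f (x + (a + s * b) *\<^sub>R axis i 1)) has_integral
     (f (x + (a + 1 * b) *\<^sub>R axis i 1) - f (x + (a + 0 * b) *\<^sub>R axis i 1))) {0..1}"
    by (rule fundamental_theorem_of_calculus)
      (use D in \<open>auto simp: has_real_derivative_iff_has_vector_derivative intro: has_vector_derivative_at_within\<close>)
  then show "b * av (\<lambda>_. 1) i a b (pd i f) x = f (x + (a + b) *\<^sub>R axis i 1) - f (x + a *\<^sub>R axis i 1)"
    by (simp add: av_def integral_unique flip: integral_mult_right)
  have D2: "((\<lambda>s. (1 - s) * f (x + (0 + s * b) *\<^sub>R axis i 1)) has_real_derivative
      b * ((1 - s) * pd i f (x + (0 + s * b) *\<^sub>R axis i 1)) - f (x + (0 + s * b) *\<^sub>R axis i 1)) (at s)" for s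
    by (rule derivative_eq_intros D refl | simp)+
  have "((\<lambda>s. b * ((1 - s) * pd i f (x + (0 + s * b) *\<^sub>R axis i 1)) - f (x + (0 + s * b) *\<^sub>R axis i 1)) has_integral
     ((1 - 1) * f (x + (0 + 1 * b) *\<^sub>R axis i 1) - (1 - 0) * f (x + (0 + 0 * b) *\<^sub>R axis i 1))) {0..1}"
    by (rule fundamental_theorem_of_calculus, simp)
      (use D2[unfolded has_real_derivative_iff_has_vector_derivative] in \<open>blast intro: has_vector_derivative_at_within\<close>)
  then have "integral {0..1} (\<lambda>s. b * ((1 - s) * pd i f (x + (0 + s * b) *\<^sub>R axis i 1)) - f (x + (0 + s * b) *\<^sub>R axis i 1)) = - f x"
    by (simp add: integral_unique)
  moreover have "integral {0..1} (\<lambda>s. b * ((1 - s) * pd i f (x + (0 + s * b) *\<^sub>R axis i 1)) - f (x + (0 + s * b) *\<^sub>R axis i 1))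
    = b * av (\<lambda>s. 1 - s) i 0 b (pd i f) x - av (\<lambda>_. 1) i 0 b f x"
    unfolding av_def
    using av_integrable[of "\<lambda>s. 1 - s" "pd i f" x 0 b i] av_integrable[of "\<lambda>s. 1" f x 0 b i] c f(2)
      continuous_on_diff[OF continuous_on_const continuous_on_id, of "{0..1}" "1::real"]
    by (subst integral_diff) (auto intro!: integrable_on_mult_right)
  ultimately show "b * av (\<lambda>s. 1 - s) i 0 b (pd i f) x = av (\<lambda>_. 1) i 0 b f x - f x"
    by linarith
qed

text \<open>Averaging gains a derivative in its own direction: differentiating a moving integral
  leaves the difference of the values at the two ends. This is the source of all smoothing
  below.\<close>

lemma av_line_cont:
  assumes f: "continuous_on UNIV f" and b: "0 < b"
  shows "((\<lambda>t. av (\<lambda>_. 1) i a b f (x + t *\<^sub>R axis i 1)) has_real_derivative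
     (f (x + (a + b) *\<^sub>R axis i 1) - f (x + a *\<^sub>R axis i 1)) / b) (at 0)"
proof -
  define \<phi> where "\<phi> u = f (x + u *\<^sub>R axis i 1)" for u
  have c: "continuous_on A \<phi>" for A
    unfolding \<phi>_def by (rule continuous_on_compose2[OF f]) (auto intro!: continuous_intros)
  \<comment> \<open>The margin 2 at both ends keeps \<open>t + a + s * b\<close>, for
    \<open>t\<close> between -1 and 1, inside the interval where the primitive \<open>\<Phi>\<close>
    is differentiable.\<close>
  define p where "p = a - 2"
  define r where "r = a + b + 2"
  define \<Phi> where "\<Phi> u = integral {p..u} \<phi>" for u
  have D: "(\<Phi> has_real_derivative \<phi> u) (at u)" if "p < u" "u < r" for u
    using integral_has_real_derivative[OF c[of "{p..r}"], of u] that at_within_Icc_at[of p u r]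
    unfolding \<Phi>_def by simp
  have A: "av (\<lambda>_. 1) i a b f (x + t *\<^sub>R axis i 1) = (\<Phi> (t + a + b) - \<Phi> (t + a)) / b" if "t \<in> {-1<..<1}" for t
  proof -
    have D': "((\<lambda>s. \<Phi> (t + a + s * b) / b) has_real_derivative \<phi> (t + a + s * b)) (at s)" if "s \<in> {0..1}" for s
    proof -
      have "((\<lambda>s. t + a + s * b) has_real_derivative b) (at s)" by (auto intro!: derivative_eq_intros)
      moreover have "s * b \<ge> 0" "s * b \<le> b" using that b by (auto simp: mult_left_le_one_le)
      ultimately have "((\<lambda>s. \<Phi> (t + a + s * b)) has_real_derivative \<phi> (t + a + s * b) * b) (at s)"
        using \<open>t \<in> _\<close> by (intro DERIV_chain2[OF D]) (auto simp: p_def r_def)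
      from DERIV_cdivide[OF this, of b] show ?thesis using b by simp
    qed
    have "((\<lambda>s. \<phi> (t + a + s * b)) has_integral (\<Phi> (t + a + 1 * b) / b - \<Phi> (t + a + 0 * b) / b)) {0..1}"
      by (rule fundamental_theorem_of_calculus)
        (use D' in \<open>auto simp: has_real_derivative_iff_has_vector_derivative intro: has_vector_derivative_at_within\<close>)
    then have "integral {0..1} (\<lambda>s. \<phi> (t + a + s * b)) = (\<Phi> (t + a + b) - \<Phi> (t + a)) / b"
      by (simp add: integral_unique diff_divide_distrib)
    then show ?thesis by (simp add: av_def \<phi>_def algebra_simps)
  qed
  have "((\<lambda>t. (\<Phi> (t + a + b) - \<Phi> (t + a)) / b) has_real_derivative (\<phi> (a + b) - \<phi> a) / b) (at 0)"
  proof (rule DERIV_cdivide, rule DERIV_diff)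
    show "((\<lambda>t. \<Phi> (t + a + b)) has_real_derivative \<phi> (a + b)) (at 0)"
    proof -
      have "((\<lambda>t. t + a + b) has_real_derivative 1) (at 0)"
        by (auto intro!: derivative_eq_intros)
      then show ?thesis
        using DERIV_chain2[of \<Phi> "\<phi> (a + b)" "\<lambda>t. t + a + b" 0 1 UNIV] D[of "a + b"] b
        by (simp add: p_def r_def)
    qed
    show "((\<lambda>t. \<Phi> (t + a)) has_real_derivative \<phi> a) (at 0)"
    proof -
      have "((\<lambda>t. t + a) has_real_derivative 1) (at 0)"
        by (auto intro!: derivative_eq_intros)
      then show ?thesis
        using DERIV_chain2[of \<Phi> "\<phi> a" "\<lambda>t. t + a" 0 1 UNIV] D[of a] b
        by (simp add: p_def r_def)
    qed
  qed
  then show ?thesis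
    unfolding \<phi>_def[symmetric]
    by (rule has_field_derivative_transform_within_open[of _ _ _ "{-1<..<1}"]) (use A in auto)
qed

section \<open>Mollification by centred box averages, its error and its commutator with
  products\<close>

definition mol :: "real \<Rightarrow> (real^2 \<Rightarrow> real) \<Rightarrow> real^2 \<Rightarrow> real" where
  "mol h f = av (\<lambda>_. 1) 1 (-h) (2*h) (av (\<lambda>_. 1) 2 (-h) (2*h) f)"

lemma mol_cont: "continuous_on UNIV f \<Longrightarrow> continuous_on UNIV (mol h f)"
  unfolding mol_def by (intro av_cont) auto

text \<open>In each direction the corresponding average differentiates to a difference quotient.
  Direction 2 is averaged on the inside, so its quotient stands under the outer average.\<close>

lemma mol_C1:
  fixes f :: "real^2 \<Rightarrow> real"
  assumes f: "continuous_on UNIV f" and h: "0 < h"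
  shows "mol h f differentiable (at x)"
    and "pd 1 (mol h f) = (\<lambda>x. (1/(2*h)) * (av (\<lambda>_. 1) 2 (-h) (2*h) f (x + h *\<^sub>R axis 1 1) - av (\<lambda>_. 1) 2 (-h) (2*h) f (x + (-h) *\<^sub>R axis 1 1)))"
    and "pd 2 (mol h f) = av (\<lambda>_. 1) 1 (-h) (2*h) (\<lambda>x. (1/(2*h)) * (f (x + h *\<^sub>R axis 2 1) - f (x + (-h) *\<^sub>R axis 2 1)))"
proof -
  let ?A = "av (\<lambda>_. 1) 2 (-h) (2*h) f"
  have A: "continuous_on UNIV ?A" by (intro av_cont f) auto
  have ct: "continuous_on UNIV (\<lambda>x::real^2. f (x + c))" for c
    by (rule continuous_on_compose2[OF f]) (auto intro!: continuous_intros)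
  have cA: "continuous_on UNIV (\<lambda>x::real^2. ?A (x + c))" for c
    by (rule continuous_on_compose2[OF A]) (auto intro!: continuous_intros)
  define g where "g j = (if j = 1 then (\<lambda>x. (1/(2*h)) * (?A (x + h *\<^sub>R axis 1 1) - ?A (x + (-h) *\<^sub>R axis 1 1)))
    else av (\<lambda>_. 1) 1 (-h) (2*h) (\<lambda>x. (1/(2*h)) * (f (x + h *\<^sub>R axis 2 1) - f (x + (-h) *\<^sub>R axis 2 1))))" for j :: 2
  have c2: "continuous_on UNIV (\<lambda>x. (1/(2*h)) * (f (x + h *\<^sub>R axis 2 1) - f (x + (-h) *\<^sub>R axis 2 1)))"
    by (intro continuous_intros ct)
  have D1: "((\<lambda>t. mol h f (x + t *\<^sub>R axis 1 1)) has_real_derivative g 1 x) (at 0)" for x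
    using av_line_cont[OF A, of "2*h" 1 "-h" x] h by (simp add: mol_def g_def)
  have D2': "((\<lambda>t. ?A (x + t *\<^sub>R axis 2 1)) has_real_derivative ((1/(2*h)) * (f (x + h *\<^sub>R axis 2 1) - f (x + (-h) *\<^sub>R axis 2 1)))) (at 0)" for x
    using av_line_cont[OF f, of "2*h" 2 "-h" x] h by simp
  have D2: "((\<lambda>t. mol h f (x + t *\<^sub>R axis 2 1)) has_real_derivative g 2 x) (at 0)" for x
    unfolding mol_def g_def using av_line[OF _ A D2' c2, of "\<lambda>_. 1" 1 "-h" "2*h" x] by simp
  have D: "((\<lambda>t. mol h f (x + t *\<^sub>R axis j 1)) has_real_derivative g j x) (at 0)" for x j
    using D1 D2 exhaust_2[of j] by auto
  have cg: "continuous_on UNIV (g j)" for j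
  proof (cases "j = 1")
    case True
    show ?thesis unfolding g_def if_P[OF True] by (intro continuous_intros cA)
  next
    case False
    show ?thesis unfolding g_def if_not_P[OF False] by (intro av_cont c2) simp
  qed
  note * = differentiable_if_continuous_partials[OF D cg]
  show "mol h f differentiable (at x)" by (rule *(1))
  show "pd 1 (mol h f) = (\<lambda>x. (1/(2*h)) * (?A (x + h *\<^sub>R axis 1 1) - ?A (x + (-h) *\<^sub>R axis 1 1)))"
    using *(2)[of 1] by (simp add: g_def fun_eq_iff)
  show "pd 2 (mol h f) = av (\<lambda>_. 1) 1 (-h) (2*h) (\<lambda>x. (1/(2*h)) * (f (x + h *\<^sub>R axis 2 1) - f (x + (-h) *\<^sub>R axis 2 1)))"
    using *(2)[of 2] by (simp add: g_def fun_eq_iff)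
qed

text \<open>One application raises the order by one with the same constant: a difference quotient
  over length \<open>2 * h\<close> costs at most 1/h, and \<open>1 \<le> \<mu> * h\<close> makes
  this affordable at frequency \<mu>. The set \<open>V'\<close> lies halfway, as each of the two
  averages moves a point by at most \<open>h\<close>.\<close>

lemma mol_bd:
  assumes UV: "\<And>x. x \<in> U \<Longrightarrow> cball x (2*h) \<subseteq> V" and h: "0 < h" "1 \<le> \<mu> * h" and K: "0 \<le> K"
    and f: "bd V n K \<mu> f"
  shows "bd U (Suc n) K \<mu> (mol h f)"
proof -
  define V' where "V' = {y. \<exists>x\<in>U. dist x y \<le> h}"
  let ?A = "av (\<lambda>_. 1) 2 (-h) (2*h) f"
  have fc: "continuous_on UNIV f" by (rule bd_cont[OF f])
  have ab: "\<bar>s * (2 * h) - h\<bar> \<le> h" "\<bar>- h + s * (2 * h)\<bar> \<le> h" if "0 \<le> s" "s \<le> 1" for s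
    using that h(1) mult_left_le_one_le[of h s] mult_nonneg_nonneg[of s h] by (auto simp: abs_le_iff)
  have V'V: "y + c *\<^sub>R axis j 1 \<in> V" if "y \<in> V'" "\<bar>c\<bar> \<le> h" for y c j
  proof -
    obtain x where x: "x \<in> U" "dist x y \<le> h" using \<open>y \<in> V'\<close> V'_def by auto
    have "dist x (y + c *\<^sub>R axis j 1) \<le> dist x y + dist y (y + c *\<^sub>R axis j 1)" by (rule dist_triangle)
    also have "\<dots> \<le> 2 * h" using x(2) that(2) by (simp add: dist_norm)
    finally show ?thesis using UV[OF x(1)] by auto
  qed
  have UV': "x + c *\<^sub>R axis j 1 \<in> V'" if "x \<in> U" "\<bar>c\<bar> \<le> h" for x c j
    unfolding V'_def using that by (auto simp: dist_norm intro!: bexI[of _ x])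
  have A: "bd V' n K \<mu> ?A"
    by (rule av_bd[OF _ _ _ f]) (auto intro!: V'V ab)
  have m: "bd U n K \<mu> (mol h f)"
    unfolding mol_def by (rule av_bd[OF _ _ _ A]) (auto intro!: UV' ab)
  have mu: "0 \<le> \<mu>" using h by (smt (verit) mult_neg_pos)
  have K': "1/(2*h) * (K + K) \<le> K * \<mu>"
    using h K mult_left_mono[OF h(2) K] by (simp add: field_simps)
  have hh: "\<bar>1/(2*h)\<bar> = 1/(2*h)" using h by simp
  have p1: "bd U n (K * \<mu>) \<mu> (pd 1 (mol h f))"
  proof -
    have "bd U n (\<bar>1/(2*h)\<bar> * (K + K)) \<mu> (pd 1 (mol h f))"
      unfolding mol_C1(2)[OF fc h(1)]
      by (intro bd_cmult bd_minus bd_translate[OF A] UV') (use h in auto)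
    then show ?thesis by (rule bd_mono) (use K' hh mu K in auto)
  qed
  have p2: "bd U n (K * \<mu>) \<mu> (pd 2 (mol h f))"
  proof -
    have "bd V' n (\<bar>1/(2*h)\<bar> * (K + K)) \<mu> (\<lambda>x. (1/(2*h)) * (f (x + h *\<^sub>R axis 2 1) - f (x + (-h) *\<^sub>R axis 2 1)))"
      by (intro bd_cmult bd_minus bd_translate[OF f] V'V) (use h in auto)
    then have "bd V' n (K * \<mu>) \<mu> (\<lambda>x. (1/(2*h)) * (f (x + h *\<^sub>R axis 2 1) - f (x + (-h) *\<^sub>R axis 2 1)))"
      by (rule bd_mono) (use K' hh mu K in auto)
    then show ?thesis
      unfolding mol_C1(3)[OF fc h(1)]
      by (rule av_bd[rotated 3]) (auto intro!: UV' ab)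
  qed
  have "bd U n (K * \<mu>) \<mu> (pd i (mol h f))" for i
    using p1 p2 exhaust_2[of i] by auto
  then show ?thesis using mol_C1(1)[OF fc h(1)] bd_bound[OF m] by auto
qed

lemma C1D:
  assumes "bd U (Suc n) K \<mu> f"
  shows "\<And>x. f differentiable (at x)" "\<And>j. continuous_on UNIV (pd j f)"
  using assms bd_cont[OF bd_pd[OF assms]] by auto

lemma mol_pd:
  assumes "bd {} (Suc n) 0 0 f"
  shows "bd {} (Suc n) 0 0 (mol h f)" "pd j (mol h f) = mol h (pd j f)"
proof -
  have A: "bd {} (Suc n) 0 0 (av (\<lambda>_. 1) i a b g)" if "bd {} (Suc n) 0 0 g" for i a b g
    by (rule av_bd[OF _ _ _ that]) auto
  show "bd {} (Suc n) 0 0 (mol h f)" unfolding mol_def by (intro A assms)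
  show "pd j (mol h f) = mol h (pd j f)"
    unfolding mol_def
    using av_pd(2)[OF _ C1D[OF A[OF assms]]] av_pd(2)[OF _ C1D[OF assms]] by simp
qed

lemma mol_pow_pd:
  assumes "bd {} (Suc m) 0 0 f"
  shows "bd {} (Suc m) 0 0 ((mol h ^^ n) f)" "pd j ((mol h ^^ n) f) = (mol h ^^ n) (pd j f)"
proof -
  have *: "bd {} (Suc m) 0 0 ((mol h ^^ n) f) \<and> pd j ((mol h ^^ n) f) = (mol h ^^ n) (pd j f)"
    by (induction n) (use assms mol_pd in auto)
  show "bd {} (Suc m) 0 0 ((mol h ^^ n) f)" "pd j ((mol h ^^ n) f) = (mol h ^^ n) (pd j f)"
    using * by auto
qed

lemma mol_pow_bd:
  assumes h: "0 < h" "1 \<le> \<mu> * h" and K: "0 \<le> K" and f: "bd V m K \<mu> f"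
  shows "(\<And>x. x \<in> U \<Longrightarrow> cball x (2 * h * n) \<subseteq> V) \<Longrightarrow> bd U (m + n) K \<mu> ((mol h ^^ n) f)"
proof (induction n arbitrary: U)
  case 0
  have mu: "0 \<le> \<mu>" using h by (smt (verit) mult_neg_pos)
  show ?case using bd_mono[OF f, of U K \<mu>] 0 mu K by auto
next
  case (Suc n)
  define U' where "U' = {y. \<exists>x\<in>U. dist x y \<le> 2 * h}"
  have "bd U' (m + n) K \<mu> ((mol h ^^ n) f)"
  proof (rule Suc.IH)
    fix y assume "y \<in> U'"
    then obtain x where x: "x \<in> U" "dist x y \<le> 2 * h" by (auto simp: U'_def)
    have "cball y (2 * h * n) \<subseteq> cball x (2 * h * Suc n)"
    proof
      fix z assume "z \<in> cball y (2 * h * n)"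
      then show "z \<in> cball x (2 * h * Suc n)"
        using dist_triangle[of x z y] x(2) by (simp add: algebra_simps)
    qed
    then show "cball y (2 * h * n) \<subseteq> V" using Suc.prems[OF x(1)] by blast
  qed
  then have "bd U (Suc (m + n)) K \<mu> (mol h ((mol h ^^ n) f))"
    by (rule mol_bd[OF _ h K, rotated]) (auto simp: U'_def)
  then show ?case by simp
qed

lemma mol_pow_cont: "continuous_on UNIV f \<Longrightarrow> continuous_on UNIV ((mol h ^^ n) f)"
  by (induction n) (auto intro: mol_cont)

lemma mol_pow_bound:
  assumes h: "0 < h" and f: "continuous_on UNIV f"
    and K: "\<And>y. dist x y \<le> 2 * h * n \<Longrightarrow> \<bar>f y\<bar> \<le> K"
  shows "\<bar>(mol h ^^ n) f x\<bar> \<le> K"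
proof -
  have "0 \<le> K" using K[of x] h by auto
  have "bd {x} (0 + n) K (1/h) ((mol h ^^ n) f)"
    by (rule mol_pow_bd[of h "1/h" K "cball x (2 * h * n)"]) (use h f K \<open>0 \<le> K\<close> in auto)
  from bd_bound[OF this] show ?thesis by simp
qed

lemma mol_lin:
  assumes "continuous_on UNIV f" "continuous_on UNIV g"
  shows "mol h (\<lambda>x. c * f x + d * g x) = (\<lambda>x. c * mol h f x + d * mol h g x)"
  unfolding mol_def using assms by (simp add: av_lin av_cont)

lemma mol_pow_lin:
  assumes "continuous_on UNIV f" "continuous_on UNIV g"
  shows "(mol h ^^ n) (\<lambda>x. c * f x + d * g x) = (\<lambda>x. c * (mol h ^^ n) f x + d * (mol h ^^ n) g x)"
  by (induction n) (simp_all add: mol_lin mol_pow_cont assms)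

lemma mol_pow_const: "(mol h ^^ n) (\<lambda>x. c) = (\<lambda>x. c)"
proof -
  have "mol h (\<lambda>x. c) = (\<lambda>x. c)" by (simp add: mol_def fun_eq_iff av_def)
  then show ?thesis by (induction n) auto
qed

text \<open>Reflecting the integration variable leaves the integral over a centred segment
  unchanged. The mean of both forms contains only second differences of \<open>f\<close>, so terms
  of first order drop out.\<close>

lemma av_symmetric:
  assumes f: "continuous_on UNIV f"
  shows "av (\<lambda>_. 1) i (-h) (2*h) f x =
    integral {0..1} (\<lambda>s. (f (x + (s * (2*h) - h) *\<^sub>R axis i 1) + f (x - (s * (2*h) - h) *\<^sub>R axis i 1)) / 2)"
proof -
  let ?F = "\<lambda>s. f (x + (s * (2*h) - h) *\<^sub>R axis i 1)"
  let ?G = "\<lambda>s. f (x - (s * (2*h) - h) *\<^sub>R axis i 1)"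
  have "integral {0-1..1-1} (\<lambda>s::real. ?F (s + 1)) = integral {0..1} ?F"
    by (rule integral_shift_real_ivl)
  moreover have "integral {-1..0} (\<lambda>s. ?G (- s)) = integral {0..1} ?G"
    using Henstock_Kurzweil_Integration.integral_reflect_real[of 1 0 ?G] by (simp only: minus_zero)
  moreover have "?G (- s) = ?F (s + 1)" for s
    by (simp add: algebra_simps)
  ultimately have e: "integral {0..1} ?F = integral {0..1} ?G" by simp
  have F: "?F integrable_on {0..1}"
    using av_integrable[of "\<lambda>_. 1" f x "-h" "2*h" i] f by (simp add: algebra_simps)
  have G: "?G integrable_on {0..1}"
    using av_integrable[of "\<lambda>_. 1" f x "h" "-2*h" i] f by (simp add: algebra_simps)
  have "integral {0..1} (\<lambda>s. (?F s + ?G s) / 2) = (integral {0..1} ?F + integral {0..1} ?G) / 2"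
    by (simp add: integral_add[OF F G])
  also have "\<dots> = integral {0..1} ?F" using e by simp
  also have "\<dots> = av (\<lambda>_. 1) i (-h) (2*h) f x" by (simp add: av_def algebra_simps)
  finally show ?thesis by simp
qed

lemma av_err:
  assumes f: "continuous_on UNIV f" and h: "0 < h"
    and k: "\<And>t. \<bar>t\<bar> \<le> h \<Longrightarrow> \<bar>f (x + t *\<^sub>R axis i 1) + f (x - t *\<^sub>R axis i 1) - 2 * f x\<bar> \<le> 2 * \<kappa>"
  shows "\<bar>av (\<lambda>_. 1) i (-h) (2*h) f x - f x\<bar> \<le> \<kappa>"
proof -
  let ?g = "\<lambda>s. (f (x + (s * (2*h) - h) *\<^sub>R axis i 1) + f (x - (s * (2*h) - h) *\<^sub>R axis i 1)) / 2"
  have c: "continuous_on {0..1} ?g"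
    by (intro continuous_intros continuous_on_compose2[OF f _ subset_UNIV]) auto
  have "0 \<le> \<kappa>" using k[of 0] h by simp
  then have "norm (integral (cbox 0 1) (\<lambda>s. ?g s - f x)) \<le> \<kappa> * Henstock_Kurzweil_Integration.content (cbox 0 (1::real))"
  proof (rule integrable_bound)
    show "(\<lambda>s. ?g s - f x) integrable_on cbox 0 1"
      using c by (auto intro!: integrable_continuous_real continuous_intros)
    show "norm (?g s - f x) \<le> \<kappa>" if "s \<in> cbox 0 1" for s
    proof -
      have "\<bar>s * (2*h) - h\<bar> \<le> h"
        using that h mult_left_le_one_le[of h s] mult_nonneg_nonneg[of s h] by (auto simp: abs_le_iff)
      from k[OF this] show ?thesis by (simp add: field_simps abs_le_iff)
    qed
  qed
  moreover have "integral {0..1} (\<lambda>s. ?g s - f x) = integral {0..1} ?g - f x"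
    using integrable_continuous_real[OF c] by (subst integral_diff) auto
  ultimately show ?thesis unfolding av_symmetric[OF f] by simp
qed

lemma av_close:
  assumes f: "continuous_on UNIV f" and g: "continuous_on UNIV g"
    and K: "\<And>s. s \<in> {0..1} \<Longrightarrow> \<bar>g (x + (a + s * b) *\<^sub>R axis i 1) - f (x + (a + s * b) *\<^sub>R axis i 1)\<bar> \<le> K"
    and e: "\<bar>av (\<lambda>_. 1) i a b f x - f x\<bar> \<le> \<kappa>"
  shows "\<bar>av (\<lambda>_. 1) i a b g x - f x\<bar> \<le> K + \<kappa>"
proof -
  have "av (\<lambda>_. 1) i a b (\<lambda>x. 1 * g x + (-1) * f x) x = 1 * av (\<lambda>_. 1) i a b g x + (-1) * av (\<lambda>_. 1) i a b f x"
    by (subst av_lin[OF _ g f]) auto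
  moreover have "\<bar>av (\<lambda>_. 1) i a b (\<lambda>x. 1 * g x + (-1) * f x) x\<bar> \<le> K"
    by (rule av_bound) (use K f g in \<open>auto intro!: continuous_intros\<close>)
  ultimately show ?thesis using e by linarith
qed

text \<open>The power consists of 2n averages. None of them enlarges an error already present, and
  each adds the error \<kappa> of averaging \<open>f\<close> itself; the iterates are always
  compared with \<open>f\<close>, so nothing has to be known about their own averaging
  error.\<close>

lemma mol_pow_err:
  assumes f: "continuous_on UNIV f" and h: "0 < h"
    and e: "\<And>y i. y \<in> V \<Longrightarrow> \<bar>av (\<lambda>_. 1) i (-h) (2*h) f y - f y\<bar> \<le> \<kappa>"
  shows "cball x (2 * h * n) \<subseteq> V \<Longrightarrow> \<bar>(mol h ^^ n) f x - f x\<bar> \<le> 2 * n * \<kappa>"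
proof (induction n arbitrary: x)
  case (Suc n)
  let ?g = "(mol h ^^ n) f"
  have g: "continuous_on UNIV ?g" by (rule mol_pow_cont[OF f])
  have ab: "\<bar>s * (2 * h) - h\<bar> \<le> h" "\<bar>- h + s * (2 * h)\<bar> \<le> h" if "s \<in> {0..1}" for s
    using that h mult_left_le_one_le[of h s] mult_nonneg_nonneg[of s h] by (auto simp: abs_le_iff)
  have cl: "\<bar>?g y - f y\<bar> \<le> 2 * n * \<kappa>" if "dist x y \<le> 2 * h" for y
  proof -
    have "cball y (2 * h * n) \<subseteq> cball x (2 * h * Suc n)"
    proof
      fix z assume "z \<in> cball y (2 * h * n)"
      then show "z \<in> cball x (2 * h * Suc n)"
        using dist_triangle[of x z y] that by (simp add: algebra_simps)
    qed
    then show ?thesis using Suc.IH[of y] Suc.prems by (simp add: subset_trans)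
  qed
  have V: "y \<in> V" if "dist x y \<le> h" for y
  proof -
    have "0 \<le> h * real n" using h by simp
    moreover have "2 * h * real (Suc n) = 2 * h + 2 * (h * real n)" by (simp add: algebra_simps)
    ultimately have "y \<in> cball x (2 * h * Suc n)" unfolding mem_cball using that h by linarith
    then show ?thesis using Suc.prems by blast
  qed
  let ?A = "av (\<lambda>_. 1) 2 (-h) (2*h) ?g"
  have A: "continuous_on UNIV ?A" by (rule av_cont[OF _ g]) simp
  have A2: "\<bar>?A y - f y\<bar> \<le> 2 * n * \<kappa> + \<kappa>" if y: "dist x y \<le> h" for y
  proof (rule av_close[OF f g _ e[OF V[OF y]]], rule cl)
    fix s :: real assume "s \<in> {0..1}"
    have "dist x (y + (- h + s * (2 * h)) *\<^sub>R axis 2 1) \<le> dist x y + dist y (y + (- h + s * (2 * h)) *\<^sub>R axis 2 1)"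
      by (rule dist_triangle)
    also have "\<dots> \<le> 2 * h" using y ab[OF \<open>s \<in> _\<close>] by (simp add: dist_norm)
    finally show "dist x (y + (- h + s * (2 * h)) *\<^sub>R axis 2 1) \<le> 2 * h" .
  qed
  have "\<bar>av (\<lambda>_. 1) 1 (-h) (2*h) ?A x - f x\<bar> \<le> (2 * n * \<kappa> + \<kappa>) + \<kappa>"
    by (rule av_close[OF f A _ e[OF V]], rule A2) (use h ab in \<open>auto simp: dist_norm\<close>)
  then have "\<bar>mol h ?g x - f x\<bar> \<le> (2 * n * \<kappa> + \<kappa>) + \<kappa>" by (simp only: mol_def)
  then show ?case by (simp add: algebra_simps)
qed simp

text \<open>The commutator does not change when constants are subtracted from \<open>p\<close> and
  \<open>q\<close>. With the constants \<open>p x\<close> and \<open>q x\<close> both factors are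
  small on the reach of the average, and the smallness multiplies. The constants stay fixed while
  \<open>y\<close> varies, so the derivatives at \<open>x\<close> are estimated in the same
  way.\<close>

lemma commutator_bd:
  assumes h: "0 < h" and p: "continuous_on UNIV p" and q: "continuous_on UNIV q"
    and K: "\<And>y. dist x y \<le> 2 * h * n \<Longrightarrow> \<bar>p y - p x\<bar> \<le> K"
    and L: "\<And>y. dist x y \<le> 2 * h * n \<Longrightarrow> \<bar>q y - q x\<bar> \<le> L"
  shows "bd {x} n ((1 + 2^n) * K * L) (1/h)
    (\<lambda>y. (mol h ^^ n) (\<lambda>y. p y * q y) y - (mol h ^^ n) p y * (mol h ^^ n) q y)"
proof -
  let ?P = "mol h ^^ n"
  define p' where "p' = (\<lambda>y. 1 * p y + (- p x) * 1)"
  define q' where "q' = (\<lambda>y. 1 * q y + (- q x) * 1)"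
  have p'c: "continuous_on UNIV p'" and q'c: "continuous_on UNIV q'"
    unfolding p'_def q'_def by (intro continuous_intros p q)+
  have K0: "0 \<le> K" "0 \<le> L" using K[of x] L[of x] h by auto
  have Pp: "?P p' = (\<lambda>y. ?P p y - p x)"
    unfolding p'_def by (subst mol_pow_lin[OF p]) (auto simp: mol_pow_const)
  have Pq: "?P q' = (\<lambda>y. ?P q y - q x)"
    unfolding q'_def by (subst mol_pow_lin[OF q]) (auto simp: mol_pow_const)
  have pq: "continuous_on UNIV (\<lambda>y. p y * q y)" by (intro continuous_intros p q)
  have "(\<lambda>y. p' y * q' y) = (\<lambda>y. 1 * (p y * q y) + 1 * ((- q x) * p y + (- p x) * q' y))"
    by (auto simp: p'_def q'_def algebra_simps)
  then have "?P (\<lambda>y. p' y * q' y) = ?P (\<lambda>y. 1 * (p y * q y) + 1 * ((- q x) * p y + (- p x) * q' y))"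
    by simp
  also have "\<dots> = (\<lambda>y. 1 * ?P (\<lambda>y. p y * q y) y + 1 * ?P (\<lambda>y. (- q x) * p y + (- p x) * q' y) y)"
    by (rule mol_pow_lin[OF pq]) (intro continuous_intros p q'c)
  also have "?P (\<lambda>y. (- q x) * p y + (- p x) * q' y) = (\<lambda>y. (- q x) * ?P p y + (- p x) * ?P q' y)"
    by (rule mol_pow_lin[OF p q'c])
  finally have e: "(\<lambda>y. ?P (\<lambda>y. p y * q y) y - ?P p y * ?P q y) = (\<lambda>y. ?P (\<lambda>y. p' y * q' y) y - ?P p' y * ?P q' y)"
    unfolding Pp Pq by (auto simp: algebra_simps)
  have b: "bd {x} (0 + n) B (1/h) (?P f)" if "0 \<le> B" "continuous_on UNIV f"
    "\<And>y. dist x y \<le> 2 * h * n \<Longrightarrow> \<bar>f y\<bar> \<le> B" for f B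
    by (rule mol_pow_bd[of h "1/h" B "cball x (2 * h * n)"]) (use h that in auto)
  have 1: "bd {x} n (K * L) (1/h) (?P (\<lambda>y. p' y * q' y))"
  proof -
    have "\<bar>p' y * q' y\<bar> \<le> K * L" if "dist x y \<le> 2 * h * n" for y
      using mult_mono[OF K[OF that] L[OF that]] K0 by (simp add: abs_mult p'_def q'_def)
    then show ?thesis using b[of "K * L" "\<lambda>y. p' y * q' y"] K0 continuous_on_mult[OF p'c q'c] by simp
  qed
  have 2: "bd {x} n K (1/h) (?P p')" using b[of K p'] K K0 p'c by (auto simp: p'_def)
  have 3: "bd {x} n L (1/h) (?P q')" using b[of L q'] L K0 q'c by (auto simp: q'_def)
  show ?thesis
    unfolding e using bd_minus[OF 1 bd_mult[OF 2 3]] by (simp add: algebra_simps)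
qed

section \<open>A potential for the off-diagonal entry\<close>

definition sa :: "2 \<Rightarrow> real \<Rightarrow> (real^2 \<Rightarrow> real) \<Rightarrow> real^2 \<Rightarrow> real" where
  "sa i h = av (\<lambda>_. 1) i 0 h"

text \<open>A primitive of the averaging error: its derivative in direction \<open>i\<close> is
  \<open>sa i h f - f\<close>. The weight \<open>1 - s\<close> is chosen for this identity, and the
  factor \<open>h\<close> records that the primitive is small.\<close>

definition va :: "2 \<Rightarrow> real \<Rightarrow> (real^2 \<Rightarrow> real) \<Rightarrow> real^2 \<Rightarrow> real" where
  "va i h f = (\<lambda>x. h * av (\<lambda>s. 1 - s) i 0 h f x)"

lemma sa_bd: "bd UNIV n K \<mu> f \<Longrightarrow> bd UNIV n K \<mu> (sa i h f)"
  unfolding sa_def by (rule av_bd[where V = UNIV]) auto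

lemma va_bd:
  assumes "bd UNIV n K \<mu> f" "0 < h"
  shows "bd UNIV n (h * K) \<mu> (va i h f)"
proof -
  have "bd UNIV n K \<mu> (av (\<lambda>s. 1 - s) i 0 h f)"
    by (rule av_bd[where V = UNIV]) (use assms in \<open>auto intro!: continuous_intros\<close>)
  from bd_cmult[OF this, of h] show ?thesis using assms(2) by (simp add: va_def)
qed

lemma sa_pd: "bd UNIV (Suc n) K \<mu> f \<Longrightarrow> pd j (sa i h f) = sa i h (pd j f)"
  unfolding sa_def by (rule av_pd(2)[OF continuous_on_const C1D])

lemma va_pd:
  assumes "bd UNIV (Suc n) K \<mu> f"
  shows "pd j (va i h f) = va i h (pd j f)"
proof -
  have q: "continuous_on {0..1::real} (\<lambda>s. 1 - s)" by (intro continuous_intros)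
  show ?thesis
    unfolding va_def using pd_cmult[OF av_pd(1)[OF q C1D[OF assms]]] av_pd(2)[OF q C1D[OF assms]] by auto
qed

lemma sa_pd_same:
  assumes "bd UNIV (Suc n) K \<mu> f" "0 < h"
  shows "pd i (sa i h f) = (\<lambda>x. (1/h) * (f (x + h *\<^sub>R axis i 1) - f x))"
  unfolding sa_pd[OF assms(1)] unfolding sa_def
  using av_pd_same(1)[OF C1D[OF assms(1)], of h i 0] assms(2) by (auto simp: field_simps)

lemma va_pd_same:
  assumes "bd UNIV (Suc n) K \<mu> f"
  shows "pd i (va i h f) = (\<lambda>x. sa i h f x - f x)"
  unfolding va_pd[OF assms] unfolding sa_def va_def
  using av_pd_same(2)[OF C1D[OF assms]] by auto

text \<open>For \<open>S\<^sub>h = sa 1 h \<circ> sa 2 h\<close>, the difference \<open>f - S\<^sub>h f\<close> consists of derivatives of averages of size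
  \<open>h K\<close>, whose gradients have size \<open>K\<close> at every scale. Doubling \<open>h\<close> therefore costs the same at each step.\<close>

lemma telescope:
  assumes f: "bd UNIV (Suc n) K \<mu> f" and mu: "1 \<le> \<mu>" and K: "0 \<le> K"
  shows "\<exists>\<Psi> :: 2 \<Rightarrow> real^2 \<Rightarrow> real. (\<forall>j. bd {} (Suc n) 0 0 (\<Psi> j))
     \<and> (\<forall>j x. \<bar>\<Psi> j x\<bar> \<le> 6 * (real N + 1) * (2^N / \<mu>) * K)
     \<and> (\<forall>i j. bd UNIV n (6 * (real N + 1) * K) \<mu> (pd i (\<Psi> j)))
     \<and> (\<forall>x. f x = pd 1 (\<Psi> 2) x + pd 2 (\<Psi> 1) x + sa 1 (2^N / \<mu>) (sa 2 (2^N / \<mu>) f) x)"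
proof (induction N)
  case 0
  define h where "h = 1 / \<mu>"
  have h: "0 < h" "h * \<mu> = 1" using mu by (auto simp: h_def)
  \<comment> \<open>The error of the double average is taken one direction at a time, as
    \<open>f - sa 1 h f\<close> plus \<open>sa 1 h\<close> applied to \<open>f - sa 2 h f\<close>;
    each bracket is a derivative of some \<open>va\<close>. Index 2 goes with the derivative in
    direction 1, as in the off-diagonal entry of a symmetric gradient.\<close>
  define \<Psi> where "\<Psi> j = (if j = (2::2) then (\<lambda>x. - va 1 h f x) else (\<lambda>x. - sa 1 h (va 2 h f) x))" for j
  have V2: "bd UNIV (Suc n) (h * K) \<mu> (va 2 h f)" by (rule va_bd[OF f h(1)])
  have b2: "bd UNIV (Suc n) (h * K) \<mu> (\<Psi> 2)"
    using bd_uminus[OF va_bd[OF f h(1)]] by (simp add: \<Psi>_def)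
  have b1: "bd UNIV (Suc n) (h * K) \<mu> (\<Psi> 1)"
    using bd_uminus[OF sa_bd[OF V2]] by (simp add: \<Psi>_def)
  have b: "bd UNIV (Suc n) (h * K) \<mu> (\<Psi> j)" for j
    using b1 b2 exhaust_2[of j] by auto
  have hK: "bd UNIV n K \<mu> (pd i (\<Psi> j))" for i j
    using bd_pd[OF b] h(2) by (metis mult.assoc mult.commute mult_1)
  have pd_um: "pd i (\<lambda>x. - g x) = (\<lambda>x. - pd i g x)" if "bd UNIV (Suc n) L \<mu> g" for i g L
    using pd_uminus[OF C1D(1)[OF that]] by auto
  have p12: "pd 1 (\<Psi> 2) = (\<lambda>x. f x - sa 1 h f x)"
    unfolding \<Psi>_def if_P[OF refl] pd_um[OF va_bd[OF f h(1)]] va_pd_same[OF f] by auto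
  have S: "sa 1 h (\<lambda>x. sa 2 h f x - f x) = (\<lambda>x. sa 1 h (sa 2 h f) x - sa 1 h f x)"
    using av_lin[of "\<lambda>_. 1" "sa 2 h f" f 1 0 h 1 "-1"] bd_cont[OF sa_bd[OF f, of 2 h]] bd_cont[OF f]
    by (simp add: sa_def)
  have p21: "pd 2 (\<Psi> 1) = (\<lambda>x. sa 1 h f x - sa 1 h (sa 2 h f) x)"
    using pd_um[OF sa_bd[OF V2], of 2 1 h] sa_pd[OF V2, of 2 1 h] va_pd_same[OF f, of 2 h] S
    by (simp add: \<Psi>_def)
  show ?case
  proof (intro exI[of _ \<Psi>] conjI allI)
    show "bd {} (Suc n) 0 0 (\<Psi> j)" for j by (rule bd_smooth[OF b])
    show "\<bar>\<Psi> j x\<bar> \<le> 6 * (real 0 + 1) * (2^0 / \<mu>) * K" for j x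
    proof -
      have "\<bar>\<Psi> j x\<bar> \<le> h * K" using bd_bound[OF b] by auto
      moreover have "0 \<le> h * K" using h K by simp
      ultimately show ?thesis unfolding h_def by simp
    qed
    show "bd UNIV n (6 * (real 0 + 1) * K) \<mu> (pd i (\<Psi> j))" for i j
      by (rule bd_mono[OF hK]) (use K mu in auto)
    show "f x = pd 1 (\<Psi> 2) x + pd 2 (\<Psi> 1) x + sa 1 (2^0 / \<mu>) (sa 2 (2^0 / \<mu>) f) x" for x
      unfolding p12 p21 by (simp add: h_def)
  qed
next
  case (Suc N)
  then obtain \<Psi> :: "2 \<Rightarrow> real^2 \<Rightarrow> real" where P: "\<And>j. bd {} (Suc n) 0 0 (\<Psi> j)"
    "\<And>j x. \<bar>\<Psi> j x\<bar> \<le> 6 * (real N + 1) * (2^N / \<mu>) * K"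
    "\<And>i j. bd UNIV n (6 * (real N + 1) * K) \<mu> (pd i (\<Psi> j))"
    "\<And>x. f x = pd 1 (\<Psi> 2) x + pd 2 (\<Psi> 1) x + sa 1 (2^N / \<mu>) (sa 2 (2^N / \<mu>) f) x"
    by blast
  define h where "h = 2^N / \<mu>"
  have h: "0 < h" "0 < 2 * h" using mu by (auto simp: h_def)
  have h2: "2^Suc N / \<mu> = 2 * h" by (simp add: h_def)
  \<comment> \<open>Passing from scale \<open>h\<close> to \<open>2 * h\<close> changes the double
    average by the change of \<open>sa 1\<close> applied to \<open>sa 2 h f\<close>, plus
    \<open>sa 1 (2*h)\<close> applied to the change of \<open>sa 2\<close>. \<open>D2\<close> and
    \<open>D1\<close> are primitives of these parts. Each keeps an average in the direction in which
    it is not a primitive, which controls the derivative there.\<close>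
  define g where "g = sa 2 h f"
  define u where "u = (\<lambda>x. va 2 h f x - va 2 (2*h) f x)"
  define D2 where "D2 = (\<lambda>x. va 1 h g x - va 1 (2*h) g x)"
  define D1 where "D1 = sa 1 (2*h) u"
  have g: "bd UNIV (Suc n) K \<mu> g" unfolding g_def by (rule sa_bd[OF f])
  have u: "bd UNIV (Suc n) (h * K + 2 * h * K) \<mu> u"
    unfolding u_def by (rule bd_minus[OF va_bd[OF f h(1)] va_bd[OF f h(2)]])
  have D2: "bd UNIV (Suc n) (h * K + 2 * h * K) \<mu> D2"
    unfolding D2_def by (rule bd_minus[OF va_bd[OF g h(1)] va_bd[OF g h(2)]])
  have D1: "bd UNIV (Suc n) (h * K + 2 * h * K) \<mu> D1"
    unfolding D1_def by (rule sa_bd[OF u])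
  have tr: "bd UNIV m (L + L) \<mu> (\<lambda>x. v (x + c) - v x)" if "bd UNIV m L \<mu> v" for v c L m
    by (rule bd_minus[OF bd_translate[OF that] that]) simp
  have pD: "pd j (\<lambda>x. a x - b x) = (\<lambda>x. pd j a x - pd j b x)" if "bd UNIV (Suc n) L \<mu> a" "bd UNIV (Suc n) L' \<mu> b" for a b L L' j
    using pd_diff[OF C1D(1)[OF that(1)] C1D(1)[OF that(2)]] by auto
  have p12: "pd 1 D2 = (\<lambda>x. sa 1 h g x - sa 1 (2*h) g x)"
    unfolding D2_def pD[OF va_bd[OF g h(1)] va_bd[OF g h(2)]] va_pd_same[OF g] by auto
  have b12: "bd UNIV (Suc n) (K + K) \<mu> (pd 1 D2)"
    unfolding p12 by (intro bd_minus sa_bd g)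
  have pg: "bd UNIV n (\<bar>1/h\<bar> * (K + K)) \<mu> (pd 2 g)"
    unfolding g_def sa_pd_same[OF f h(1)] by (intro bd_cmult tr bd_le[OF f]) simp
  \<comment> \<open>The derivative across costs 2/h, since \<open>g\<close> is averaged in direction
    2, and the factors \<open>h\<close> and \<open>2 * h\<close> of the two primitives repay it. The
    total is 6 K, the worst of the four cases and the origin of the constant 6.\<close>
  have b22: "bd UNIV n (h * (\<bar>1/h\<bar> * (K + K)) + 2 * h * (\<bar>1/h\<bar> * (K + K))) \<mu> (pd 2 D2)"
    unfolding D2_def pD[OF va_bd[OF g h(1)] va_bd[OF g h(2)]] va_pd[OF g]
    by (rule bd_minus[OF va_bd[OF pg h(1)] va_bd[OF pg h(2)]])
  have b11: "bd UNIV (Suc n) (\<bar>1/(2*h)\<bar> * ((h * K + 2 * h * K) + (h * K + 2 * h * K))) \<mu> (pd 1 D1)"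
    unfolding D1_def sa_pd_same[OF u h(2)] by (rule bd_cmult[OF tr[OF u]])
  have pu: "pd 2 u = (\<lambda>x. sa 2 h f x - sa 2 (2*h) f x)"
    unfolding u_def pD[OF va_bd[OF f h(1)] va_bd[OF f h(2)]] va_pd_same[OF f] by auto
  have bu: "bd UNIV (Suc n) (K + K) \<mu> (pd 2 u)" unfolding pu by (intro bd_minus sa_bd f)
  have p21: "pd 2 D1 = sa 1 (2*h) (pd 2 u)" unfolding D1_def by (rule sa_pd[OF u])
  have b21: "bd UNIV (Suc n) (K + K) \<mu> (pd 2 D1)" unfolding p21 by (rule sa_bd[OF bu])
  have c: "continuous_on UNIV (sa 2 h f)" "continuous_on UNIV (sa 2 (2*h) f)"
    by (rule bd_cont[OF sa_bd[OF f]])+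
  have e21: "pd 2 D1 = (\<lambda>x. sa 1 (2*h) (sa 2 h f) x - sa 1 (2*h) (sa 2 (2*h) f) x)"
    unfolding p21 pu using av_lin[OF _ c, of "\<lambda>_. 1" 1 0 "2*h" 1 "-1"] by (simp add: sa_def)
  define D where "D j = (if j = (2::2) then D2 else D1)" for j
  have n12: "(1::2) \<noteq> 2" by simp
  have Dsm: "bd {} (Suc n) 0 0 (D j)" for j using D1 D2 by (auto simp: D_def intro: bd_smooth)
  have Db: "\<bar>D j x\<bar> \<le> 3 * h * K" for j x
    using bd_bound[OF D1, of x] bd_bound[OF D2, of x] by (auto simp: D_def mult.commute mult.left_commute)
  have Dpd: "bd UNIV n (6 * K) \<mu> (pd i (D j))" for i j
  proof -
    have "bd UNIV n (6 * K) \<mu> (pd 1 D2)" "bd UNIV n (6 * K) \<mu> (pd 2 D1)"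
      by (rule bd_mono[OF bd_le[OF b12, of n]] bd_mono[OF bd_le[OF b21, of n]], use K mu in auto)+
    moreover have "bd UNIV n (6 * K) \<mu> (pd 2 D2)"
      by (rule bd_mono[OF b22]) (use K mu h in auto)
    moreover have "bd UNIV n (6 * K) \<mu> (pd 1 D1)"
      by (rule bd_mono[OF bd_le[OF b11, of n]]) (use K mu h in \<open>auto simp: field_simps\<close>)
    ultimately show ?thesis using exhaust_2[of i] exhaust_2[of j] n12 by (auto simp: D_def)
  qed
  have pa: "pd i (\<lambda>x. \<Psi> j x + D j x) = (\<lambda>x. pd i (\<Psi> j) x + pd i (D j) x)" for i j
    using pd_add[OF C1D(1)[OF P(1)] C1D(1)[OF Dsm]] by auto
  show ?case
  proof (intro exI[of _ "\<lambda>j x. \<Psi> j x + D j x"] conjI allI)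
    show "bd {} (Suc n) 0 0 (\<lambda>x. \<Psi> j x + D j x)" for j
      using bd_add[OF P(1) Dsm] by simp
    show "\<bar>\<Psi> j x + D j x\<bar> \<le> 6 * (real (Suc N) + 1) * (2 ^ Suc N / \<mu>) * K" for j x
    proof -
      have "\<bar>\<Psi> j x + D j x\<bar> \<le> 6 * (real N + 1) * h * K + 3 * h * K"
        using P(2)[of j x] Db[of j x] unfolding h_def[symmetric] by linarith
      also have "\<dots> \<le> 6 * (real (Suc N) + 1) * (2 * h) * K"
      proof -
        have "0 \<le> h * K" "0 \<le> N * (h * K)" using h K by auto
        then show ?thesis by (simp add: algebra_simps)
      qed
      finally show ?thesis unfolding h2 .
    qed
    show "bd UNIV n (6 * (real (Suc N) + 1) * K) \<mu> (pd i (\<lambda>x. \<Psi> j x + D j x))" for i j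
      unfolding pa using bd_add[OF P(3)[of i j] Dpd[of i j]] by (simp add: algebra_simps)
    show "f x = pd 1 (\<lambda>x. \<Psi> 2 x + D 2 x) x + pd 2 (\<lambda>x. \<Psi> 1 x + D 1 x) x + sa 1 (2^Suc N / \<mu>) (sa 2 (2^Suc N / \<mu>) f) x" for x
      unfolding pa h2 using P(4)[of x, folded h_def] n12
      by (simp add: D_def p12 e21 g_def)
  qed
qed

text \<open>At scale about \<open>1\<close> the remainder still has compact support. It vanishes after a long translation, so it is a
  derivative of its average over the corresponding segment.\<close>

lemma off_diagonal_potential:
  assumes f: "bd UNIV (Suc n) K \<mu> f" and mu: "1 \<le> \<mu>" and K: "0 \<le> K"
    and R: "0 \<le> R" and supp: "\<And>x. R \<le> norm x \<Longrightarrow> f x = 0"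
  shows "\<exists>\<Psi> :: 2 \<Rightarrow> real^2 \<Rightarrow> real. (\<forall>j. bd {} (Suc n) 0 0 (\<Psi> j))
     \<and> (\<forall>j x. \<bar>\<Psi> j x\<bar> \<le> (12 * (log 2 \<mu> + 2) + 4 * R + 4) * K)
     \<and> (\<forall>i j. bd UNIV n ((12 * (log 2 \<mu> + 2) + 4 * R + 4) * K) \<mu> (pd i (\<Psi> j)))
     \<and> (\<forall>x. norm x \<le> R \<longrightarrow> pd 1 (\<Psi> 2) x + pd 2 (\<Psi> 1) x = f x)"
proof -
  \<comment> \<open>The number of doublings that lead from scale 1/\<mu> to a scale \<open>h\<close>
    between 1 and 2. It is the source of the logarithm.\<close>
  define N where "N = nat \<lceil>log 2 \<mu>\<rceil>"
  define h where "h = 2^N / \<mu>"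
  have l0: "0 \<le> log 2 \<mu>" using mu by simp
  have N: "log 2 \<mu> \<le> N" "real N < log 2 \<mu> + 1"
    using l0 unfolding N_def by linarith+
  have "2 powr log 2 \<mu> \<le> 2 powr real N" using N(1) by simp
  then have h1: "1 \<le> h" using mu by (simp add: h_def powr_realpow)
  have "2 powr real N \<le> 2 powr (log 2 \<mu> + 1)" using N(2) by (intro powr_mono) auto
  then have h2: "h \<le> 2" using mu by (simp add: h_def powr_realpow powr_add field_simps)
  have h0: "0 < h" using h1 by simp
  \<comment> \<open>\<open>sa\<close> looks only in positive coordinate directions. A shift to the
    right by more than 2R therefore takes the ball of radius \<open>R\<close> out of the support of
    \<open>f\<close>, and the averages cannot bring it back.\<close>
  define H where "H = 2 * R + 1"
  have H: "0 < H" using R by (simp add: H_def)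
  obtain \<Psi> :: "2 \<Rightarrow> real^2 \<Rightarrow> real" where P: "\<And>j. bd {} (Suc n) 0 0 (\<Psi> j)"
    "\<And>j x. \<bar>\<Psi> j x\<bar> \<le> 6 * (real N + 1) * h * K"
    "\<And>i j. bd UNIV n (6 * (real N + 1) * K) \<mu> (pd i (\<Psi> j))"
    "\<And>x. f x = pd 1 (\<Psi> 2) x + pd 2 (\<Psi> 1) x + sa 1 h (sa 2 h f) x"
    using telescope[OF f mu K, of N, folded h_def] by blast
  define g where "g = sa 1 h (sa 2 h f)"
  have s2: "bd UNIV (Suc n) K \<mu> (sa 2 h f)" by (rule sa_bd[OF f])
  have g: "bd UNIV (Suc n) K \<mu> g" unfolding g_def by (rule sa_bd[OF s2])
  have g0: "g (x + H *\<^sub>R axis 1 1) = 0" if "norm x \<le> R" for x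
  proof -
    have f0: "f (x + H *\<^sub>R axis 1 1 + (s * h) *\<^sub>R axis 1 1 + (t * h) *\<^sub>R axis 2 1) = 0" if "0 \<le> s" for s t
    proof (rule supp)
      let ?y = "x + H *\<^sub>R axis 1 1 + (s * h) *\<^sub>R axis 1 1 + (t * h) *\<^sub>R axis 2 1"
      have "\<bar>x $ 1\<bar> \<le> R" using component_le_norm_cart[of x 1] \<open>norm x \<le> R\<close> by linarith
      moreover have "?y $ 1 = x $ 1 + H + s * h" by (simp add: axis_def)
      moreover have "0 \<le> s * h" using that h1 by simp
      ultimately have "R \<le> \<bar>?y $ 1\<bar>" unfolding H_def by linarith
      then show "R \<le> norm ?y" using component_le_norm_cart[of ?y 1] by linarith
    qed
    have "integral {0..1} (\<lambda>s. integral {0..1} (\<lambda>t. f (x + H *\<^sub>R axis 1 1 + (s * h) *\<^sub>R axis 1 1 + (t * h) *\<^sub>R axis 2 1)))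
      = integral {0..1} (\<lambda>s::real. 0)"
      by (rule Henstock_Kurzweil_Integration.integral_cong) (simp add: f0)
    then show ?thesis by (simp add: g_def sa_def av_def)
  qed
  \<comment> \<open>By the fundamental theorem, the derivative of \<open>D\<close> in direction 1 is
    \<open>g\<close> minus its translate by \<open>H\<close>, and the translate vanishes on the ball
    of radius \<open>R\<close>.\<close>
  define D where "D = (\<lambda>x. (- H) * sa 1 H g x)"
  have D: "bd UNIV (Suc n) (\<bar>-H\<bar> * K) \<mu> D" unfolding D_def by (intro bd_cmult sa_bd g)
  have pD: "pd j D = (\<lambda>x. (- H) * pd j (sa 1 H g) x)" for j
    unfolding D_def by (rule ext) (rule pd_cmult[OF C1D(1)[OF sa_bd[OF g]]])
  have pD1: "pd 1 D x = g x - g (x + H *\<^sub>R axis 1 1)" for x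
    unfolding pD sa_pd_same[OF g H] using H by (simp add: field_simps)
  have tr: "bd UNIV m (L + L) \<mu> (\<lambda>x. v (x + c) - v x)" if "bd UNIV m L \<mu> v" for v c L m
    by (rule bd_minus[OF bd_translate[OF that] that]) simp
  have b1: "bd UNIV (Suc n) (\<bar>-H\<bar> * (\<bar>1/H\<bar> * (K + K))) \<mu> (pd 1 D)"
    unfolding pD sa_pd_same[OF g H] by (intro bd_cmult tr g)
  have "bd UNIV n (\<bar>1/h\<bar> * (K + K)) \<mu> (pd 2 (sa 2 h f))"
    unfolding sa_pd_same[OF f h0] by (intro bd_cmult tr bd_le[OF f]) simp
  then have b2: "bd UNIV n (\<bar>-H\<bar> * (\<bar>1/h\<bar> * (K + K))) \<mu> (pd 2 D)"
    unfolding pD sa_pd[OF g] unfolding g_def sa_pd[OF s2] by (intro bd_cmult sa_bd)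
  let ?L = "12 * (log 2 \<mu> + 2) + 4 * R + 4"
  have HK: "2 * K \<le> 2 * H * K" "0 \<le> H * K" using H K R mult_right_mono[of 1 H K] by (auto simp: H_def algebra_simps)
  have b: "bd UNIV n (2 * H * K) \<mu> (pd i D)" for i
  proof -
    have "bd UNIV n (2 * H * K) \<mu> (pd 1 D)"
      by (rule bd_mono[OF bd_le[OF b1, of n]]) (use H K mu HK in auto)
    moreover have "bd UNIV n (2 * H * K) \<mu> (pd 2 D)"
    proof (rule bd_mono[OF b2])
      have "\<bar>1/h\<bar> \<le> 1" using h1 by simp
      then have "H * (\<bar>1/h\<bar> * (2 * K)) \<le> H * (1 * (2 * K))"
        using H K by (intro mult_left_mono mult_right_mono) auto
      then show "\<bar>-H\<bar> * (\<bar>1/h\<bar> * (K + K)) \<le> 2 * H * K" using H by (simp add: algebra_simps)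
    qed (use H K mu in auto)
    ultimately show ?thesis using exhaust_2[of i] by auto
  qed
  define \<Phi> where "\<Phi> j = (if j = (2::2) then (\<lambda>x. \<Psi> 2 x + D x) else \<Psi> j)" for j
  have pa: "pd i (\<lambda>x. \<Psi> 2 x + D x) = (\<lambda>x. pd i (\<Psi> 2) x + pd i D x)" for i
    using pd_add[OF C1D(1)[OF P(1)] C1D(1)[OF D]] by auto
  have NK: "6 * (real N + 1) * K \<le> 6 * (log 2 \<mu> + 2) * K" using N(2) K by (intro mult_right_mono) auto
  have LK: "0 \<le> log 2 \<mu> * K" "0 \<le> R * K" using l0 K R by auto
  have key: "12 * (real N + 1) * K + 2 * H * K \<le> ?L * K"
    using NK K LK by (simp add: H_def algebra_simps)
  have key': "6 * (real N + 1) * K \<le> 12 * (real N + 1) * K" "0 \<le> 6 * (real N + 1) * K"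
    using K by (auto intro!: mult_right_mono)
  show ?thesis
  proof (intro exI[of _ \<Phi>] conjI allI impI)
    show "bd {} (Suc n) 0 0 (\<Phi> j)" for j
      using P(1)[of j] bd_add[OF P(1)[of 2] bd_smooth[OF D]] by (simp add: \<Phi>_def)
    show "\<bar>\<Phi> j x\<bar> \<le> ?L * K" for j x
    proof -
      have "6 * (real N + 1) * K * h \<le> 6 * (real N + 1) * K * 2" using h2 K by (intro mult_left_mono) auto
      then have "\<bar>\<Psi> j x\<bar> \<le> 12 * (real N + 1) * K" for j using P(2)[of j x] by (simp add: algebra_simps)
      moreover have "\<bar>D x\<bar> \<le> 2 * H * K" using bd_bound[OF D, of x] H K HK by simp
      ultimately have "\<bar>\<Phi> j x\<bar> \<le> 12 * (real N + 1) * K + 2 * H * K"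
        using HK(2) K by (auto simp: \<Phi>_def) (smt (verit))+
      then show ?thesis using key by linarith
    qed
    show "bd UNIV n (?L * K) \<mu> (pd i (\<Phi> j))" for i j
    proof -
      have "bd UNIV n (6 * (real N + 1) * K + 2 * H * K) \<mu> (pd i (\<Phi> j))"
      proof (cases "j = 2")
        case True
        then show ?thesis using bd_add[OF P(3)[of i 2] b[of i]] pa by (simp add: \<Phi>_def)
      next
        case False
        then show ?thesis using bd_mono[OF P(3)[of i j], of UNIV "6 * (real N + 1) * K + 2 * H * K" \<mu>] key'(2) HK(2) mu K
          by (simp add: \<Phi>_def)
      qed
      then show ?thesis by (rule bd_mono) (use key key' mu HK(2) in auto)
    qed
    show "pd 1 (\<Phi> 2) x + pd 2 (\<Phi> 1) x = f x" if "norm x \<le> R" for x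
      using P(4)[of x] pD1[of x] g0[OF that] by (simp add: \<Phi>_def pa g_def)
  qed
qed

section \<open>One corrugation\<close>

text \<open>This is the von Karman strain of the pair, in entries and with derivatives in the whole
  plane. It is applied to extensions of the given maps, where \<open>defect\<close> uses derivatives
  relative to a neighbourhood.\<close>

definition vk :: "nat \<Rightarrow> (nat \<Rightarrow> real^2 \<Rightarrow> real) \<Rightarrow> (2 \<Rightarrow> real^2 \<Rightarrow> real) \<Rightarrow> 2 \<Rightarrow> 2 \<Rightarrow> real^2 \<Rightarrow> real" where
  "vk k v w i j x = (\<Sum>a<k. pd i (v a) x * pd j (v a) x) / 2 + (pd i (w j) x + pd j (w i) x) / 2"

text \<open>The profiles \<open>p = 2 sin t\<close>, \<open>q = cos (2 t) / 2\<close> and \<open>r = - sin (2 t) / 2\<close> satisfy \<open>p'\<^sup>2 / 2 + r' = 1\<close>, which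
  produces \<open>a\<^sup>2 e\<^sub>d \<otimes> e\<^sub>d\<close>, and \<open>p p' + 2 r + q' = 0\<close>, which cancels the terms \<open>a \<nabla>a \<otimes> e\<^sub>d\<close> of order \<open>1 / \<nu>\<close>. The
  perturbation \<open>cp\<close> is added to a component of \<open>v\<close> and \<open>cw\<close> to \<open>w\<close>; \<open>cerr\<close> is the remainder.\<close>

definition cp :: "(real^2 \<Rightarrow> real) \<Rightarrow> real \<Rightarrow> 2 \<Rightarrow> real^2 \<Rightarrow> real" where
  "cp a \<nu> d = (\<lambda>x. a x * (2 / \<nu> * sin (\<nu> * x $ d)))"

definition cq :: "(real^2 \<Rightarrow> real) \<Rightarrow> real \<Rightarrow> 2 \<Rightarrow> real^2 \<Rightarrow> real" where
  "cq a \<nu> d = (\<lambda>x. a x * (1 / (2 * \<nu>^2) * cos (2 * \<nu> * x $ d)))"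

definition cr :: "(real^2 \<Rightarrow> real) \<Rightarrow> real \<Rightarrow> 2 \<Rightarrow> real^2 \<Rightarrow> real" where
  "cr a \<nu> d = (\<lambda>x. - (a x * a x * (1 / (2 * \<nu>) * sin (2 * \<nu> * x $ d))))"

definition cw :: "(real^2 \<Rightarrow> real) \<Rightarrow> real \<Rightarrow> 2 \<Rightarrow> (real^2 \<Rightarrow> real) \<Rightarrow> 2 \<Rightarrow> real^2 \<Rightarrow> real" where
  "cw a \<nu> d u j = (\<lambda>x. cq a \<nu> d x * pd j a x + (if j = d then 1 else 0) * cr a \<nu> d x - cp a \<nu> d x * pd j u x)"

definition cerr :: "(2 \<Rightarrow> 2 \<Rightarrow> real^2 \<Rightarrow> real) \<Rightarrow> (real^2 \<Rightarrow> real) \<Rightarrow> real \<Rightarrow> 2 \<Rightarrow> 2 \<Rightarrow> 2 \<Rightarrow> real^2 \<Rightarrow> real" where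
  "cerr H a \<nu> d i j = (\<lambda>x. (1 - 1/2 * cos (2 * \<nu> * x $ d)) * (1 / \<nu>^2 * (pd i a x * pd j a x))
     + 1/2 * (cq a \<nu> d x * (pd i (pd j a) x + pd j (pd i a) x))
     - 1/2 * (cp a \<nu> d x * (H i j x + H j i x)))"

lemma diff_sin: "(\<lambda>x::real^2. c * sin (e * x $ d)) differentiable (at x)"
  and pd_sin: "pd i (\<lambda>x. c * sin (e * x $ d)) x = (if i = d then c * e * cos (e * x $ d) else 0)"
proof -
  have l: "((\<lambda>t. c * sin (e * t)) has_real_derivative c * e * cos (e * t)) (at t)" for t
    by (auto intro!: derivative_eq_intros)
  show "(\<lambda>x::real^2. c * sin (e * x $ d)) differentiable (at x)"
    by (rule pd_chain(2)[OF differentiable_nth l])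
  show "pd i (\<lambda>x. c * sin (e * x $ d)) x = (if i = d then c * e * cos (e * x $ d) else 0)"
    using pd_chain(1)[OF differentiable_nth l, of i d x] by (simp add: pd_nth)
qed

lemma diff_cos: "(\<lambda>x::real^2. c * cos (e * x $ d)) differentiable (at x)"
  and pd_cos: "pd i (\<lambda>x. c * cos (e * x $ d)) x = (if i = d then - c * e * sin (e * x $ d) else 0)"
proof -
  have l: "((\<lambda>t. c * cos (e * t)) has_real_derivative - c * e * sin (e * t)) (at t)" for t
    by (auto intro!: derivative_eq_intros)
  show "(\<lambda>x::real^2. c * cos (e * x $ d)) differentiable (at x)"
    by (rule pd_chain(2)[OF differentiable_nth l])
  show "pd i (\<lambda>x. c * cos (e * x $ d)) x = (if i = d then - c * e * sin (e * x $ d) else 0)"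
    using pd_chain(1)[OF differentiable_nth l, of i d x] by (simp add: pd_nth)
qed

text \<open>The term of \<open>cw\<close> with the gradient of \<open>u\<close> cancels the products
  of the gradients of \<open>v b\<close> and \<open>cp\<close>, and the profile identities cancel
  the oscillating terms of order one and of order 1/\<nu>. What survives is quadratic in the
  gradient of \<open>a\<close>, or pairs \<open>cq\<close> with the Hessian of \<open>a\<close>, or
  \<open>cp\<close> with that of \<open>v b\<close>.\<close>

lemma corrugation_identity:
  assumes b: "b < k" and nu: "0 < \<nu>"
    and v: "\<And>a x. a < k \<Longrightarrow> v a differentiable (at x)" "\<And>j x. pd j (v b) differentiable (at x)"
    and w: "\<And>j x. w j differentiable (at x)"
    and a: "\<And>x. a differentiable (at x)" "\<And>j x. pd j a differentiable (at x)"
  shows "vk k (v(b := (\<lambda>x. v b x + cp a \<nu> d x))) (\<lambda>j x. w j x + cw a \<nu> d (v b) j x) i j x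
    = vk k v w i j x + (if i = d \<and> j = d then (a x)^2 else 0) + cerr (\<lambda>i j. pd i (pd j (v b))) a \<nu> d i j x"
proof -
  define s where "s = sin (\<nu> * x $ d)"
  define c where "c = cos (\<nu> * x $ d)"
  define s2 where "s2 = sin (2 * \<nu> * x $ d)"
  define c2 where "c2 = cos (2 * \<nu> * x $ d)"
  define \<delta> where "\<delta> i = (if i = d then 1 else (0::real))" for i
  have tr: "s2 = 2 * s * c" "c2 = c^2 - s^2" "s^2 + c^2 = 1"
    using sin_double[of "\<nu> * x $ d"] cos_double[of "\<nu> * x $ d"]
    by (simp_all add: s_def c_def s2_def c2_def mult.assoc)
  have pdiff: "cp a \<nu> d differentiable (at x)" for x
    unfolding cp_def by (intro differentiable_mult a diff_sin)
  have qdiff: "cq a \<nu> d differentiable (at x)" for x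
    unfolding cq_def by (intro differentiable_mult a diff_cos)
  have aadiff: "(\<lambda>x. a x * a x) differentiable (at x)" for x
    by (intro differentiable_mult a)
  have rdiff0: "(\<lambda>x. a x * a x * (1 / (2 * \<nu>) * sin (2 * \<nu> * x $ d))) differentiable (at x)" for x
    by (intro differentiable_mult aadiff diff_sin)
  have rdiff: "cr a \<nu> d differentiable (at x)" for x
    unfolding cr_def by (rule differentiable_minus[OF rdiff0])
  have pp: "pd i (cp a \<nu> d) x = pd i a x * (2 / \<nu> * s) + a x * \<delta> i * (2 * c)" for i
    unfolding cp_def pd_mult[OF a(1) diff_sin] pd_sin using nu by (simp add: s_def c_def \<delta>_def)
  have pq: "pd i (cq a \<nu> d) x = pd i a x * (1 / (2 * \<nu>^2) * c2) - a x * \<delta> i * (s2 / \<nu>)" for i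
    unfolding cq_def pd_mult[OF a(1) diff_cos] pd_cos using nu
    by (simp add: s2_def c2_def \<delta>_def power2_eq_square)
  have pr: "pd i (cr a \<nu> d) x = - (2 * a x * pd i a x * (1 / (2 * \<nu>) * s2) + (a x)^2 * \<delta> i * c2)" for i
    unfolding cr_def pd_uminus[OF rdiff0] pd_mult[OF aadiff diff_sin] pd_mult[OF a(1) a(1)] pd_sin using nu
    by (simp add: s2_def c2_def \<delta>_def power2_eq_square)
  have cwdiff: "cw a \<nu> d (v b) j differentiable (at x)" for j x
    unfolding cw_def by (intro differentiable_add differentiable_diff differentiable_mult qdiff rdiff pdiff a v differentiable_const)
  have pcw: "pd i (cw a \<nu> d (v b) j) x = pd i (cq a \<nu> d) x * pd j a x + cq a \<nu> d x * pd i (pd j a) x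
     + \<delta> j * pd i (cr a \<nu> d) x - (pd i (cp a \<nu> d) x * pd j (v b) x + cp a \<nu> d x * pd i (pd j (v b)) x)" for i j
  proof -
    have d1: "(\<lambda>x. cq a \<nu> d x * pd j a x) differentiable (at x)" for x by (intro differentiable_mult qdiff a)
    have d2: "(\<lambda>x. (if j = d then 1 else 0) * cr a \<nu> d x) differentiable (at x)" for x
      by (intro differentiable_mult rdiff differentiable_const)
    have d3: "(\<lambda>x. cp a \<nu> d x * pd j (v b) x) differentiable (at x)" for x by (intro differentiable_mult pdiff v)
    show ?thesis
      unfolding cw_def pd_diff[OF differentiable_add[OF d1 d2] d3] pd_add[OF d1 d2]
        pd_mult[OF qdiff a(2)] pd_cmult[OF rdiff] pd_mult[OF pdiff v(2)] \<delta>_def by simp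
  qed
  have pw: "pd i (\<lambda>x. w j x + cw a \<nu> d (v b) j x) x = pd i (w j) x + pd i (cw a \<nu> d (v b) j) x" for i j
    by (rule pd_add[OF w cwdiff])
  have pv: "pd i (\<lambda>x. v b x + cp a \<nu> d x) x = pd i (v b) x + pd i (cp a \<nu> d) x" for i
    by (rule pd_add[OF v(1)[OF b] pdiff])
  let ?v = "v(b := (\<lambda>x. v b x + cp a \<nu> d x))"
  have "(\<Sum>a'<k. pd i (?v a') x * pd j (?v a') x) = pd i (?v b) x * pd j (?v b) x + (\<Sum>a'\<in>{..<k}-{b}. pd i (?v a') x * pd j (?v a') x)"
    using b by (intro sum.remove) auto
  also have "(\<Sum>a'\<in>{..<k}-{b}. pd i (?v a') x * pd j (?v a') x) = (\<Sum>a'\<in>{..<k}-{b}. pd i (v a') x * pd j (v a') x)"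
    by (intro sum.cong) auto
  also have "\<dots> = (\<Sum>a'<k. pd i (v a') x * pd j (v a') x) - pd i (v b) x * pd j (v b) x"
    using b by (subst sum.remove[of "{..<k}" b]) auto
  finally have sm: "(\<Sum>a'<k. pd i (?v a') x * pd j (?v a') x) = (\<Sum>a'<k. pd i (v a') x * pd j (v a') x)
     + (pd i (v b) x + pd i (cp a \<nu> d) x) * (pd j (v b) x + pd j (cp a \<nu> d) x) - pd i (v b) x * pd j (v b) x"
    by (simp add: pv)
  define z where "z = a x"
  define ai where "ai = pd i a x"
  define aj where "aj = pd j a x"
  define m where "m = 1 / \<nu>"
  have num: "2 / \<nu> = 2 * m" "1 / (2 * \<nu>^2) = m^2 / 2" "s2 / \<nu> = s2 * m" "1 / (2 * \<nu>) = m / 2" "1 / \<nu>^2 = m^2"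
    by (simp_all add: m_def power2_eq_square)
  have dd: "(if i = d \<and> j = d then (a x)^2 else 0) = \<delta> i * \<delta> j * z^2" by (simp add: \<delta>_def z_def)
  let ?pi = "ai * (2 * m * s) + z * \<delta> i * (2 * c)"
  let ?pj = "aj * (2 * m * s) + z * \<delta> j * (2 * c)"
  let ?L = "?pi * ?pj
     + ((ai * (m^2/2 * c2) - z * \<delta> i * (s2 * m)) * aj + (aj * (m^2/2 * c2) - z * \<delta> j * (s2 * m)) * ai)
     + \<delta> j * (- (2 * z * ai * (m/2 * s2) + z^2 * \<delta> i * c2)) + \<delta> i * (- (2 * z * aj * (m/2 * s2) + z^2 * \<delta> j * c2))"
  let ?R = "2 * (\<delta> i * \<delta> j * z^2) + 2 * ((1 - c2/2) * (m^2 * (ai * aj)))"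
  \<comment> \<open>This is twice the claim after removal of the Hessian terms and of the products
    with the gradient of \<open>v b\<close>. It is polynomial in the sines and cosines, and the
    double-angle formulas decide it.\<close>
  have core: "?L = ?R"
  proof -
    have c2': "c2 = 2 * c^2 - 1" and s2': "4 * s^2 = 2 - 2 * c2" using tr by (auto simp: algebra_simps)
    have "?pi * ?pj = ai * aj * m^2 * (4 * s^2) + m * (z * \<delta> j * ai + z * \<delta> i * aj) * (2 * (2 * s * c)) + z^2 * \<delta> i * \<delta> j * (2 * (2 * c^2))"
      by (simp add: algebra_simps power2_eq_square)
    also have "\<dots> = ai * aj * m^2 * (2 - 2 * c2) + m * (z * \<delta> j * ai + z * \<delta> i * aj) * (2 * s2) + z^2 * \<delta> i * \<delta> j * (2 * (c2 + 1))"
      using c2' s2' tr(1) by simp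
    finally show ?thesis by (simp add: algebra_simps power2_eq_square)
  qed
  show ?thesis
    unfolding vk_def sm pw pcw dd cerr_def
    unfolding pp pq pr num s_def[symmetric] c_def[symmetric] s2_def[symmetric] c2_def[symmetric]
      z_def[symmetric] ai_def[symmetric] aj_def[symmetric]
    apply (subst eq_iff_diff_eq_0)
    apply (rule trans[where s = "(?L - ?R) / 2"])
     apply (simp add: field_simps power2_eq_square)
    using core by simp
qed

text \<open>A product costs the Leibniz factor \<open>2^n\<close>, and the frequency
  \<open>2 * \<nu>\<close> in \<open>cq\<close> and \<open>cr\<close> costs another
  \<open>2^n\<close> when measured at \<nu>. With two products and one change of frequency,
  \<open>cr\<close> needs all of \<open>8^n\<close>.\<close>

lemma corr_bd:
  assumes a: "bd UNIV n \<alpha> \<mu> a" and al: "0 \<le> \<alpha>" and mu: "0 \<le> \<mu>" "\<mu> \<le> \<nu>" and nu: "0 < \<nu>"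
  shows "bd UNIV n (8^(n+1) * (\<alpha> / \<nu>)) \<nu> (cp a \<nu> d)"
    and "bd UNIV n (8^(n+1) * (\<alpha> / \<nu>^2)) \<nu> (cq a \<nu> d)"
    and "bd UNIV n (8^(n+1) * (\<alpha>^2 / \<nu>)) \<nu> (cr a \<nu> d)"
proof -
  have an: "bd UNIV n \<alpha> \<nu> a" by (rule bd_mono[OF a]) (use al mu in auto)
  have p24: "(2::real)^n \<le> 8^n" "(4::real)^n \<le> 8^n" by (auto intro: power_mono)
  have p: "bd UNIV n (2^n * \<alpha> * (2/\<nu>)) \<nu> (cp a \<nu> d)"
    unfolding cp_def using bd_sin[of \<nu> "2/\<nu>" UNIV n d 0] nu by (intro bd_mult an) simp
  show "bd UNIV n (8^(n+1) * (\<alpha> / \<nu>)) \<nu> (cp a \<nu> d)"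
  proof (rule bd_mono[OF p])
    have "2^n * 2 * (\<alpha> / \<nu>) \<le> 8^n * 8 * (\<alpha> / \<nu>)"
      using p24 al nu by (intro mult_right_mono mult_mono) auto
    then show "2^n * \<alpha> * (2/\<nu>) \<le> 8^(n+1) * (\<alpha> / \<nu>)" by (simp add: algebra_simps)
  qed (use al nu in auto)
  have c2: "bd UNIV n (2^n * (1 / (2 * \<nu>^2))) \<nu> (\<lambda>x. 1 / (2 * \<nu>^2) * cos (2 * \<nu> * x $ d))"
    by (rule bd_scale_freq[OF bd_cos]) (use nu in auto)
  have s2: "bd UNIV n (2^n * (1 / (2 * \<nu>))) \<nu> (\<lambda>x. 1 / (2 * \<nu>) * sin (2 * \<nu> * x $ d))"
    using bd_sin[of "2*\<nu>" "1 / (2 * \<nu>)" UNIV n d 0] nu by (intro bd_scale_freq) auto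
  have q: "bd UNIV n (2^n * \<alpha> * (2^n * (1 / (2 * \<nu>^2)))) \<nu> (cq a \<nu> d)"
    unfolding cq_def by (rule bd_mult[OF an c2])
  show "bd UNIV n (8^(n+1) * (\<alpha> / \<nu>^2)) \<nu> (cq a \<nu> d)"
  proof (rule bd_mono[OF q])
    have "4^n * (1/2) * (\<alpha> / \<nu>^2) \<le> 8^n * 8 * (\<alpha> / \<nu>^2)"
      using p24 al nu by (intro mult_right_mono mult_mono) auto
    moreover have "(2::real)^n * 2^n = 4^n" by (simp add: power_mult_distrib[symmetric])
    ultimately show "2^n * \<alpha> * (2^n * (1 / (2 * \<nu>^2))) \<le> 8^(n+1) * (\<alpha> / \<nu>^2)"
      by (simp add: algebra_simps)
  qed (use al nu in auto)
  have r: "bd UNIV n (2^n * (2^n * \<alpha> * \<alpha>) * (2^n * (1 / (2 * \<nu>)))) \<nu> (cr a \<nu> d)"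
    unfolding cr_def by (rule bd_uminus[OF bd_mult[OF bd_mult[OF an an] s2]])
  show "bd UNIV n (8^(n+1) * (\<alpha>^2 / \<nu>)) \<nu> (cr a \<nu> d)"
  proof (rule bd_mono[OF r])
    have "8^n * (1/2) * (\<alpha>^2 / \<nu>) \<le> 8^n * 8 * (\<alpha>^2 / \<nu>)"
      using al nu by (intro mult_right_mono mult_mono) auto
    moreover have "(2::real)^n * 2^n * 2^n = 8^n" by (simp add: power_mult_distrib[symmetric])
    ultimately show "2^n * (2^n * \<alpha> * \<alpha>) * (2^n * (1 / (2 * \<nu>))) \<le> 8^(n+1) * (\<alpha>^2 / \<nu>)"
      by (simp add: algebra_simps power2_eq_square)
  qed (use al nu in auto)
qed

text \<open>The Hessian \<open>H\<close> is paired with \<open>cp\<close>, of size \<alpha>/\<nu>.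
  The other terms contain two amplitudes and two derivatives of amplitudes; each derivative costs
  \<mu> and comes with a factor 1/\<nu>.\<close>

lemma cerr_bd:
  assumes a: "bd UNIV (n + 2) \<alpha> \<mu> a" and al: "0 \<le> \<alpha>" and mu: "0 \<le> \<mu>" "\<mu> \<le> \<nu>" and nu: "0 < \<nu>"
    and H: "\<And>i j. bd UNIV n \<eta> \<nu> (H i j)" and eta: "0 \<le> \<eta>"
  shows "bd UNIV n (8^(2*n+4) * (\<alpha> * \<eta> / \<nu> + (\<alpha> * \<mu> / \<nu>)^2)) \<nu> (cerr H a \<nu> d i j)"
proof -
  have a2: "bd UNIV (Suc (Suc n)) \<alpha> \<mu> a" using a by simp
  have a1: "bd UNIV n (\<alpha> * \<mu>) \<nu> (pd i a)" for i
    by (rule bd_mono[OF bd_le[OF bd_pd[OF a2], of n]]) (use al mu nu in auto)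
  have a0: "bd UNIV n (\<alpha> * \<mu> * \<mu>) \<nu> (pd i (pd j a))" for i j
    by (rule bd_mono[OF bd_pd[OF bd_pd[OF a2]]]) (use al mu nu in auto)
  have an: "bd UNIV n \<alpha> \<mu> a" by (rule bd_le[OF a]) simp
  note c = corr_bd[OF an al mu nu, of d]
  have c2: "bd UNIV n (1 + 2^n * (1/2)) \<nu> (\<lambda>x. 1 - 1/2 * cos (2 * \<nu> * x $ d))"
    by (rule bd_minus[OF bd_const bd_scale_freq[OF bd_cos]]) (use nu in auto)
  have t1: "bd UNIV n (2^n * (1 + 2^n * (1/2)) * (\<bar>1 / \<nu>^2\<bar> * (2^n * (\<alpha> * \<mu>) * (\<alpha> * \<mu>)))) \<nu>
     (\<lambda>x. (1 - 1/2 * cos (2 * \<nu> * x $ d)) * (1 / \<nu>^2 * (pd i a x * pd j a x)))"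
    by (rule bd_mult[OF c2 bd_cmult[OF bd_mult[OF a1 a1]]])
  have t2: "bd UNIV n (\<bar>1/2\<bar> * (2^n * (8^(n+1) * (\<alpha> / \<nu>^2)) * (\<alpha> * \<mu> * \<mu> + \<alpha> * \<mu> * \<mu>))) \<nu>
     (\<lambda>x. 1/2 * (cq a \<nu> d x * (pd i (pd j a) x + pd j (pd i a) x)))"
    by (rule bd_cmult[OF bd_mult[OF c(2) bd_add[OF a0 a0]]])
  have t3: "bd UNIV n (\<bar>1/2\<bar> * (2^n * (8^(n+1) * (\<alpha> / \<nu>)) * (\<eta> + \<eta>))) \<nu>
     (\<lambda>x. 1/2 * (cp a \<nu> d x * (H i j x + H j i x)))"
    by (rule bd_cmult[OF bd_mult[OF c(1) bd_add[OF H H]]])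
  note t = bd_minus[OF bd_add[OF t1 t2] t3]
  define X where "X = (\<alpha> * \<mu> / \<nu>)^2"
  define Y where "Y = \<alpha> * \<eta> / \<nu>"
  have XY: "0 \<le> X" "0 \<le> Y" using al eta nu by (auto simp: X_def Y_def)
  have p2: "(1::real) \<le> 2^n" "(2::real)^n \<le> 8^n" "(4::real)^n \<le> 8^n" "(1::real) \<le> 8^n" by (auto intro: power_mono)
  have e8: "(8::real)^(2*n+4) = 4096 * (8^n * 8^n)" by (simp add: power_add power_mult power2_eq_square[symmetric] power_mult_distrib[symmetric])
     (simp add: power2_eq_square power_mult_distrib[symmetric])
  have e1: "2^n * (1 + 2^n * (1/2)) * (\<bar>1 / \<nu>^2\<bar> * (2^n * (\<alpha> * \<mu>) * (\<alpha> * \<mu>))) = 4^n * (1 + 2^n * (1/2)) * X"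
    using nu by (simp add: X_def power2_eq_square power_mult_distrib[symmetric] field_simps)
  have e2: "\<bar>1/2\<bar> * (2^n * (8^(n+1) * (\<alpha> / \<nu>^2)) * (\<alpha> * \<mu> * \<mu> + \<alpha> * \<mu> * \<mu>)) = 8 * (2^n * 8^n) * X"
    using nu by (simp add: X_def power2_eq_square field_simps)
  have e3: "\<bar>1/2\<bar> * (2^n * (8^(n+1) * (\<alpha> / \<nu>)) * (\<eta> + \<eta>)) = 8 * (2^n * 8^n) * Y"
    using nu by (simp add: Y_def field_simps)
  have m1: "4^n * (1 + 2^n * (1/2)) * X \<le> (8^n * (2 * 8^n)) * X"
  proof (intro mult_right_mono mult_mono)
    show "1 + 2^n * (1/2) \<le> 2 * (8::real)^n" using p2 by linarith
  qed (use XY p2 in auto)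
  have m2: "8 * (2^n * 8^n) * X \<le> 8 * (8^n * 8^n) * X" using XY p2 by (intro mult_right_mono mult_left_mono) auto
  have m3: "8 * (2^n * 8^n) * Y \<le> 8 * (8^n * 8^n) * Y" using XY p2 by (intro mult_right_mono mult_left_mono) auto
  have nn: "0 \<le> (8^n * 8^n) * X" "0 \<le> (8^n * 8^n) * Y" using XY by auto
  show ?thesis
    unfolding cerr_def
  proof (rule bd_mono[OF t])
    show "2^n * (1 + 2^n * (1/2)) * (\<bar>1 / \<nu>^2\<bar> * (2^n * (\<alpha> * \<mu>) * (\<alpha> * \<mu>)))
      + \<bar>1/2\<bar> * (2^n * (8^(n+1) * (\<alpha> / \<nu>^2)) * (\<alpha> * \<mu> * \<mu> + \<alpha> * \<mu> * \<mu>))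
      + \<bar>1/2\<bar> * (2^n * (8^(n+1) * (\<alpha> / \<nu>)) * (\<eta> + \<eta>)) \<le> 8^(2*n+4) * (\<alpha> * \<eta> / \<nu> + (\<alpha> * \<mu> / \<nu>)^2)"
      unfolding e1 e2 e3 e8 X_def[symmetric] Y_def[symmetric]
      using m1 m2 m3 nn by (simp add: algebra_simps)
    show "0 \<le> 8^(2*n+4) * (\<alpha> * \<eta> / \<nu> + (\<alpha> * \<mu> / \<nu>)^2)" using XY by (simp add: X_def Y_def)
  qed (use nu in auto)
qed

text \<open>After \<open>i\<close> corrugations the frequency is \<open>freq k l \<sigma> i\<close>, and the component \<open>a\<close> has been corrugated \<open>uses k i a\<close>
  times: \<open>uses k i a\<close> counts the \<open>i' < i\<close> with \<open>i' mod k = a\<close>.\<close>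

definition fexp :: "nat \<Rightarrow> nat \<Rightarrow> nat" where
  "fexp k i = (if i = 0 then 0 else 2 * ((i - 1) div k + 1) + (i - 1) div 2)"

definition freq :: "nat \<Rightarrow> real \<Rightarrow> real \<Rightarrow> nat \<Rightarrow> real" where
  "freq k l \<sigma> i = \<sigma> ^ fexp k i / l"

definition uses :: "nat \<Rightarrow> nat \<Rightarrow> nat \<Rightarrow> nat" where
  "uses k i a = (i + k - 1 - a) div k"

lemma uses_current: "1 \<le> k \<Longrightarrow> uses k i (i mod k) = i div k"
proof -
  assume k: "1 \<le> k"
  have "i mod k \<le> k - 1" using k by (simp add: mod_less_divisor less_imp_le_nat Suc_leI flip: less_Suc_eq_le)
  then have "i + k - 1 - i mod k = (k - 1) + k * (i div k)" using k mult_div_mod_eq[of k i] by linarith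
  moreover have "((k - 1) + k * (i div k)) div k = i div k + (k - 1) div k"
    using k by (intro div_mult_self2) simp
  ultimately show ?thesis using k by (simp add: uses_def)
qed

lemma uses_next: "1 \<le> k \<Longrightarrow> uses k (Suc i) (i mod k) = i div k + 1"
proof -
  assume k: "1 \<le> k"
  have "i mod k \<le> k - 1" using k by (simp add: mod_less_divisor less_imp_le_nat Suc_leI flip: less_Suc_eq_le)
  then have "Suc i + k - 1 - i mod k = k * (i div k) + k" using k mult_div_mod_eq[of k i] by linarith
  then have "Suc i + k - 1 - i mod k = k * (i div k + 1)" by simp
  then show ?thesis using k by (simp add: uses_def)
qed

lemma uses_mono: "i \<le> i' \<Longrightarrow> uses k i a \<le> uses k i' a"
  unfolding uses_def by (intro div_le_mono) simp

lemma fexp_mono: "i \<le> i' \<Longrightarrow> fexp k i \<le> fexp k i'"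
  unfolding fexp_def by (auto intro!: add_mono mult_le_mono div_le_mono)

text \<open>A function much larger than its derivatives suggest is fitted into the format of
  \<open>bd\<close>: \<eta> is \<nu> times \<eta>/\<nu>, so the constant grows by \<eta>/\<nu> only.
  It serves gradients of size \<open>G\<close> whose Hessians are of size \<eta>.\<close>

lemma bd_raise:
  assumes "\<And>x. f differentiable (at x)" "\<And>x. x \<in> U \<Longrightarrow> \<bar>f x\<bar> \<le> g"
    "\<And>i. bd U n \<eta> \<nu> (pd i f)" "0 < \<nu>" "0 \<le> g" "0 \<le> \<eta>"
  shows "bd U (Suc n) (g + \<eta> / \<nu>) \<nu> f"
proof -
  have "bd U n ((g + \<eta> / \<nu>) * \<nu>) \<nu> (pd i f)" for i
    by (rule bd_mono[OF assms(3)]) (use assms(4-6) in \<open>auto simp: field_simps\<close>)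
  moreover have "\<bar>f x\<bar> \<le> g + \<eta> / \<nu>" if "x \<in> U" for x
    using assms(2)[OF that] assms(4,6) by (simp add: add_increasing2)
  ultimately show ?thesis using assms(1) by auto
qed

text \<open>\<open>V\<close> and \<open>W\<close> are the accumulated perturbations.
  \<open>V\<close> is made of amplitudes and profiles and is controlled on the plane, with
  \<open>n\<close> orders beyond the Hessian, because its Hessian enters the next errors.
  \<open>W\<close> contains the gradient of the mollified map and is controlled on \<open>X\<close>
  only; it enters the strain linearly and no error contains it, so two derivatives suffice.\<close>

definition vw_bounds :: "nat \<Rightarrow> (real^2) set \<Rightarrow> real \<Rightarrow> real \<Rightarrow> real \<Rightarrow> real \<Rightarrow> nat \<Rightarrow> nat \<Rightarrow> real \<Rightarrow> nat
    \<Rightarrow> (nat \<Rightarrow> real^2 \<Rightarrow> real) \<Rightarrow> (2 \<Rightarrow> real^2 \<Rightarrow> real) \<Rightarrow> bool" where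
  "vw_bounds k X l \<sigma> E G J n B i V W \<longleftrightarrow>
     (\<forall>a<k. (\<forall>x. V a differentiable (at x)) \<and> (\<forall>j x. pd j (V a) differentiable (at x)) \<and>
        (\<forall>x. \<bar>V a x\<bar> \<le> B * E) \<and> (\<forall>j x. \<bar>pd j (V a) x\<bar> \<le> B * E) \<and>
        (\<forall>j j'. bd UNIV n (B * E * \<sigma> ^ (2 * uses k i a) / l) (freq k l \<sigma> i) (pd j (pd j' (V a))))) \<and>
     (\<forall>j. bd {} 2 0 0 (W j) \<and> (\<forall>x\<in>X. \<bar>W j x\<bar> \<le> B * E * (1 + E + G) \<and>
        (\<forall>i. \<bar>pd i (W j) x\<bar> \<le> B * E * (1 + E + G)) \<and>
        (\<forall>i i'. \<bar>pd i' (pd i (W j)) x\<bar> \<le> B * E * (1 + E + G) * \<sigma> ^ (2 * J) / l)))"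

text \<open>Bounds on \<open>v0\<close> are only available on \<open>X\<close>, whereas the corrugation error must be controlled on the whole
  plane for the next potential. Therefore the error is formed with the cut-off Hessian \<open>H0\<close>, which agrees with
  the true one on \<open>X\<close>.\<close>

locale corrugation_data =
  fixes k :: nat and X :: "(real^2) set" and R l \<sigma> E G :: real and J N :: nat and Z :: real
    and v0 :: "nat \<Rightarrow> real^2 \<Rightarrow> real" and w0 :: "2 \<Rightarrow> real^2 \<Rightarrow> real"
    and H0 :: "nat \<Rightarrow> 2 \<Rightarrow> 2 \<Rightarrow> real^2 \<Rightarrow> real" and ch :: "real^2 \<Rightarrow> real"
  assumes k1: "1 \<le> k" and l0: "0 < l" and l1: "l \<le> 1" and sg: "1 \<le> \<sigma>" and E0: "0 < E" and G0: "0 \<le> G"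
    and R0: "0 \<le> R" and Z1: "1 \<le> Z"
    and XR: "\<And>x. x \<in> X \<Longrightarrow> norm x \<le> R"
    and v0_smooth: "\<And>a. a < k \<Longrightarrow> bd {} 3 0 0 (v0 a)" and w0_smooth: "\<And>j. bd {} 2 0 0 (w0 j)"
    and v0_grad: "\<And>a j x. a < k \<Longrightarrow> x \<in> X \<Longrightarrow> \<bar>pd j (v0 a) x\<bar> \<le> G"
    and v0_hess: "\<And>a i j. a < k \<Longrightarrow> bd X 1 (Z * E / l) (1 / l) (pd i (pd j (v0 a)))"
    and H0_bd: "\<And>a i j. a < k \<Longrightarrow> bd UNIV N (Z * E / l) (1 / l) (H0 a i j)"
    and H0_eq: "\<And>a i j x. a < k \<Longrightarrow> x \<in> X \<Longrightarrow> H0 a i j x = pd i (pd j (v0 a)) x"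
    and chi_bd: "bd UNIV N Z (1 / l) ch"
    and chi_one: "\<And>x. x \<in> X \<Longrightarrow> ch x = 1"
    and chi_zero: "\<And>x. R \<le> norm x \<Longrightarrow> ch x = 0"
begin

abbreviation VW where "VW \<equiv> vw_bounds k X l \<sigma> E G J"
abbreviation fr where "fr \<equiv> freq k l \<sigma>"

lemma fr_ge: "1 / l \<le> fr i"
  unfolding freq_def using sg l0 by (simp add: divide_right_mono)

lemma fr_ge1: "1 \<le> fr i"
proof -
  have "1 \<le> 1 / l" using l0 l1 by simp
  then show ?thesis using fr_ge[of i] by linarith
qed

lemma fr_mono: "i \<le> i' \<Longrightarrow> fr i \<le> fr i'"
  unfolding freq_def using sg l0 by (intro divide_right_mono power_increasing fexp_mono) auto

lemma VW_mono:
  assumes "VW n B i V W" "n' \<le> n" "B \<le> B'" "0 \<le> B"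
  shows "VW n' B' i V W"
proof -
  have BE: "B * E \<le> B' * E" using assms(3) E0 by simp
  have Y: "B * E * (1 + E + G) \<le> B' * E * (1 + E + G)" using BE E0 G0 by (simp add: mult_right_mono)
  have Y2: "B * E * (1 + E + G) * \<sigma> ^ (2 * J) / l \<le> B' * E * (1 + E + G) * \<sigma> ^ (2 * J) / l"
    using sg l0 by (intro divide_right_mono mult_right_mono[OF Y]) auto
  have h: "bd UNIV n' (B' * E * \<sigma> ^ m / l) (fr i) f" if "bd UNIV n (B * E * \<sigma> ^ m / l) (fr i) f" for f m
  proof (rule bd_mono[OF bd_le[OF that assms(2)]])
    show "B * E * \<sigma> ^ m / l \<le> B' * E * \<sigma> ^ m / l"
      using sg l0 by (intro divide_right_mono mult_right_mono[OF BE]) auto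
    show "0 \<le> fr i" using fr_ge1[of i] by simp
    show "0 \<le> B' * E * \<sigma> ^ m / l" using assms(3,4) E0 sg l0 by simp
  qed auto
  show ?thesis
    unfolding vw_bounds_def
    using assms(1)[unfolded vw_bounds_def] h BE Y Y2 by (meson order_trans)
qed

lemma V_smooth:
  assumes "VW n B i V W" "1 \<le> n" "a < k"
  shows "bd {} 3 0 0 (V a)"
proof -
  have "bd {} 1 0 0 (pd j (pd j' (V a)))" for j j'
    using assms bd_le[OF bd_smooth, of UNIV n _ "fr i" _ 1] unfolding vw_bounds_def by blast
  then show ?thesis using assms(1,3) unfolding vw_bounds_def by (auto simp: numeral_3_eq_3)
qed

text \<open>Write \<open>s\<close> for \<open>i div 2\<close> and \<open>c\<close> for
  \<open>i div k\<close>. An amplitude of size E/\<sigma>^s meets a Hessian of size E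
  \<sigma>^(2c)/l; divided by the new frequency, their product is the square of E/\<sigma>^(s+1) up
  to constants. The derivatives of the amplitude contribute the same, since \<mu> is below the new
  frequency by a factor \<sigma>. This is the gain of one round.\<close>

lemma corr_step:
  fixes d :: 2
  assumes VW: "VW n B i V W" and n: "1 \<le> n" and nN: "n \<le> N" and ZB: "Z \<le> B" and A: "1 \<le> A"
    and am: "bd UNIV (n + 2) (A * E / \<sigma> ^ (i div 2)) \<mu> am" and mu: "0 < \<mu>" "\<mu> * \<sigma> \<le> fr (Suc i)"
    and iJ: "i div k + 1 \<le> J"
  defines "b \<equiv> i mod k" and "\<nu> \<equiv> fr (Suc i)"
  defines "V' \<equiv> V(b := (\<lambda>x. V b x + cp am \<nu> d x))"
    and "W' \<equiv> (\<lambda>j x. W j x + cw am \<nu> d (\<lambda>x. v0 b x + V b x) j x)"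
  shows "VW n (8 ^ (2 * n + 10) * A^2 * B) (Suc i) V' W'"
    and "\<And>j j'. bd UNIV n (8 ^ (2 * n + 10) * A^2 * B * (E / \<sigma> ^ (i div 2 + 1))^2) \<nu>
            (cerr (\<lambda>j j' x. H0 b j j' x + pd j (pd j' (V b)) x) am \<nu> d j j')"
    and "\<And>j j' x. x \<in> X \<Longrightarrow> vk k (\<lambda>a x. v0 a x + V' a x) (\<lambda>j x. w0 j x + W' j x) j j' x
        = vk k (\<lambda>a x. v0 a x + V a x) (\<lambda>j x. w0 j x + W j x) j j' x + (if j = d \<and> j' = d then (am x)^2 else 0)
          + cerr (\<lambda>j j' x. H0 b j j' x + pd j (pd j' (V b)) x) am \<nu> d j j' x"
proof -
  have bk: "b < k" using k1 by (simp add: b_def)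
  define s where "s = i div 2"
  define c where "c = i div k"
  define \<alpha> where "\<alpha> = A * E / \<sigma> ^ s"
  define \<eta> where "\<eta> = 2 * B * E * \<sigma> ^ (2 * c) / l"
  have B: "1 \<le> B" using ZB Z1 by simp
  have nu1: "1 \<le> \<nu>" unfolding \<nu>_def by (rule fr_ge1)
  then have nu0: "0 < \<nu>" by simp
  have al0: "0 \<le> \<alpha>" using A E0 sg by (simp add: \<alpha>_def)
  have eta0: "0 \<le> \<eta>" using B E0 sg l0 by (simp add: \<eta>_def)
  have sp: "0 < \<sigma> ^ m" "1 \<le> \<sigma> ^ m" for m using sg by auto
  have al1: "\<alpha> \<le> A * E" unfolding \<alpha>_def using divide_left_mono[of 1 "\<sigma>^s" "A * E"] sp A E0 by simp
  have nu_eq: "\<nu> = \<sigma> ^ (2 * (c + 1)) * \<sigma> ^ s / l"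
    by (simp add: \<nu>_def freq_def fexp_def c_def s_def power_add)
  \<comment> \<open>\<open>fexp\<close> is made for this equation. Amplitude times frequency is the
    size of the new Hessian of component \<open>b\<close>; the decay of the amplitude cancels, and
    the budget for \<open>c + 1\<close> uses remains.\<close>
  have anu: "\<alpha> * \<nu> = A * E * \<sigma> ^ (2 * (c + 1)) / l"
    unfolding \<alpha>_def nu_eq using sp(1)[of s] by simp
  have muN: "\<mu> \<le> \<nu>"
  proof -
    have "\<mu> * 1 \<le> \<mu> * \<sigma>" using mu(1) sg by (intro mult_left_mono) auto
    then show ?thesis using mu(2) by (simp add: \<nu>_def)
  qed
  have am': "bd UNIV (n + 2) \<alpha> \<mu> am" using am by (simp add: \<alpha>_def s_def)
  have eta_nu: "\<eta> / \<nu> = 2 * B * E / (\<sigma>^2 * \<sigma> ^ s)"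
    unfolding \<eta>_def nu_eq using l0 sp(1)[of "2*c"] by (simp add: field_simps power2_eq_square)
  have eta_nu1: "\<eta> / \<nu> \<le> 2 * B * E"
  proof -
    have "1 * 1 \<le> \<sigma>^2 * \<sigma>^s" by (intro mult_mono sp) auto
    then show ?thesis unfolding eta_nu using divide_left_mono[of 1 "\<sigma>^2 * \<sigma>^s" "2 * B * E"] B E0 by simp
  qed
  from VW have V: "\<And>a x. a < k \<Longrightarrow> V a differentiable (at x)" "\<And>a j x. a < k \<Longrightarrow> pd j (V a) differentiable (at x)"
    "\<And>a x. a < k \<Longrightarrow> \<bar>V a x\<bar> \<le> B * E" "\<And>a j x. a < k \<Longrightarrow> \<bar>pd j (V a) x\<bar> \<le> B * E"
    "\<And>a j j'. a < k \<Longrightarrow> bd UNIV n (B * E * \<sigma> ^ (2 * uses k i a) / l) (fr i) (pd j (pd j' (V a)))"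
    and W: "\<And>j. bd {} 2 0 0 (W j)" "\<And>j x. x \<in> X \<Longrightarrow> \<bar>W j x\<bar> \<le> B * E * (1 + E + G)"
    "\<And>j i x. x \<in> X \<Longrightarrow> \<bar>pd i (W j) x\<bar> \<le> B * E * (1 + E + G)"
    "\<And>j i i' x. x \<in> X \<Longrightarrow> \<bar>pd i' (pd i (W j)) x\<bar> \<le> B * E * (1 + E + G) * \<sigma> ^ (2 * J) / l"
    unfolding vw_bounds_def by blast+
  have ub: "uses k i b = c" "uses k (Suc i) b = c + 1"
    using uses_current[OF k1] uses_next[OF k1] by (auto simp: b_def c_def)
  have Vb: "bd UNIV n (B * E * \<sigma> ^ (2 * c) / l) \<nu> (pd j (pd j' (V b)))" for j j'
    by (rule bd_mono[OF V(5)[OF bk, unfolded ub]]) (use fr_mono[of i "Suc i"] fr_ge1[of i] B E0 sg l0 in \<open>auto simp: \<nu>_def\<close>)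
  have ZE: "Z * E / l \<le> B * E * \<sigma> ^ (2 * c) / l"
  proof -
    have "Z * E * 1 \<le> B * E * \<sigma> ^ (2 * c)" using ZB E0 Z1 B sp by (intro mult_mono) auto
    then show ?thesis using l0 by (simp add: divide_right_mono)
  qed
  have lnu: "1 / l \<le> \<nu>" unfolding \<nu>_def by (rule fr_ge)
  have B2: "B * E * \<sigma> ^ (2 * c) / l + B * E * \<sigma> ^ (2 * c) / l = \<eta>" by (simp add: \<eta>_def)
  \<comment> \<open>Both summands fit into half of \<eta>: the cut-off Hessian of the mollified
    component because \<open>Z \<le> B\<close>, and that of \<open>V b\<close> by the count of its
    uses.\<close>
  have H: "bd UNIV n \<eta> \<nu> (\<lambda>x. H0 b j j' x + pd j (pd j' (V b)) x)" for j j'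
    unfolding B2[symmetric]
    by (rule bd_add[OF bd_mono[OF bd_le[OF H0_bd[OF bk] nN]] Vb])
      (use ZE lnu l0 B E0 sg in auto)
  have err_c: "8 ^ (2 * n + 4) * (\<alpha> * \<eta> / \<nu> + (\<alpha> * \<mu> / \<nu>)^2) \<le> 8 ^ (2 * n + 10) * A^2 * B * (E / \<sigma> ^ (s + 1))^2"
  proof -
    have 1: "\<alpha> * \<eta> / \<nu> = 2 * (A * B * (E / \<sigma> ^ (s + 1))^2)"
    proof -
      have "\<alpha> * \<eta> / \<nu> = \<alpha> * (\<eta> / \<nu>)" by simp
      also have "\<dots> = 2 * (A * B * (E / \<sigma> ^ (s + 1))^2)"
        unfolding eta_nu using sp(1)[of s] sg by (simp add: \<alpha>_def field_simps power2_eq_square)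
      finally show ?thesis .
    qed
    have "\<mu> / \<nu> \<le> 1 / \<sigma>" using mu nu0 sg by (simp add: \<nu>_def field_simps)
    then have "\<alpha> * (\<mu> / \<nu>) \<le> \<alpha> * (1 / \<sigma>)" using al0 by (rule mult_left_mono)
    then have "(\<alpha> * \<mu> / \<nu>)^2 \<le> (\<alpha> / \<sigma>)^2" using al0 mu nu0 by (intro power_mono) auto
    also have "(\<alpha> / \<sigma>)^2 = A^2 * (E / \<sigma> ^ (s + 1))^2"
      by (simp add: \<alpha>_def power_mult_distrib power_divide field_simps)
    finally have 2: "(\<alpha> * \<mu> / \<nu>)^2 \<le> A^2 * (E / \<sigma> ^ (s + 1))^2" .
    have "A * B \<le> A^2 * B" "A^2 * 1 \<le> A^2 * B"
      using A B by (auto simp: power2_eq_square intro!: mult_right_mono mult_left_mono)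
    then have "2 * (A * B * (E / \<sigma> ^ (s + 1))^2) + A^2 * (E / \<sigma> ^ (s + 1))^2 \<le> 3 * (A^2 * B * (E / \<sigma> ^ (s + 1))^2)"
      using mult_right_mono[of "2 * (A * B) + A^2" "3 * (A^2 * B)" "(E / \<sigma> ^ (s + 1))^2"] by (simp add: algebra_simps)
    then have 3: "\<alpha> * \<eta> / \<nu> + (\<alpha> * \<mu> / \<nu>)^2 \<le> 3 * (A^2 * B * (E / \<sigma> ^ (s + 1))^2)"
      using 1 2 by linarith
    have "0 \<le> A^2 * B * (E / \<sigma> ^ (s + 1))^2" using B by simp
    then have "3 * (A^2 * B * (E / \<sigma> ^ (s + 1))^2) \<le> 8 ^ 6 * (A^2 * B * (E / \<sigma> ^ (s + 1))^2)"
      by (intro mult_right_mono) auto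
    then have "8 ^ (2 * n + 4) * (\<alpha> * \<eta> / \<nu> + (\<alpha> * \<mu> / \<nu>)^2) \<le> 8 ^ (2 * n + 4) * (8 ^ 6 * (A^2 * B * (E / \<sigma> ^ (s + 1))^2))"
      by (intro mult_left_mono order_trans[OF 3]) auto
    also have "\<dots> = 8 ^ (2 * n + 10) * A^2 * B * (E / \<sigma> ^ (s + 1))^2" by (simp add: power_add)
    finally show ?thesis .
  qed
  show "bd UNIV n (8 ^ (2 * n + 10) * A^2 * B * (E / \<sigma> ^ (i div 2 + 1))^2) \<nu>
            (cerr (\<lambda>j j' x. H0 b j j' x + pd j (pd j' (V b)) x) am \<nu> d j j')" for j j'
    by (rule bd_mono[OF cerr_bd[OF am' al0 less_imp_le[OF mu(1)] muN nu0 H eta0]])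
      (use err_c B nu0 in \<open>auto simp: s_def\<close>)
  let ?u = "\<lambda>x. v0 b x + V b x"
  have v0d: "\<And>x. v0 a differentiable (at x)" "\<And>j x. pd j (v0 a) differentiable (at x)" if "a < k" for a
    using v0_smooth[OF that] by (auto simp: numeral_3_eq_3)
  have pu: "pd j (\<lambda>x. v0 a x + V a x) = (\<lambda>x. pd j (v0 a) x + pd j (V a) x)" if "a < k" for j a
    by (rule ext) (rule pd_add[OF v0d(1)[OF that] V(1)[OF that]])
  have ppu: "pd i (pd j (\<lambda>x. v0 a x + V a x)) = (\<lambda>x. pd i (pd j (v0 a)) x + pd i (pd j (V a)) x)" if "a < k" for i j a
    unfolding pu[OF that] by (rule ext) (rule pd_add[OF v0d(2)[OF that] V(2)[OF that]])
  have amd: "am differentiable (at x)" "pd j am differentiable (at x)" for j x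
    using am' by (auto simp: numeral_2_eq_2)
  have Wd: "W j differentiable (at x)" "pd i (W j) differentiable (at x)" for i j x
    using W(1) by (auto simp: numeral_2_eq_2)
  have w0d: "w0 j differentiable (at x)" for j x
    using w0_smooth by (auto simp: numeral_2_eq_2)
  show "vk k (\<lambda>a x. v0 a x + V' a x) (\<lambda>j x. w0 j x + W' j x) j j' x
        = vk k (\<lambda>a x. v0 a x + V a x) (\<lambda>j x. w0 j x + W j x) j j' x + (if j = d \<and> j' = d then (am x)^2 else 0)
          + cerr (\<lambda>j j' x. H0 b j j' x + pd j (pd j' (V b)) x) am \<nu> d j j' x" if "x \<in> X" for j j' x
  proof -
    have e1: "(\<lambda>a x. v0 a x + V' a x) = (\<lambda>a x. v0 a x + V a x)(b := (\<lambda>x. (v0 b x + V b x) + cp am \<nu> d x))"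
      by (auto simp: V'_def fun_eq_iff)
    have e2: "(\<lambda>j x. w0 j x + W' j x) = (\<lambda>j x. (w0 j x + W j x) + cw am \<nu> d ?u j x)"
      by (auto simp: W'_def fun_eq_iff)
    have e3: "cerr (\<lambda>i j. pd i (pd j ?u)) am \<nu> d j j' x = cerr (\<lambda>j j' x. H0 b j j' x + pd j (pd j' (V b)) x) am \<nu> d j j' x"
      using H0_eq[OF bk that] by (simp add: cerr_def ppu[OF bk])
    show ?thesis
      unfolding e1 e2 e3[symmetric]
      by (rule corrugation_identity[where v = "\<lambda>a x. v0 a x + V a x" and w = "\<lambda>j x. w0 j x + W j x", OF bk nu0])
        (auto simp: pu[OF bk] intro!: differentiable_add v0d V w0d Wd amd bk)
  qed
  let ?B = "8 ^ (2 * n + 10) * A^2 * B"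
  have A2: "A \<le> A^2" "1 \<le> A^2" using A self_le_power[of A 2] by auto
  have p8: "(1::real) \<le> 8 ^ m" for m by simp
  have AB: "A \<le> A^2 * B" "B \<le> A^2 * B" "A * B \<le> A^2 * B"
    using mult_mono[OF A2(1) B] mult_right_mono[OF A2(2), of B] mult_right_mono[OF A2(1), of B] A B by auto
  have cp: "bd UNIV (n + 2) (8 ^ (n + 3) * (\<alpha> / \<nu>)) \<nu> (cp am \<nu> d)"
    using corr_bd(1)[OF am' al0 less_imp_le[OF mu(1)] muN nu0] by (simp add: eval_nat_numeral)
  have cp2: "bd UNIV (Suc (Suc n)) (8 ^ (n + 3) * (\<alpha> / \<nu>)) \<nu> (cp am \<nu> d)" using cp by simp
  have cpd: "cp am \<nu> d differentiable (at x)" "pd j (cp am \<nu> d) differentiable (at x)" for j x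
    using cp2 by auto
  have an: "\<alpha> / \<nu> \<le> A * E"
    using al1 divide_left_mono[OF nu1 al0] nu0 by simp
  have Bp: "B + 8 ^ (n + 3) * A \<le> ?B"
  proof -
    have "B + 8 ^ (n + 3) * A \<le> 8 ^ (n + 3) * (A^2 * B) + 8 ^ (n + 3) * (A^2 * B)"
      using AB mult_mono[OF p8[of "n + 3"] AB(2)] A B by (intro add_mono mult_left_mono) auto
    also have "\<dots> \<le> 8 ^ (n + 4) * (A^2 * B)" using A B by (simp add: power_add)
    also have "\<dots> \<le> 8 ^ (2 * n + 10) * (A^2 * B)"
      using A B by (intro mult_right_mono power_increasing) auto
    finally show ?thesis by (simp add: mult.assoc)
  qed
  have BpE: "B * E + 8 ^ (n + 3) * A * E \<le> ?B * E" using mult_right_mono[OF Bp, of E] E0 by (simp add: algebra_simps)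
  have BB: "B \<le> ?B" using Bp A by (smt (verit) mult_nonneg_nonneg zero_le_power)
  have VV': "(\<forall>x. V' a differentiable (at x)) \<and> (\<forall>j x. pd j (V' a) differentiable (at x)) \<and>
        (\<forall>x. \<bar>V' a x\<bar> \<le> ?B * E) \<and> (\<forall>j x. \<bar>pd j (V' a) x\<bar> \<le> ?B * E) \<and>
        (\<forall>j j'. bd UNIV n (?B * E * \<sigma> ^ (2 * uses k (Suc i) a) / l) \<nu> (pd j (pd j' (V' a))))"
    if a: "a < k" for a
  proof (cases "a = b")
    case False
    then have Va: "V' a = V a" by (simp add: V'_def)
    have "bd UNIV n (?B * E * \<sigma> ^ (2 * uses k (Suc i) a) / l) \<nu> (pd j (pd j' (V a)))" for j j'
    proof (rule bd_mono[OF V(5)[OF a]])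
      show "B * E * \<sigma> ^ (2 * uses k i a) / l \<le> ?B * E * \<sigma> ^ (2 * uses k (Suc i) a) / l"
        using BB E0 l0 sg uses_mono[of i "Suc i" k a] B
        by (intro divide_right_mono mult_mono power_increasing) auto
    qed (use fr_mono[of i "Suc i"] fr_ge1[of i] B E0 l0 sg in \<open>auto simp: \<nu>_def\<close>)
    moreover have "B * E \<le> ?B * E" by (rule mult_right_mono[OF BB less_imp_le[OF E0]])
    ultimately show ?thesis unfolding Va using V[OF a] by (meson order_trans)
  next
    case True
    have Va: "V' a = (\<lambda>x. V b x + cp am \<nu> d x)" using True by (simp add: V'_def)
    have p1: "pd j (V' a) = (\<lambda>x. pd j (V b) x + pd j (cp am \<nu> d) x)" for j
      unfolding Va by (rule ext) (rule pd_add[OF V(1)[OF bk] cpd(1)])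
    have p2: "pd j (pd j' (V' a)) = (\<lambda>x. pd j (pd j' (V b)) x + pd j (pd j' (cp am \<nu> d)) x)" for j j'
      unfolding p1 by (rule ext) (rule pd_add[OF V(2)[OF bk] cpd(2)])
    have "\<bar>V' a x\<bar> \<le> ?B * E" for x
    proof -
      have "8 ^ (n + 3) * (\<alpha> / \<nu>) \<le> 8 ^ (n + 3) * (A * E)" by (rule mult_left_mono[OF an]) simp
      then have "\<bar>cp am \<nu> d x\<bar> \<le> 8 ^ (n + 3) * A * E" using bd_bound[OF cp, of x] by simp
      then show ?thesis unfolding Va using V(3)[OF bk, of x] BpE by linarith
    qed
    moreover have "\<bar>pd j (V' a) x\<bar> \<le> ?B * E" for j x
    proof -
      have "\<bar>pd j (cp am \<nu> d) x\<bar> \<le> 8 ^ (n + 3) * (\<alpha> / \<nu>) * \<nu>" using bd_bound[OF bd_pd[OF cp2], of x] by simp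
      also have "\<dots> = 8 ^ (n + 3) * \<alpha>" using nu0 by simp
      also have "\<dots> \<le> 8 ^ (n + 3) * A * E" using al1 by simp
      finally show ?thesis unfolding p1 using V(4)[OF bk, of j x] BpE by linarith
    qed
    moreover have "bd UNIV n (?B * E * \<sigma> ^ (2 * uses k (Suc i) a) / l) \<nu> (pd j (pd j' (V' a)))" for j j'
      unfolding p2
    proof (rule bd_mono[OF bd_add[OF Vb bd_pd[OF bd_pd[OF cp2]]]])
      have "8 ^ (n + 3) * (\<alpha> / \<nu>) * \<nu> * \<nu> = 8 ^ (n + 3) * (\<alpha> * \<nu>)" using nu0 by simp
      also have "\<dots> = 8 ^ (n + 3) * A * E * \<sigma> ^ (2 * (c + 1)) / l" by (simp add: anu)
      finally have e: "8 ^ (n + 3) * (\<alpha> / \<nu>) * \<nu> * \<nu> = 8 ^ (n + 3) * A * E * \<sigma> ^ (2 * (c + 1)) / l" .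
      have "B * E * \<sigma> ^ (2 * c) / l \<le> B * E * \<sigma> ^ (2 * (c + 1)) / l"
        using B E0 l0 sg by (intro divide_right_mono mult_left_mono power_increasing) auto
      then have "B * E * \<sigma> ^ (2 * c) / l + 8 ^ (n + 3) * (\<alpha> / \<nu>) * \<nu> * \<nu> \<le> (B * E + 8 ^ (n + 3) * A * E) * \<sigma> ^ (2 * (c + 1)) / l"
        unfolding e by (simp add: algebra_simps add_divide_distrib)
      also have "\<dots> \<le> ?B * E * \<sigma> ^ (2 * (c + 1)) / l"
        using l0 sg by (intro divide_right_mono mult_right_mono BpE) auto
      finally show "B * E * \<sigma> ^ (2 * c) / l + 8 ^ (n + 3) * (\<alpha> / \<nu>) * \<nu> * \<nu> \<le> ?B * E * \<sigma> ^ (2 * uses k (Suc i) a) / l"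
        unfolding True ub(2) .
    qed (use nu0 B E0 l0 sg in auto)
    ultimately show ?thesis using V(1,2)[OF bk] cpd unfolding p1 unfolding Va by (auto intro!: differentiable_add)
  qed
  \<comment> \<open>All parts of \<open>cw\<close> are \<alpha>/\<nu> times a gradient: of size
    \<alpha> in the terms with \<open>cq\<close> and \<open>cr\<close>, and of size G + 3BE for the
    map being corrugated. The 3 is one from \<open>V b\<close> and two from \<eta>/\<nu>.\<close>
  define Q where "Q = 8 ^ 4 * (\<alpha> / \<nu>) * (\<alpha> + (G + 3 * B * E)) * 2"
  have Q0: "0 \<le> Q" using al0 nu0 G0 B E0 by (simp add: Q_def)
  have am2: "bd UNIV 2 \<alpha> \<mu> am" by (rule bd_le[OF am']) simp
  \<comment> \<open>Three derivatives of the amplitude are needed here, because \<open>cw\<close>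
    contains its gradient and \<open>W'\<close> must be twice differentiable. This is where
    \<open>1 \<le> n\<close> enters for the amplitude.\<close>
  have am3: "bd UNIV (Suc 2) \<alpha> \<mu> am" by (rule bd_le[OF am']) (use n in simp)
  note cc = corr_bd[OF am2 al0 less_imp_le[OF mu(1)] muN nu0, of d]
  have pdu: "bd X 2 (G + B * E + \<eta> / \<nu>) \<nu> (pd j ?u)" for j
  proof -
    have "bd X (Suc 1) ((G + B * E) + \<eta> / \<nu>) \<nu> (pd j ?u)"
    proof (rule bd_raise)
      show "pd j ?u differentiable (at x)" for x
        unfolding pu[OF bk] by (intro differentiable_add v0d V bk)
      show "\<bar>pd j ?u x\<bar> \<le> G + B * E" if "x \<in> X" for x
        unfolding pu[OF bk] using v0_grad[OF bk that, of j] V(4)[OF bk, of j x] by linarith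
      show "bd X 1 \<eta> \<nu> (pd i' (pd j ?u))" for i'
        unfolding ppu[OF bk] B2[symmetric]
        by (rule bd_add[OF bd_mono[OF v0_hess[OF bk]] bd_mono[OF bd_le[OF Vb n]]])
          (use ZE lnu l0 B E0 sg nu0 in auto)
    qed (use nu0 G0 B E0 eta0 in auto)
    then show ?thesis by (simp add: numeral_2_eq_2)
  qed
  have cwb: "bd X 2 Q \<nu> (cw am \<nu> d ?u j)" for j
  proof -
    have a1: "bd UNIV 2 (\<alpha> * \<mu>) \<nu> (pd j am)"
      by (rule bd_mono[OF bd_pd[OF am3]]) (use al0 mu muN nu0 in auto)
    have t1: "bd UNIV 2 (2^2 * (8^(2+1) * (\<alpha> / \<nu>^2)) * (\<alpha> * \<mu>)) \<nu> (\<lambda>x. cq am \<nu> d x * pd j am x)"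
      by (rule bd_mult[OF cc(2) a1])
    have t2: "bd UNIV 2 (\<bar>(if j = d then 1 else 0)\<bar> * (8^(2+1) * (\<alpha>^2 / \<nu>))) \<nu> (\<lambda>x. (if j = d then 1 else 0) * cr am \<nu> d x)"
      by (rule bd_cmult[OF cc(3)])
    have t3: "bd X 2 (2^2 * (8^(2+1) * (\<alpha> / \<nu>)) * (G + B * E + \<eta> / \<nu>)) \<nu> (\<lambda>x. cp am \<nu> d x * pd j ?u x)"
      by (rule bd_mult[OF bd_mono[OF cc(1)] pdu]) (use al0 nu0 in auto)
    have t1': "bd X 2 (2048 * (\<alpha> / \<nu> * \<alpha>)) \<nu> (\<lambda>x. cq am \<nu> d x * pd j am x)"
    proof (rule bd_mono[OF t1])
      have "\<alpha> / \<nu> * \<alpha> * (\<mu> / \<nu>) \<le> \<alpha> / \<nu> * \<alpha> * 1" using muN nu0 al0 by (intro mult_left_mono) auto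
      then show "2^2 * (8^(2+1) * (\<alpha> / \<nu>^2)) * (\<alpha> * \<mu>) \<le> 2048 * (\<alpha> / \<nu> * \<alpha>)"
        by (simp add: power2_eq_square)
    qed (use al0 nu0 in auto)
    have t2': "bd X 2 (512 * (\<alpha> / \<nu> * \<alpha>)) \<nu> (\<lambda>x. (if j = d then 1 else 0) * cr am \<nu> d x)"
      by (rule bd_mono[OF t2]) (use al0 nu0 in \<open>auto simp: power2_eq_square\<close>)
    have t3': "bd X 2 (2048 * (\<alpha> / \<nu>) * (G + 3 * B * E)) \<nu> (\<lambda>x. cp am \<nu> d x * pd j ?u x)"
    proof (rule bd_mono[OF t3])
      have "2048 * (\<alpha> / \<nu>) * (G + B * E + \<eta> / \<nu>) \<le> 2048 * (\<alpha> / \<nu>) * (G + 3 * B * E)"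
        by (rule mult_left_mono) (use eta_nu1 al0 nu0 in auto)
      then show "2^2 * (8^(2+1) * (\<alpha> / \<nu>)) * (G + B * E + \<eta> / \<nu>) \<le> 2048 * (\<alpha> / \<nu>) * (G + 3 * B * E)"
        by simp
    qed (use al0 nu0 G0 B E0 in auto)
    have Qn: "0 \<le> \<alpha> / \<nu> * \<alpha>" "0 \<le> \<alpha> / \<nu> * (G + 3 * B * E)" using al0 nu0 G0 B E0 by auto
    have lin: "2048 * x + 512 * x + 2048 * y \<le> 8192 * x + 8192 * y" if "0 \<le> x" "0 \<le> y" for x y :: real
      using that by linarith
    have Qe: "Q = 8192 * (\<alpha> / \<nu> * \<alpha>) + 8192 * (\<alpha> / \<nu> * (G + 3 * B * E))" unfolding Q_def by (simp only: distrib_left) simp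
    have "bd X 2 (2048 * (\<alpha> / \<nu> * \<alpha>) + 512 * (\<alpha> / \<nu> * \<alpha>) + 2048 * (\<alpha> / \<nu>) * (G + 3 * B * E)) \<nu> (cw am \<nu> d ?u j)"
      unfolding cw_def by (intro bd_minus bd_add t1' t2' t3')
    then show ?thesis
    proof (rule bd_mono)
      show "2048 * (\<alpha> / \<nu> * \<alpha>) + 512 * (\<alpha> / \<nu> * \<alpha>) + 2048 * (\<alpha> / \<nu>) * (G + 3 * B * E) \<le> Q"
        unfolding Qe mult.assoc[of 2048] by (rule lin[OF Qn])
    qed (use nu0 Q0 in auto)
  qed
  have cwd: "cw am \<nu> d ?u j differentiable (at x)" "pd i' (cw am \<nu> d ?u j) differentiable (at x)" for j i' x
    using cwb[of j] by (auto simp: numeral_2_eq_2)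
  have Gs: "\<alpha> + (G + 3 * B * E) \<le> 4 * A * B * (1 + E + G)"
  proof -
    have a1: "1 \<le> A * B" using mult_mono[OF A B] A by simp
    have "A * E \<le> A * B * E" "B * E \<le> A * B * E" "G \<le> A * B * G"
      using A B E0 G0 mult_right_mono[OF a1 G0] by (auto intro!: mult_right_mono)
    moreover have "0 \<le> A * B" "0 \<le> A * B * G" using A B G0 by auto
    ultimately show ?thesis using al1 by (simp add: algebra_simps)
  qed
  have Qnu: "Q * \<nu> \<le> 8^6 * (A^2 * B) * E * (1 + E + G)"
  proof -
    have "Q * \<nu> = 8192 * \<alpha> * (\<alpha> + (G + 3 * B * E))" using nu0 by (simp add: Q_def)
    also have "\<dots> \<le> 8192 * (A * E) * (4 * A * B * (1 + E + G))"
      using al0 al1 Gs A B E0 G0 by (intro mult_mono) auto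
    also have "\<dots> \<le> 8^6 * (A^2 * B) * E * (1 + E + G)" using A B E0 G0 by (simp add: power2_eq_square algebra_simps)
    finally show ?thesis .
  qed
  have Qnn: "Q * \<nu> * \<nu> \<le> 8^6 * (A^2 * B) * E * (1 + E + G) * \<sigma> ^ (2 * J) / l"
  proof -
    have "Q * \<nu> * \<nu> = 8192 * (\<alpha> * \<nu>) * (\<alpha> + (G + 3 * B * E))" using nu0 by (simp add: Q_def)
    also have "\<dots> \<le> 8192 * (A * E * \<sigma> ^ (2 * J) / l) * (4 * A * B * (1 + E + G))"
    proof (intro mult_mono Gs)
      show "\<alpha> * \<nu> \<le> A * E * \<sigma> ^ (2 * J) / l"
        unfolding anu using A E0 l0 sg iJ
        by (intro divide_right_mono mult_left_mono power_increasing) (auto simp: c_def)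
    qed (use A B E0 G0 al0 l0 sg nu0 in auto)
    also have "\<dots> = 32768 * ((A^2 * B) * E * (1 + E + G) * \<sigma> ^ (2 * J) / l)" by (simp add: power2_eq_square)
    also have "\<dots> \<le> 8^6 * ((A^2 * B) * E * (1 + E + G) * \<sigma> ^ (2 * J) / l)"
      using A B E0 G0 l0 sg by (intro mult_right_mono) auto
    finally show ?thesis by simp
  qed
  have Q1: "Q \<le> Q * \<nu>" using Q0 nu1 mult_left_mono[of 1 \<nu> Q] by simp
  have Bw: "B + 8^6 * (A^2 * B) \<le> ?B"
  proof -
    have "B + 8^6 * (A^2 * B) \<le> 8^7 * (A^2 * B)" using AB A B by simp
    also have "\<dots> \<le> 8 ^ (2 * n + 10) * (A^2 * B)" using A B by (intro mult_right_mono power_increasing) auto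
    finally show ?thesis by (simp add: mult.assoc)
  qed
  have BwE: "B * E * (1 + E + G) + 8^6 * (A^2 * B) * E * (1 + E + G) \<le> ?B * E * (1 + E + G)"
    using mult_right_mono[OF Bw, of "E * (1 + E + G)"] E0 G0 by (simp add: algebra_simps)
  have BwE2: "B * E * (1 + E + G) * \<sigma> ^ (2 * J) / l + 8^6 * (A^2 * B) * E * (1 + E + G) * \<sigma> ^ (2 * J) / l
      \<le> ?B * E * (1 + E + G) * \<sigma> ^ (2 * J) / l"
    using mult_right_mono[OF BwE, of "\<sigma> ^ (2 * J) / l"] l0 sg by (simp add: algebra_simps add_divide_distrib)
  have WW': "bd {} 2 0 0 (W' j) \<and> (\<forall>x\<in>X. \<bar>W' j x\<bar> \<le> ?B * E * (1 + E + G) \<and>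
        (\<forall>i. \<bar>pd i (W' j) x\<bar> \<le> ?B * E * (1 + E + G)) \<and>
        (\<forall>i i'. \<bar>pd i' (pd i (W' j)) x\<bar> \<le> ?B * E * (1 + E + G) * \<sigma> ^ (2 * J) / l))" for j
  proof -
    have p1: "pd i (W' j) = (\<lambda>x. pd i (W j) x + pd i (cw am \<nu> d ?u j) x)" for i
      unfolding W'_def by (rule ext) (rule pd_add[OF Wd(1) cwd(1)])
    have p2: "pd i' (pd i (W' j)) = (\<lambda>x. pd i' (pd i (W j)) x + pd i' (pd i (cw am \<nu> d ?u j)) x)" for i i'
      unfolding p1 by (rule ext) (rule pd_add[OF Wd(2) cwd(2)])
    have s: "bd {} 2 0 0 (W' j)"
      unfolding W'_def using bd_add[OF W(1) bd_smooth[OF cwb]] by simp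
    have cw2: "bd X (Suc (Suc 0)) Q \<nu> (cw am \<nu> d ?u j)" using cwb by (simp add: numeral_2_eq_2)
    have b0: "\<bar>cw am \<nu> d ?u j x\<bar> \<le> Q" "\<bar>pd i (cw am \<nu> d ?u j) x\<bar> \<le> Q * \<nu>" "\<bar>pd i' (pd i (cw am \<nu> d ?u j)) x\<bar> \<le> Q * \<nu> * \<nu>"
      if "x \<in> X" for x i i'
      using bd_bound[OF cw2 that] bd_bound[OF bd_pd[OF cw2] that] bd_bound[OF bd_pd[OF bd_pd[OF cw2]] that] by auto
    have "\<bar>W' j x\<bar> \<le> ?B * E * (1 + E + G)" if "x \<in> X" for x
      unfolding W'_def using W(2)[OF that, of j] b0(1)[OF that] Q1 Qnu BwE by linarith
    moreover have "\<bar>pd i (W' j) x\<bar> \<le> ?B * E * (1 + E + G)" if "x \<in> X" for x i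
      unfolding p1 using W(3)[OF that, of i j] b0(2)[OF that, of i] Qnu BwE by linarith
    moreover have "\<bar>pd i' (pd i (W' j)) x\<bar> \<le> ?B * E * (1 + E + G) * \<sigma> ^ (2 * J) / l" if "x \<in> X" for x i i'
      unfolding p2 using W(4)[OF that, of i' i j] b0(3)[OF that, of i' i] Qnn BwE2 by linarith
    ultimately show ?thesis using s by blast
  qed
  show "VW n ?B (Suc i) V' W'"
    unfolding vw_bounds_def using VV' WW' unfolding \<nu>_def by blast
qed

lemma bd_linear: "bd {} n 0 0 (\<lambda>x. c * x $ j)"
proof (cases n)
  case 0
  then show ?thesis by (auto intro!: continuous_intros)
next
  case (Suc m)
  have d: "(\<lambda>x::real^2. c * x $ j) differentiable (at x)" for x
    by (intro differentiable_mult differentiable_nth differentiable_const)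
  have "pd i (\<lambda>x. c * x $ j) = (\<lambda>x. if i = j then c else 0)" for i
    by (rule ext) (simp add: pd_cmult pd_nth)
  moreover have "bd {} m 0 0 (\<lambda>x. a)" for a
    by (rule bd_smooth[OF bd_const[of a "\<bar>a\<bar>" 0]]) auto
  ultimately show ?thesis using d Suc by simp
qed

section \<open>Iterating pairs of corrugations\<close>

text \<open>The invariant: \<open>F\<close> is the strain that remains to be produced, so on
  \<open>X\<close> the current strain plus \<open>F\<close> equals the initial strain plus
  \<open>F0\<close>. The bounds and the support of \<open>F\<close> refer to the plane because the
  next potential is nonlocal.\<close>

definition stage where
  "stage F0 n B s V W F \<longleftrightarrow> VW n B (2 * s) V W \<and>
     (\<forall>i j. bd UNIV n (B * (E / \<sigma> ^ s)^2) (fr (2 * s)) (F i j)) \<and> (\<forall>i j. F i j = F j i) \<and>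
     (\<forall>i j x. R \<le> norm x \<longrightarrow> F i j x = 0) \<and>
     (\<forall>x\<in>X. \<forall>i j. vk k v0 w0 i j x + F0 i j x
        = vk k (\<lambda>a x. v0 a x + V a x) (\<lambda>j x. w0 j x + W j x) i j x + F i j x)"

text \<open>The summand \<open>(i - 1) div 2\<close> of the exponent rises by one exactly when
  \<open>i\<close> passes from an even to an odd number; at the start the exponent rises from 0 to
  2. The gap \<sigma> separates the amplitudes of a round from its first corrugation.\<close>

lemma fr_step: "fr (2 * s) * \<sigma> \<le> fr (Suc (2 * s))"
proof -
  have "Suc (fexp k (2 * s)) \<le> fexp k (Suc (2 * s))"
  proof (cases s)
    case 0
    then show ?thesis by (simp add: fexp_def)
  next
    case (Suc t)
    have "(2 * s - 1) div k \<le> (2 * s) div k" by (intro div_le_mono) simp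
    then show ?thesis using Suc by (simp add: fexp_def)
  qed
  then have "\<sigma> ^ Suc (fexp k (2 * s)) \<le> \<sigma> ^ fexp k (Suc (2 * s))" using sg by (rule power_increasing)
  then show ?thesis using l0 by (simp add: freq_def divide_right_mono mult.commute)
qed

text \<open>Both amplitudes are computed from \<open>F\<close> before the first corrugation, so both
  keep the low frequency \<open>fr (2 * s)\<close>; the errors of the two corrugations are left to
  the next round. Of the \<open>n + 3\<close> orders the potential takes one and \<open>cerr\<close>
  takes two.\<close>

lemma pair_step:
  assumes st: "stage F0 (n + 3) B s V W F" and n: "1 \<le> n" and nN: "n \<le> N" and ZB: "Z \<le> B"
    and L1: "1 \<le> L" and L: "12 * (log 2 (fr (2 * s)) + 2) + 4 * R + 4 \<le> L"
    and J: "(2 * s + 1) div k + 1 \<le> J"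
    and C1: "1 \<le> C1" "\<And>h \<mu>. 0 \<le> \<mu> \<Longrightarrow> bd UNIV (n + 2) (1/2) \<mu> h \<Longrightarrow> bd UNIV (n + 2) C1 \<mu> (\<lambda>x. (1 + h x) powr (1/2))"
  shows "\<exists>V' W' F'. stage F0 n (2 ^ (n + 1) * 8 ^ (4 * n + 20) * 6 ^ 4 * C1 ^ 4 * 9 * (1 + R) * (L * B) ^ 6) (Suc s) V' W' F'"
proof -
  define \<mu> where "\<mu> = fr (2 * s)"
  define K where "K = B * (E / \<sigma> ^ s)^2"
  \<comment> \<open>The corrected diagonal entry \<open>F d d - pd d (\<Psi> d)\<close> is at most K
    + 2LK, hence at most 3LK. Twice this bound, added to the diagonal, keeps the quotient by
    \<open>c\<close> within 1/2 of 1.\<close>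
  define c where "c = 6 * L * K"
  define A where "A = 6 * C1 * L * B"
  have B: "1 \<le> B" using ZB Z1 by simp
  have sp: "0 < \<sigma> ^ m" "1 \<le> \<sigma> ^ m" for m using sg by auto
  have mu1: "1 \<le> \<mu>" unfolding \<mu>_def by (rule fr_ge1)
  have Es: "0 < E / \<sigma> ^ s" using E0 sp by simp
  have K0: "0 < K" unfolding K_def using B Es by (intro mult_pos_pos zero_less_power) auto
  have LK: "K \<le> L * K" using mult_right_mono[OF L1, of K] K0 by simp
  have c0: "0 < c" unfolding c_def using K0 L1 by simp
  have LB: "1 \<le> L * B" using mult_mono[OF L1 B] L1 by simp
  have A1: "1 \<le> A"
  proof -
    have "1 * 1 \<le> (6 * C1) * (L * B)" using C1(1) LB by (intro mult_mono) auto
    then show ?thesis by (simp add: A_def mult.assoc)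
  qed
  from st have VW0: "VW (n + 3) B (2 * s) V W"
    and F: "\<And>i j. bd UNIV (n + 3) K \<mu> (F i j)" "\<And>i j. F i j = F j i" "\<And>i j x. R \<le> norm x \<Longrightarrow> F i j x = 0"
      "\<And>x i j. x \<in> X \<Longrightarrow> vk k v0 w0 i j x + F0 i j x
        = vk k (\<lambda>a x. v0 a x + V a x) (\<lambda>j x. w0 j x + W j x) i j x + F i j x"
    unfolding stage_def K_def \<mu>_def by blast+
  have f: "bd UNIV (Suc (n + 2)) (2 * K) \<mu> (\<lambda>x. 2 * F 1 2 x)"
    using bd_cmult[OF F(1)[of 1 2], of 2] by (simp add: eval_nat_numeral)
  define L0 where "L0 = 12 * (log 2 \<mu> + 2) + 4 * R + 4"
  have L0: "L0 \<le> L" using L by (simp add: L0_def \<mu>_def)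
  have f0: "R \<le> norm x \<Longrightarrow> 2 * F 1 2 x = 0" for x using F(3) by simp
  have K2: "0 \<le> 2 * K" using K0 by simp
  obtain \<Psi> :: "2 \<Rightarrow> real^2 \<Rightarrow> real" where P: "\<And>j. bd {} (Suc (n + 2)) 0 0 (\<Psi> j)"
    "\<And>j x. \<bar>\<Psi> j x\<bar> \<le> L0 * (2 * K)" "\<And>i j. bd UNIV (n + 2) (L0 * (2 * K)) \<mu> (pd i (\<Psi> j))"
    "\<And>x. norm x \<le> R \<Longrightarrow> pd 1 (\<Psi> 2) x + pd 2 (\<Psi> 1) x = 2 * F 1 2 x"
    using off_diagonal_potential[OF f mu1 K2 R0 f0, folded L0_def] by blast
  have L0K: "L0 * (2 * K) \<le> 2 * L * K" using L0 K0 by simp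
  have Pb: "\<bar>\<Psi> j x\<bar> \<le> 2 * L * K" for j x using P(2)[of j x] L0K by linarith
  have Pd: "bd UNIV (n + 2) (2 * L * K) \<mu> (pd i (\<Psi> j))" for i j
    by (rule bd_mono[OF P(3)]) (use L0K mu1 K0 L1 in auto)
  define h where "h d = (\<lambda>x. (1 / c) * (F d d x - pd d (\<Psi> d) x))" for d
  have h: "bd UNIV (n + 2) (1/2) \<mu> (h d)" for d
  proof -
    have "bd UNIV (n + 2) (\<bar>1/c\<bar> * (K + 2 * L * K)) \<mu> (h d)"
      unfolding h_def by (intro bd_cmult bd_minus Pd bd_le[OF F(1)]) simp
    then show ?thesis
    proof (rule bd_mono)
      have "K + 2 * L * K \<le> c / 2" using LK unfolding c_def by linarith
      then have "(1/c) * (K + 2 * L * K) \<le> (1/c) * (c / 2)" using c0 by (intro mult_left_mono) auto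
      then show "\<bar>1/c\<bar> * (K + 2 * L * K) \<le> 1/2" using c0 by simp
    qed (use mu1 in auto)
  qed
  \<comment> \<open>The root is written as a real power so that \<open>bd_powr_1_plus\<close> bounds
    its derivatives.\<close>
  define am where "am d = (\<lambda>x. sqrt c * (1 + h d x) powr (1/2))" for d
  have amsq: "(am d x)^2 = c + F d d x - pd d (\<Psi> d) x" for d x
  proof -
    have "0 \<le> 1 + h d x" using bd_bound[OF h, of x d] by (simp add: abs_le_iff)
    then have "(am d x)^2 = c * (1 + h d x)"
      using c0 by (simp add: am_def power_mult_distrib powr_half_sqrt)
    also have "\<dots> = c + c * h d x" by (simp add: distrib_left)
    also have "c * h d x = F d d x - pd d (\<Psi> d) x" using c0 by (simp add: h_def)
    finally show ?thesis by simp
  qed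
  have am: "bd UNIV (n + 2) (A * E / \<sigma> ^ s) \<mu> (am d)" for d
  proof -
    have "bd UNIV (n + 2) (\<bar>sqrt c\<bar> * C1) \<mu> (am d)"
      unfolding am_def by (intro bd_cmult C1(2) h) (use mu1 in simp)
    then show ?thesis
    proof (rule bd_mono)
      have y: "1 \<le> 6 * (L * B)" using LB by simp
      have "sqrt c = sqrt (6 * (L * B)) * (E / \<sigma> ^ s)"
      proof -
        have "c = (6 * (L * B)) * (E / \<sigma> ^ s)^2" by (simp add: c_def K_def)
        then show ?thesis using Es by (simp only: real_sqrt_mult real_sqrt_abs abs_of_pos)
      qed
      moreover have "sqrt (6 * (L * B)) \<le> 6 * (L * B)"
      proof -
        have "sqrt z \<le> z" if "1 \<le> z" for z :: real
          using that self_le_power[OF that, of 2] by (intro real_le_lsqrt) auto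
        then show ?thesis using y by blast
      qed
      ultimately have "sqrt c \<le> 6 * (L * B) * (E / \<sigma> ^ s)"
        using mult_right_mono[of "sqrt (6 * (L * B))" "6 * (L * B)" "E / \<sigma> ^ s"] Es by simp
      then have "sqrt c * C1 \<le> 6 * (L * B) * (E / \<sigma> ^ s) * C1" using C1(1) by (intro mult_right_mono) auto
      then show "\<bar>sqrt c\<bar> * C1 \<le> A * E / \<sigma> ^ s" using c0 by (simp add: A_def mult_ac)
      show "0 \<le> A * E / \<sigma> ^ s" using A1 E0 sg by simp
    qed (use mu1 in auto)
  qed
  \<comment> \<open>The symmetric gradient of \<open>\<Psi>\<close> carries the off-diagonal entry,
    and the linear part subtracts \<open>c\<close> times the identity. The squares of the amplitudes
    will restore the latter and supply the corrected diagonal.\<close>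
  define W1 where "W1 j = (\<lambda>x. W j x + (\<Psi> j x - c * x $ j))" for j
  define B1 where "B1 = 9 * (1 + R) * L * B"
  have W: "\<And>j. bd {} 2 0 0 (W j)" "\<And>j x. x \<in> X \<Longrightarrow> \<bar>W j x\<bar> \<le> B * E * (1 + E + G)"
    "\<And>j i x. x \<in> X \<Longrightarrow> \<bar>pd i (W j) x\<bar> \<le> B * E * (1 + E + G)"
    "\<And>j i i' x. x \<in> X \<Longrightarrow> \<bar>pd i' (pd i (W j)) x\<bar> \<le> B * E * (1 + E + G) * \<sigma> ^ (2 * J) / l"
    using VW0 unfolding vw_bounds_def by blast+
  have Wd: "W j differentiable (at x)" "pd i (W j) differentiable (at x)" for i j x
    using W(1) by (auto simp: numeral_2_eq_2)
  have P3: "bd {} (Suc (Suc (Suc n))) 0 0 (\<Psi> j)" for j using P(1) by simp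
  have Psd: "\<Psi> j differentiable (at x)" "pd i (\<Psi> j) differentiable (at x)" for i j x
    using P3[of j] by auto
  have xd: "(\<lambda>x::real^2. c * x $ j) differentiable (at x)" for j x
    by (intro differentiable_mult differentiable_nth differentiable_const)
  have px: "pd i (\<lambda>x. c * x $ j) = (\<lambda>x. if i = j then c else 0)" for i j
    by (rule ext) (simp add: pd_cmult pd_nth)
  have pW1: "pd i (W1 j) = (\<lambda>x. pd i (W j) x + (pd i (\<Psi> j) x - (if i = j then c else 0)))" for i j
    unfolding W1_def
    by (rule ext) (simp add: pd_add[OF Wd(1) differentiable_diff[OF Psd(1) xd]] pd_diff[OF Psd(1) xd] px)
  have ppW1: "pd i' (pd i (W1 j)) = (\<lambda>x. pd i' (pd i (W j)) x + pd i' (pd i (\<Psi> j)) x)" for i' i j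
    unfolding pW1
    by (rule ext) (simp add: pd_add[OF Wd(2) differentiable_diff[OF Psd(2) differentiable_const]] pd_diff[OF Psd(2) differentiable_const])
  have KE: "K \<le> B * E * E"
  proof -
    have "(E / \<sigma> ^ s)^2 \<le> E^2" using E0 sp divide_left_mono[of 1 "\<sigma>^s" E]
      by (intro power_mono[OF _ less_imp_le[OF Es]]) auto
    then have "B * (E / \<sigma> ^ s)^2 \<le> B * E^2" using B by (intro mult_left_mono) auto
    then show ?thesis by (simp add: K_def power2_eq_square)
  qed
  have EY: "E * E \<le> E * (1 + E + G)" using E0 G0 by (intro mult_left_mono) auto
  have KY: "K \<le> B * E * (1 + E + G)"
    using KE mult_left_mono[OF EY, of B] B by (simp only: mult.assoc) linarith
  have KmuY: "K * \<mu> \<le> B * E * (1 + E + G) * \<sigma> ^ (2 * J) / l"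
  proof -
    \<comment> \<open>The frequency may exceed the budget \<sigma>^(2J)/l by a factor \<sigma>^(2s),
      which is what \<open>K\<close> has already lost in size.\<close>
    have "fexp k (2 * s) \<le> 2 * J + 2 * s"
    proof (cases "s = 0")
      case False
      have "(2 * s - 1) div k \<le> (2 * s + 1) div k" by (intro div_le_mono) simp
      then show ?thesis using J False unfolding fexp_def by auto
    qed (simp add: fexp_def)
    then have "\<sigma> ^ fexp k (2 * s) \<le> \<sigma> ^ (2 * J + 2 * s)" using sg by (intro power_increasing)
    then have m: "\<sigma> ^ fexp k (2 * s) \<le> \<sigma> ^ (2 * J) * (\<sigma> ^ s)^2" by (simp add: power_add power_mult mult.commute[of 2] power_even_eq)
    have "K * \<mu> = (B * E * E / l) * (\<sigma> ^ fexp k (2 * s) / (\<sigma> ^ s)^2)"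
      by (simp add: K_def \<mu>_def freq_def power2_eq_square mult_ac)
    also have "\<dots> \<le> (B * E * E / l) * \<sigma> ^ (2 * J)"
      using m sp(1)[of s] B E0 l0 by (intro mult_left_mono) (auto simp: divide_le_eq)
    also have "\<dots> = B * (E * E) * (\<sigma> ^ (2 * J) / l)" by simp
    also have "\<dots> \<le> B * (E * (1 + E + G)) * (\<sigma> ^ (2 * J) / l)"
      using B l0 sg by (intro mult_right_mono mult_left_mono[OF EY]) auto
    finally show ?thesis by (simp add: mult.assoc)
  qed
  define Y where "Y = B * E * (1 + E + G)"
  have Y0: "0 \<le> Y" using B E0 G0 by (simp add: Y_def)
  have LY: "Y \<le> L * Y" "0 \<le> R * (L * Y)" using mult_right_mono[OF L1 Y0] L1 Y0 R0 by auto
  have B1Y: "B1 * E * (1 + E + G) = 9 * (1 + R) * (L * Y)" by (simp add: B1_def Y_def)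
  have LKY: "L * K \<le> L * Y" using KY L1 by (simp add: Y_def)
  have VW1: "VW (n + 3) B1 (2 * s) V W1"
  proof -
    have "B \<le> B1"
    proof -
      have "1 * B \<le> (9 * (1 + R) * L) * B"
        using B L1 R0 mult_mono[of 1 "9 * (1 + R)" 1 L] by (intro mult_right_mono) auto
      then show ?thesis by (simp add: B1_def)
    qed
    then have V: "VW (n + 3) B1 (2 * s) V W" using VW_mono[OF VW0] B by simp
    have a1: "bd {} 2 0 0 (W1 j)" for j
    proof -
      have "bd {} 2 (0 + (0 + 0)) 0 (\<lambda>x. W j x + (\<Psi> j x - c * x $ j))"
        by (intro bd_add W bd_minus bd_linear bd_le[OF P(1)]) simp
      then show ?thesis by (simp only: W1_def add_0)
    qed
    have a2: "\<bar>W1 j x\<bar> \<le> B1 * E * (1 + E + G)" if "x \<in> X" for x j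
    proof -
      have "\<bar>x $ j\<bar> \<le> R" using component_le_norm_cart[of x j] XR[OF that] by linarith
      then have "\<bar>c * x $ j\<bar> \<le> c * R" using c0 by (simp add: abs_mult)
      then have "\<bar>W1 j x\<bar> \<le> Y + 2 * (L * K) + 6 * (L * K) * R"
        unfolding W1_def using W(2)[OF that, of j] Pb[of j x] by (simp add: Y_def c_def)
      also have "\<dots> \<le> L * Y + 2 * (L * Y) + 6 * (L * Y) * R"
        using LY(1) LKY mult_right_mono[OF LKY R0] by (simp only: mult.assoc)
      also have "\<dots> \<le> 9 * (1 + R) * (L * Y)" using LY Y0 L1 by (simp add: algebra_simps)
      finally show ?thesis unfolding B1Y .
    qed
    have a3: "\<bar>pd i (W1 j) x\<bar> \<le> B1 * E * (1 + E + G)" if "x \<in> X" for x i j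
    proof -
      have "\<bar>pd i (\<Psi> j) x\<bar> \<le> 2 * L * K" using bd_bound[OF Pd, of x] by simp
      then have "\<bar>pd i (W1 j) x\<bar> \<le> Y + 2 * (L * K) + 6 * (L * K)"
      proof -
        have "\<bar>pd i (W j) x\<bar> \<le> Y" using W(3)[OF that, of i j] by (simp add: Y_def)
        moreover have "\<bar>if i = j then c else 0\<bar> \<le> 6 * (L * K)" using c0 by (simp add: c_def)
        ultimately show ?thesis unfolding pW1 using \<open>\<bar>pd i (\<Psi> j) x\<bar> \<le> 2 * L * K\<close> by linarith
      qed
      also have "\<dots> \<le> 9 * (1 + R) * (L * Y)" using LY LKY by (simp add: algebra_simps)
      finally show ?thesis unfolding B1Y .
    qed
    have a4: "\<bar>pd i' (pd i (W1 j)) x\<bar> \<le> B1 * E * (1 + E + G) * \<sigma> ^ (2 * J) / l" if "x \<in> X" for x i i' j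
    proof -
      have Pd': "bd UNIV (Suc (Suc n)) (2 * L * K) \<mu> (pd i (\<Psi> j))" using Pd by simp
      have "\<bar>pd i' (pd i (\<Psi> j)) x\<bar> \<le> 2 * L * (K * \<mu>)" using bd_bound[OF bd_pd[OF Pd'], of x i'] by simp
      also have "\<dots> \<le> 2 * L * (Y * \<sigma> ^ (2 * J) / l)" using KmuY L1 by (intro mult_left_mono) (auto simp: Y_def)
      finally have "\<bar>pd i' (pd i (W1 j)) x\<bar> \<le> Y * \<sigma> ^ (2 * J) / l + 2 * L * (Y * \<sigma> ^ (2 * J) / l)"
        unfolding ppW1 using W(4)[OF that, of i' i j] by (simp add: Y_def)
      also have "\<dots> = (Y + 2 * (L * Y)) * (\<sigma> ^ (2 * J) / l)" by (simp add: algebra_simps add_divide_distrib)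
      also have "\<dots> \<le> (9 * (1 + R) * (L * Y)) * (\<sigma> ^ (2 * J) / l)"
      proof (rule mult_right_mono)
        have "9 * (1 + R) * (L * Y) = 9 * (L * Y) + 9 * (R * (L * Y))" by (simp add: algebra_simps)
        then show "Y + 2 * (L * Y) \<le> 9 * (1 + R) * (L * Y)" using LY Y0 by linarith
      qed (use l0 sg in auto)
      finally show ?thesis using B1Y by simp
    qed
    show ?thesis
      unfolding vw_bounds_def
      by (intro conjI ballI conjunct1[OF V[unfolded vw_bounds_def]] allI a1 a2 a3 a4)
  qed
  have B1: "Z \<le> B1" "1 \<le> B1"
  proof -
    have "1 * B \<le> (9 * (1 + R) * L) * B"
      using B L1 R0 mult_mono[of 1 "9 * (1 + R)" 1 L] by (intro mult_right_mono) auto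
    then have "B \<le> B1" by (simp add: B1_def)
    then show "Z \<le> B1" "1 \<le> B1" using ZB B by auto
  qed
  have mustep: "\<mu> * \<sigma> \<le> fr (Suc (2 * s))" "\<mu> * \<sigma> \<le> fr (Suc (2 * s + 1))"
    unfolding \<mu>_def using fr_step[of s] fr_mono[of "Suc (2 * s)" "Suc (2 * s + 1)"] by auto
  have Ja: "2 * s div k + 1 \<le> J"
    using J div_le_mono[of "2 * s" "2 * s + 1" k] by linarith
  have am0: "bd UNIV (n + 2) (A * E / \<sigma> ^ (2 * s div 2)) \<mu> (am 1)" using am by simp
  have am1: "bd UNIV (n + 2) (A * E / \<sigma> ^ ((2 * s + 1) div 2)) \<mu> (am 2)" using am by simp
  have mu0: "0 < \<mu>" using mu1 by simp
  define b where "b = 2 * s mod k"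
  define V2 where "V2 = V(b := (\<lambda>x. V b x + cp (am 1) (fr (Suc (2 * s))) 1 x))"
  define W2 where "W2 = (\<lambda>j x. W1 j x + cw (am 1) (fr (Suc (2 * s))) 1 (\<lambda>x. v0 b x + V b x) j x)"
  define B2 where "B2 = 8 ^ (2 * n + 10) * A^2 * B1"
  have VW1n: "VW n B1 (2 * s) V W1" using VW_mono[OF VW1, of n B1] B1 by simp
  note c1 = corr_step[OF VW1n n nN B1(1) A1 am0 mu0 mustep(1) Ja, where d = 1, folded b_def, folded V2_def W2_def B2_def]
  have A2: "1 \<le> A^2" using A1 by simp
  have B2: "B1 \<le> B2"
  proof -
    have "1 * 1 \<le> 8 ^ (2 * n + 10) * A^2" by (intro mult_mono A2) auto
    then show ?thesis using B1 mult_right_mono[of 1 "8 ^ (2 * n + 10) * A^2" B1] by (simp add: B2_def)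
  qed
  have ZB2: "Z \<le> B2" using B2 B1 by simp
  define b' where "b' = (2 * s + 1) mod k"
  define V3 where "V3 = V2(b' := (\<lambda>x. V2 b' x + cp (am 2) (fr (Suc (2 * s + 1))) 2 x))"
  define W3 where "W3 = (\<lambda>j x. W2 j x + cw (am 2) (fr (Suc (2 * s + 1))) 2 (\<lambda>x. v0 b' x + V2 b' x) j x)"
  define B3 where "B3 = 8 ^ (2 * n + 10) * A^2 * B2"
  have VW2: "VW n B2 (2 * s + 1) V2 W2" using c1(1) by simp
  note c2 = corr_step[OF VW2 n nN ZB2 A1 am1 mu0 mustep(2) J, where d = 2, folded b'_def, folded V3_def W3_def B3_def]
  have B3: "B2 \<le> B3"
  proof -
    have "1 * 1 \<le> 8 ^ (2 * n + 10) * A^2" by (intro mult_mono A2) auto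
    then show ?thesis using B1 B2 mult_right_mono[of 1 "8 ^ (2 * n + 10) * A^2" B2] by (simp add: B3_def)
  qed
  define e1 where "e1 = cerr (\<lambda>j j' x. H0 b j j' x + pd j (pd j' (V b)) x) (am 1) (fr (Suc (2 * s))) 1"
  define e2 where "e2 = cerr (\<lambda>j j' x. H0 b' j j' x + pd j (pd j' (V2 b')) x) (am 2) (fr (Suc (2 * s + 1))) 2"
  \<comment> \<open>The sign is negative because an error already produced has to be taken away
    again. The cutoff, equal to 1 on \<open>X\<close>, restores compact support.\<close>
  define F' where "F' i j = (\<lambda>x. - (ch x * (e1 i j x + e2 i j x)))" for i j
  \<comment> \<open>Two corrugations contribute the fourth power of \<open>A\<close>, hence of
    \<open>L * B\<close>; the potential contributes one more \<open>L * B\<close> and the cutoff one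
    \<open>B\<close>. A last factor \<open>L\<close> rounds this up to the sixth power of
    \<open>L * B\<close>.\<close>
  define B4 where "B4 = 2 ^ (n + 1) * 8 ^ (4 * n + 20) * 6 ^ 4 * C1 ^ 4 * 9 * (1 + R) * (L * B) ^ 6"
  have ssn: "Suc (2 * s + 1) = 2 * Suc s" by simp
  have fr0: "0 \<le> fr i" for i using fr_ge1[of i] by simp
  have B4e: "B4 = L * (2 ^ (n + 1) * B * B3)"
  proof -
    have A4: "A^2 * A^2 = 6 ^ 4 * C1 ^ 4 * (L * B) ^ 4"
      by (simp add: A_def power2_eq_square power4_eq_xxxx)
    have e8: "(8::real) ^ (2 * n + 10) * 8 ^ (2 * n + 10) = 8 ^ (4 * n + 20)" by (simp flip: power_add)
    have e6: "(L * B) ^ 6 = (L * B) ^ 4 * ((L * B) * (L * B))" by (simp add: eval_nat_numeral)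
    have "L * (2 ^ (n + 1) * B * B3) = 2 ^ (n + 1) * (8 ^ (2 * n + 10) * 8 ^ (2 * n + 10)) * (A^2 * A^2) * 9 * (1 + R) * ((L * B) * (L * B))"
      unfolding B3_def B2_def B1_def by (simp only: mult_ac)
    then show ?thesis unfolding A4 e8 B4_def e6 by (simp only: mult_ac)
  qed
  have nB: "1 \<le> 2 ^ (n + 1) * B"
  proof -
    have "1 * 1 \<le> 2 ^ (n + 1) * B" by (rule mult_mono[OF one_le_power B]) auto
    then show ?thesis by simp
  qed
  have B3p: "0 \<le> B3" using B1 B2 B3 by simp
  have B4': "2 ^ (n + 1) * B * B3 \<le> B4"
    unfolding B4e using mult_right_mono[OF L1, of "2 ^ (n + 1) * B * B3"] B B3p by simp
  have B34: "B3 \<le> B4"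
    using mult_right_mono[OF nB B3p] B4' by simp
  have Eq0: "0 \<le> (E / \<sigma> ^ Suc s)^2" by simp
  have F'b: "bd UNIV n (B4 * (E / \<sigma> ^ Suc s)^2) (fr (2 * Suc s)) (F' i j)" for i j
  proof -
    have b1: "bd UNIV n (B3 * (E / \<sigma> ^ Suc s)^2) (fr (2 * Suc s)) (e1 i j)"
      unfolding e1_def
      by (rule bd_mono[OF c1(2)]) (use B3 B2 B1 fr0 fr_mono[of "Suc (2 * s)" "2 * Suc s"] Eq0 in \<open>auto intro!: mult_right_mono\<close>)
    have b2: "bd UNIV n (B3 * (E / \<sigma> ^ Suc s)^2) (fr (2 * Suc s)) (e2 i j)"
      using c2(2) unfolding e2_def ssn by simp
    have b3: "bd UNIV n B (fr (2 * Suc s)) ch"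
      by (rule bd_mono[OF bd_le[OF chi_bd nN]]) (use ZB B l0 fr_ge in auto)
    have "bd UNIV n (2 ^ n * B * (B3 * (E / \<sigma> ^ Suc s)^2 + B3 * (E / \<sigma> ^ Suc s)^2)) (fr (2 * Suc s)) (F' i j)"
      unfolding F'_def by (intro bd_uminus bd_mult bd_add b1 b2 b3)
    then show ?thesis
    proof (rule bd_mono)
      have "2 ^ n * B * (B3 * (E / \<sigma> ^ Suc s)^2 + B3 * (E / \<sigma> ^ Suc s)^2) = 2 ^ (n + 1) * B * B3 * (E / \<sigma> ^ Suc s)^2"
        by simp
      also have "\<dots> \<le> B4 * (E / \<sigma> ^ Suc s)^2" by (rule mult_right_mono[OF B4' Eq0])
      finally show "2 ^ n * B * (B3 * (E / \<sigma> ^ Suc s)^2 + B3 * (E / \<sigma> ^ Suc s)^2) \<le> B4 * (E / \<sigma> ^ Suc s)^2" .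
      show "0 \<le> B4 * (E / \<sigma> ^ Suc s)^2" using B34 B3p Eq0 by (intro mult_nonneg_nonneg) auto
    qed (use fr0 in auto)
  qed
  have esym: "cerr H a \<nu> d i j = cerr H a \<nu> d j i" for H a \<nu> d i j
    by (rule ext) (simp add: cerr_def algebra_simps)
  have Fs: "F' i j = F' j i" for i j
    unfolding F'_def e1_def e2_def by (subst (1 2) esym) simp
  have F0': "F' i j x = 0" if "R \<le> norm x" for i j x
    using chi_zero[OF that] by (simp add: F'_def)
  have id: "vk k v0 w0 i j x + F0 i j x
      = vk k (\<lambda>a x. v0 a x + V3 a x) (\<lambda>j x. w0 j x + W3 j x) i j x + F' i j x" if x: "x \<in> X" for i j x
  proof -
    let ?v = "\<lambda>a x. v0 a x + V a x"
    have w0d: "w0 j differentiable (at x)" for j x using w0_smooth by (auto simp: numeral_2_eq_2)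
    have W1d: "W1 j differentiable (at x)" for j x
      unfolding W1_def by (intro differentiable_add differentiable_diff Wd Psd xd)
    have q: "vk k ?v (\<lambda>j x. w0 j x + W1 j x) i j x = vk k ?v (\<lambda>j x. w0 j x + W j x) i j x
        + (pd i (\<Psi> j) x + pd j (\<Psi> i) x) / 2 - (if i = j then c else 0)"
      unfolding vk_def pd_add[OF w0d Wd(1)] pd_add[OF w0d W1d] pW1 by (auto simp: add_divide_distrib)
    have F12: "pd 1 (\<Psi> 2) x + pd 2 (\<Psi> 1) x = 2 * F 1 2 x" by (rule P(4)[OF XR[OF x]])
    \<comment> \<open>The algebraic decomposition of the remaining strain: a symmetric gradient, a
      multiple of the identity and two squares along the axes. It uses that the potential is exact
      on the ball of radius \<open>R\<close>, which contains \<open>X\<close>.\<close>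
    have f: "F i j x = (pd i (\<Psi> j) x + pd j (\<Psi> i) x) / 2 - (if i = j then c else 0)
        + (if i = 1 \<and> j = 1 then (am 1 x)^2 else 0) + (if i = 2 \<and> j = 2 then (am 2 x)^2 else 0)"
      unfolding amsq using F12 F(2)[of 2 1] exhaust_2[of i] exhaust_2[of j] by auto
    have "vk k v0 w0 i j x + F0 i j x = vk k ?v (\<lambda>j x. w0 j x + W1 j x) i j x
       + (if i = 1 \<and> j = 1 then (am 1 x)^2 else 0) + (if i = 2 \<and> j = 2 then (am 2 x)^2 else 0)"
      using F(4)[OF x, of i j] q f by linarith
    moreover have "F' i j x = - (e1 i j x + e2 i j x)" using chi_one[OF x] by (simp add: F'_def)
    ultimately show ?thesis
      using c1(3)[OF x, of i j, folded e1_def] c2(3)[OF x, of i j, folded e2_def]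
      unfolding W3_def W2_def by linarith
  qed
  have VW3: "VW n B4 (2 * Suc s) V3 W3"
    using VW_mono[OF c2(1), of n B4] B34 B3 B2 B1 unfolding ssn by simp
  have "stage F0 n B4 (Suc s) V3 W3 F'"
    unfolding stage_def using VW3 F'b Fs F0' id by blast
  then show ?thesis unfolding B4_def by blast
qed

end

section \<open>Iteration of the rounds and absorption of the logarithms\<close>

lemma (in corrugation_data) stage_0:
  assumes F0: "\<And>i j. bd UNIV n (Z * E^2) (1 / l) (F0 i j)" "\<And>i j. F0 i j = F0 j i"
    "\<And>i j x. R \<le> norm x \<Longrightarrow> F0 i j x = 0"
  shows "stage F0 n Z 0 (\<lambda>a x. 0) (\<lambda>j x. 0) F0"
proof -
  have b: "bd UNIV m K \<mu> (\<lambda>x. 0)" if "0 \<le> K" "0 \<le> \<mu>" for m K \<mu>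
    by (rule bd_const) (use that in auto)
  have ZE: "0 \<le> Z * E * \<sigma> ^ m / l" "0 \<le> Z * E" "0 \<le> Z * E * (1 + E + G)"
    "0 \<le> Z * E * (1 + E + G) * \<sigma> ^ m / l" for m
    using Z1 E0 sg l0 G0 by auto
  have "0 \<le> fr 0" using fr_ge1[of 0] by simp
  then have "VW n Z (2 * 0) (\<lambda>a x. 0) (\<lambda>j x. 0)"
    unfolding vw_bounds_def using ZE b bd_smooth[OF b[of 0 0]] by simp
  then show ?thesis
    unfolding stage_def using F0 by (simp add: freq_def fexp_def)
qed

definition start_defect :: "nat \<Rightarrow> real \<Rightarrow> real \<Rightarrow> real \<Rightarrow> (2 \<Rightarrow> 2 \<Rightarrow> real^2 \<Rightarrow> real) \<Rightarrow> bool" where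
  "start_defect n R K l F0 \<longleftrightarrow> (\<forall>i j. bd UNIV n K (1 / l) (F0 i j)) \<and> (\<forall>i j. F0 i j = F0 j i) \<and>
    (\<forall>i j x. R \<le> norm x \<longrightarrow> F0 i j x = 0)"

text \<open>The order of quantifiers is the point: \<open>C\<close> and \<open>Q\<close> precede the
  data, while the bound \<open>L\<close> for the logarithms comes after them. A constant polynomial
  in \<open>L\<close>, with degree independent of the data, can be absorbed into a small power of
  \<open>lam\<close>. The order \<open>3 * (S - s) + 1\<close> reserves three derivatives for each
  round still to come.\<close>

definition stage_reachable :: "nat \<Rightarrow> real \<Rightarrow> real \<Rightarrow> nat \<Rightarrow> nat \<Rightarrow> nat \<Rightarrow> nat \<Rightarrow> real \<Rightarrow> nat \<Rightarrow> bool" where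
  "stage_reachable k R Z S J N s C Q \<longleftrightarrow> (\<forall>X l \<sigma> E G v0 w0 H0 ch F0 L.
    corrugation_data k X R l \<sigma> E G N Z v0 w0 H0 ch \<longrightarrow> start_defect (3 * S + 1) R (Z * E^2) l F0 \<longrightarrow> 1 \<le> L \<longrightarrow>
    (\<forall>s<S. 12 * (log 2 (freq k l \<sigma> (2 * s)) + 2) + 4 * R + 4 \<le> L) \<longrightarrow>
    Z \<le> C * L ^ Q \<and>
    (\<exists>V W F. corrugation_data.stage k X R l \<sigma> E G J v0 w0 F0 (3 * (S - s) + 1) (C * L ^ Q) s V W F))"

text \<open>A round turns the constant \<open>B\<close> into a multiple of the sixth power of
  \<open>L * B\<close>. The degree in \<open>L\<close> passes from \<open>Q\<close> to
  \<open>6 * (Q + 1)\<close>, which is harmless for a fixed number of rounds. The bound of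
  \<open>Z\<close> is carried along because each round asks that \<open>B\<close> dominate
  \<open>Z\<close>.\<close>

lemma iterate_stages:
  fixes k :: nat and R Z :: real and S J N :: nat
  assumes k: "1 \<le> k" and R: "0 \<le> R" and Z: "1 \<le> Z" and N: "3 * S + 1 \<le> N"
    and J: "\<And>s. s < S \<Longrightarrow> (2 * s + 1) div k + 1 \<le> J"
  shows "s \<le> S \<Longrightarrow> \<exists>C\<ge>1. \<exists>Q. stage_reachable k R Z S J N s C Q"
proof (induction s)
  case 0
  have "stage_reachable k R Z S J N 0 Z 0"
    unfolding stage_reachable_def
  proof (intro allI impI conjI)
    fix X l \<sigma> E G v0 w0 H0 ch F0 L
    assume d: "corrugation_data k X R l \<sigma> E G N Z v0 w0 H0 ch" and F0: "start_defect (3 * S + 1) R (Z * E^2) l F0"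
    interpret corrugation_data k X R l \<sigma> E G J N Z v0 w0 H0 ch by (rule d)
    have "stage F0 (3 * S + 1) Z 0 (\<lambda>a x. 0) (\<lambda>j x. 0) F0"
      by (rule stage_0) (use F0 in \<open>auto simp only: start_defect_def\<close>)
    then show "\<exists>V W F. corrugation_data.stage k X R l \<sigma> E G J v0 w0 F0 (3 * (S - 0) + 1) (Z * L ^ 0) 0 V W F" by auto
  qed simp
  then show ?case using Z by blast
next
  case (Suc s)
  then obtain C Q where C: "1 \<le> C" and st: "stage_reachable k R Z S J N s C Q" by auto
  define n where "n = 3 * (S - Suc s) + 1"
  have n: "3 * (S - s) + 1 = n + 3" "1 \<le> n" "n \<le> N" using Suc.prems N by (auto simp: n_def)
  obtain C1' where C1': "0 \<le> C1'" "\<And>h \<mu>. 0 \<le> \<mu> \<Longrightarrow> bd UNIV (n + 2) (1/2) \<mu> h \<Longrightarrow> bd UNIV (n + 2) C1' \<mu> (\<lambda>x. (1 + h x) powr (1/2))"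
    using bd_powr_1_plus[of "n + 2" "1/2"] by blast
  define C1 where "C1 = C1' + 1"
  have C1: "1 \<le> C1" "bd UNIV (n + 2) C1 \<mu> (\<lambda>x. (1 + h x) powr (1/2))" if "0 \<le> \<mu>" "bd UNIV (n + 2) (1/2) \<mu> h" for h \<mu>
    using C1'(1) bd_mono[OF C1'(2)[OF that], of UNIV C1 \<mu>] that(1) by (auto simp: C1_def)
  have C11: "1 \<le> C1" using C1'(1) by (simp add: C1_def)
  define D where "D = 2 ^ (n + 1) * 8 ^ (4 * n + 20) * 6 ^ 4 * C1 ^ 4 * 9 * (1 + R)"
  have D: "1 \<le> D"
  proof -
    have "1 * 1 * 1 * 1 * 1 * 1 \<le> D"
      unfolding D_def by (intro mult_mono one_le_power) (use R C11 in auto)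
    then show ?thesis by simp
  qed
  have "1 \<le> D * C ^ 6" using mult_mono[OF D one_le_power[OF C, of 6]] D by simp
  moreover have "stage_reachable k R Z S J N (Suc s) (D * C ^ 6) (6 * (Q + 1))"
    unfolding stage_reachable_def
  proof (intro conjI allI impI)
    fix X l \<sigma> E G v0 w0 H0 ch F0 L
    assume d: "corrugation_data k X R l \<sigma> E G N Z v0 w0 H0 ch" and F0: "start_defect (3 * S + 1) R (Z * E^2) l F0"
      and L: "1 \<le> L" "\<forall>s<S. 12 * (log 2 (freq k l \<sigma> (2 * s)) + 2) + 4 * R + 4 \<le> L"
    interpret corrugation_data k X R l \<sigma> E G J N Z v0 w0 H0 ch by (rule d)
    define B where "B = C * L ^ Q"
    obtain V W F where ZB: "Z \<le> B" and s0: "stage F0 (n + 3) B s V W F"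
      using st[unfolded stage_reachable_def, rule_format, OF d F0 L(1)] L(2) unfolding n B_def by blast
    have Ls: "12 * (log 2 (freq k l \<sigma> (2 * s)) + 2) + 4 * R + 4 \<le> L" using L Suc.prems by simp
    have Js: "(2 * s + 1) div k + 1 \<le> J" using J Suc.prems by simp
    have e: "D * (L * B) ^ 6 = D * C ^ 6 * L ^ (6 * (Q + 1))"
      by (simp add: B_def power_mult_distrib power_mult[symmetric] power_add algebra_simps)
    show "\<exists>V W F. corrugation_data.stage k X R l \<sigma> E G J v0 w0 F0 (3 * (S - Suc s) + 1) (D * C ^ 6 * L ^ (6 * (Q + 1))) (Suc s) V W F"
      using pair_step[OF s0 n(2,3) ZB L(1) Ls Js C11 C1(2), folded D_def] unfolding n_def[symmetric] e by blast
    have LB: "1 \<le> L * B" using mult_mono[OF L(1), of 1 B] ZB Z L(1) by simp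
    have "Z \<le> L * B" using mult_mono[OF L(1) ZB] Z L(1) by simp
    also have "\<dots> \<le> (L * B) ^ 6" using LB self_le_power[of "L * B" 6] by simp
    also have "\<dots> \<le> D * (L * B) ^ 6" using D LB mult_right_mono[of 1 D "(L * B) ^ 6"] by simp
    finally show "Z \<le> D * C ^ 6 * L ^ (6 * (Q + 1))" unfolding e .
  qed
  ultimately show ?case by blast
qed

text \<open>Both \<sigma> and 1/l are at most \<open>lam\<close>, so all frequencies up to step
  \<open>I\<close> lie below one fixed power of \<open>lam\<close>. The logarithm of
  \<open>lam\<close> is then traded for lam^\<epsilon>/\<epsilon>.\<close>

lemma log_freq_bound:
  assumes "0 < l" "l \<le> 1" "1 / l < lam" "\<sigma> = sqrt (lam * l)" "i \<le> I" "0 < \<epsilon>"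
  shows "log 2 (freq k l \<sigma> i) \<le> (fexp k I + 1) / (\<epsilon> * ln 2) * lam powr \<epsilon>"
proof -
  have lam: "1 \<le> lam" using assms(1-3) by (smt (verit) le_divide_eq_1_pos)
  have "\<sigma> \<le> sqrt (lam ^ 2)" unfolding assms(4) power2_eq_square
    using assms(1,2) lam by (intro real_sqrt_le_mono mult_left_mono) auto
  then have s: "\<sigma> \<le> lam" using lam by simp
  have "1 < lam * l" using assms(1,3) by (simp add: field_simps)
  then have s1: "1 \<le> \<sigma>" unfolding assms(4) by simp
  have "freq k l \<sigma> i = \<sigma> ^ fexp k i * (1 / l)" by (simp add: freq_def)
  also have "\<dots> \<le> lam ^ fexp k i * lam"
    using s s1 assms(1,3) lam by (intro mult_mono power_mono) auto
  also have "\<dots> = lam ^ (fexp k i + 1)" by simp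
  also have "\<dots> \<le> lam ^ (fexp k I + 1)" using lam fexp_mono[OF assms(5), of k] by (intro power_increasing) auto
  finally have f: "freq k l \<sigma> i \<le> lam ^ (fexp k I + 1)" .
  have f0: "0 < freq k l \<sigma> i" using s1 assms(1) by (simp add: freq_def)
  have "log 2 (freq k l \<sigma> i) \<le> log 2 (lam ^ (fexp k I + 1))"
    using f f0 by (intro log_mono) auto
  also have "\<dots> = (fexp k I + 1) * (ln lam / ln 2)"
    using lam ln_realpow[of lam "fexp k I + 1"] by (simp only: log_def) simp
  also have "\<dots> \<le> (fexp k I + 1) * ((lam powr \<epsilon> / \<epsilon>) / ln 2)"
    using ln_powr_bound[OF lam assms(6)] by (intro mult_left_mono divide_right_mono) auto
  also have "\<dots> = (fexp k I + 1) / (\<epsilon> * ln 2) * lam powr \<epsilon>" by simp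
  finally show ?thesis .
qed

theorem corrugation_stages:
  fixes k :: nat and R Z \<gamma> :: real and S J N :: nat
  assumes k: "1 \<le> k" and R: "0 \<le> R" and Z: "1 \<le> Z" and N: "3 * S + 1 \<le> N"
    and J: "\<And>s. s < S \<Longrightarrow> (2 * s + 1) div k + 1 \<le> J" and g: "0 < \<gamma>"
  shows "\<exists>C\<ge>1. \<forall>X l E G v0 w0 H0 ch F0 lam.
    corrugation_data k X R l (sqrt (lam * l)) E G N Z v0 w0 H0 ch \<longrightarrow> start_defect (3 * S + 1) R (Z * E^2) l F0 \<longrightarrow>
    1 / l < lam \<longrightarrow>
    (\<exists>V W F. corrugation_data.stage k X R l (sqrt (lam * l)) E G J v0 w0 F0 1 (C * lam powr (\<gamma> / 2)) S V W F)"
proof -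
  obtain C Q where C: "1 \<le> C" and st: "stage_reachable k R Z S J N S C Q"
    using iterate_stages[OF k R Z N J, of S] by auto
  \<comment> \<open>With this choice the power Q + 1 of lam^\<epsilon> is lam^(\<gamma>/2). The
    exponent is \<gamma>/2 because the bounds for \<open>v\<close> allow no more.\<close>
  define \<epsilon> where "\<epsilon> = \<gamma> / (2 * (Q + 1))"
  have eps: "0 < \<epsilon>" using g by (simp add: \<epsilon>_def)
  define q where "q = (fexp k (2 * S) + 1) / (\<epsilon> * ln 2)"
  define D where "D = 12 * q + 28 + 4 * R"
  have D: "1 \<le> D" using eps R by (simp add: D_def q_def)
  show ?thesis
  proof (intro exI[of _ "C * D ^ (Q + 1)"] conjI allI impI)
    show "1 \<le> C * D ^ (Q + 1)" using mult_mono[OF C one_le_power[OF D, of "Q + 1"]] C by simp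
    fix X l E G v0 w0 H0 ch F0 lam
    assume d: "corrugation_data k X R l (sqrt (lam * l)) E G N Z v0 w0 H0 ch"
      and F0: "start_defect (3 * S + 1) R (Z * E^2) l F0" and lam: "1 / l < lam"
    interpret corrugation_data k X R l "sqrt (lam * l)" E G J N Z v0 w0 H0 ch by (rule d)
    define L where "L = D * lam powr \<epsilon>"
    have lam1: "1 \<le> lam" using lam l0 l1 by (smt (verit) le_divide_eq_1_pos)
    have lp: "1 \<le> lam powr \<epsilon>" using lam1 eps by (simp add: ge_one_powr_ge_zero)
    have L1: "1 \<le> L" unfolding L_def using mult_mono[OF D lp] D by simp
    have lb: "12 * (log 2 (freq k l (sqrt (lam * l)) (2 * s)) + 2) + 4 * R + 4 \<le> L" if "s < S" for s
    proof -
      have "2 * s \<le> 2 * S" using that by simp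
      have lin: "12 * (x + 2) + 4 * R + 4 \<le> 12 * y + (28 + 4 * R)" if "x \<le> y" for x y :: real
        using that by simp
      have "12 * (log 2 (freq k l (sqrt (lam * l)) (2 * s)) + 2) + 4 * R + 4 \<le> 12 * (q * lam powr \<epsilon>) + (28 + 4 * R)"
        by (rule lin[OF log_freq_bound[OF l0 l1 lam refl \<open>2 * s \<le> 2 * S\<close> eps, of k, folded q_def]])
      also have "28 + 4 * R \<le> (28 + 4 * R) * lam powr \<epsilon>" using lp R mult_left_mono[of 1 "lam powr \<epsilon>" "28 + 4 * R"] by simp
      finally show ?thesis by (simp add: L_def D_def distrib_right mult.assoc)
    qed
    obtain V W F where Z': "Z \<le> C * L ^ Q" and VWF: "stage F0 1 (C * L ^ Q) S V W F"
      using st[unfolded stage_reachable_def, rule_format, OF d F0 L1] lb by auto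
    have B: "C * L ^ Q \<le> C * D ^ (Q + 1) * lam powr (\<gamma> / 2)"
    proof -
      have "L ^ Q \<le> L ^ (Q + 1)" using L1 by (intro power_increasing) auto
      also have "\<dots> = D ^ (Q + 1) * (lam powr \<epsilon>) ^ (Q + 1)" by (simp add: L_def power_mult_distrib)
      also have "(lam powr \<epsilon>) ^ (Q + 1) = lam powr (\<epsilon> * (Q + 1))"
        using lam1 by (simp add: powr_realpow[symmetric] powr_powr algebra_simps powr_add)
      also have "\<epsilon> * (Q + 1) = \<gamma> / 2" by (simp add: \<epsilon>_def field_simps)
      finally show ?thesis using C by (simp add: mult.assoc mult_left_mono)
    qed
    have B0: "0 \<le> C * L ^ Q" using Z' Z by simp
    have "stage F0 1 (C * D ^ (Q + 1) * lam powr (\<gamma> / 2)) S V W F"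
      unfolding stage_def
    proof (intro conjI)
      show "VW 1 (C * D ^ (Q + 1) * lam powr (\<gamma> / 2)) (2 * S) V W"
        using VWF VW_mono B B0 unfolding stage_def by blast
      show "\<forall>i j. bd UNIV 1 (C * D ^ (Q + 1) * lam powr (\<gamma> / 2) * (E / sqrt (lam * l) ^ S)\<^sup>2) (fr (2 * S)) (F i j)"
      proof (intro allI)
        fix i j
        have "bd UNIV 1 (C * L ^ Q * (E / sqrt (lam * l) ^ S)\<^sup>2) (fr (2 * S)) (F i j)" using VWF unfolding stage_def by blast
        then show "bd UNIV 1 (C * D ^ (Q + 1) * lam powr (\<gamma> / 2) * (E / sqrt (lam * l) ^ S)\<^sup>2) (fr (2 * S)) (F i j)"
          by (rule bd_mono) (use mult_right_mono[OF B zero_le_power2] fr_ge1[of "2 * S"] B0 B in \<open>auto intro!: mult_nonneg_nonneg simp del: One_nat_def\<close>)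
      qed
    qed (use VWF in \<open>auto simp: stage_def\<close>)
    then show "\<exists>V W F. corrugation_data.stage k X R l (sqrt (lam * l)) E G J v0 w0 F0 1 (C * D ^ (Q + 1) * lam powr (\<gamma> / 2)) S V W F" by blast
  qed
qed

section \<open>Norms on closed neighbourhoods\<close>

lemma pderivs_UNIV: "pderivs UNIV (i # js) f = pd i (pderivs UNIV js f)"
  by (simp add: pd_def fun_eq_iff)

lemma bd_pderivs: "bd {} m 0 0 f \<Longrightarrow> length js \<le> m \<Longrightarrow> bd {} (m - length js) 0 0 (pderivs UNIV js f)"
proof (induction js)
  case (Cons i js)
  have e: "m - length js = Suc (m - length (i # js))" using Cons.prems(2) by simp
  have "bd {} (m - length js) 0 0 (pderivs UNIV js f)" using Cons by simp
  then have "bd {} (Suc (m - length (i # js))) 0 0 (pderivs UNIV js f)" unfolding e .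
  then show ?case unfolding pderivs_UNIV using bd_pd[of "{}" "m - length (i # js)" 0 0] by simp
qed simp

lemma C_diff_iff_bd: "C_diff m f \<longleftrightarrow> bd {} m 0 0 f"
proof
  assume C: "C_diff m f"
  have "bd {} n 0 0 (pderivs UNIV js f)" if "n + length js = m" for n js
    using that
  proof (induction n arbitrary: js)
    case 0
    then show ?case using C by (simp add: C_diff_def)
  next
    case (Suc n)
    have "bd {} n 0 0 (pd i (pderivs UNIV js f))" for i
      using Suc.IH[of "i # js"] Suc.prems unfolding pderivs_UNIV by simp
    moreover have "pderivs UNIV js f differentiable (at x)" for x
      using C Suc.prems by (auto simp: C_diff_def differentiable_on_def)
    ultimately show ?case by simp
  qed
  from this[of m "[]"] show "bd {} m 0 0 f" by simp
next
  assume f: "bd {} m 0 0 f"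
  show "C_diff m f"
    unfolding C_diff_def
  proof (intro conjI allI impI)
    fix js :: "2 list"
    assume "length js < m"
    then show "pderivs UNIV js f differentiable_on UNIV"
      using bd_diff[OF bd_pderivs[OF f, of js]] by (simp add: differentiable_on_def)
  next
    fix js :: "2 list"
    assume "length js \<le> m"
    then show "continuous_on UNIV (pderivs UNIV js f)"
      using bd_cont[OF bd_pderivs[OF f, of js]] by simp
  qed
qed

lemma in_closed_nbhd: "x \<in> closed_nbhd \<omega> r \<longleftrightarrow> (\<exists>z\<in>closure \<omega>. dist z x \<le> r)"
  unfolding closed_nbhd_def
proof
  assume "\<exists>z\<in>closure \<omega>. dist z x \<le> r"
  then obtain z where "z \<in> closure \<omega>" "dist z x \<le> r" by blast
  then show "x \<in> {x + y | x y. x \<in> closure \<omega> \<and> y \<in> cball 0 r}"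
    by (intro CollectI exI[of _ z] exI[of _ "x - z"]) (auto simp: dist_norm norm_minus_commute)
next
  assume "x \<in> {x + y | x y. x \<in> closure \<omega> \<and> y \<in> cball 0 r}"
  then obtain z y where "x = z + y" "z \<in> closure \<omega>" "norm y \<le> r" by auto
  then show "\<exists>z\<in>closure \<omega>. dist z x \<le> r" by (intro bexI[of _ z]) (auto simp: dist_norm)
qed

text \<open>Every point of the neighbourhood lies in a closed ball contained in it, so the derivatives
  along an open set of directions are determined.\<close>

lemma nbhd_derivative_unique:
  assumes r: "0 < r" and x: "x \<in> closed_nbhd \<omega> r"
    and D: "(g has_derivative D) (at x within closed_nbhd \<omega> r)"
    and D': "(g has_derivative D') (at x within closed_nbhd \<omega> r)"
  shows "D = D'"
proof -
  let ?K = "closed_nbhd \<omega> r"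
  obtain z where z: "z \<in> closure \<omega>" "dist z x \<le> r" using x in_closed_nbhd by blast
  have K: "cball z r \<subseteq> ?K" using z(1) in_closed_nbhd by auto
  interpret D: bounded_linear D by (rule has_derivative_bounded_linear[OF D])
  interpret D': bounded_linear D' by (rule has_derivative_bounded_linear[OF D'])
  have eq: "D (y - x) = D' (y - x)" if y: "y \<in> cball z r" for y
  proof -
    define p where "p = (\<lambda>t::real. x + t *\<^sub>R (y - x))"
    have p: "(p has_derivative (\<lambda>t. t *\<^sub>R (y - x))) (at 0 within {0..1})"
      unfolding p_def by (auto intro!: derivative_eq_intros)
    have im: "p ` {0..1} \<subseteq> ?K"
    proof
      fix q assume "q \<in> p ` {0..1}"
      then obtain t where t: "0 \<le> t" "t \<le> 1" "q = p t" by auto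
      have "(1 - t) *\<^sub>R x + t *\<^sub>R y \<in> cball z r"
        using t y z(2) by (intro convexD[OF convex_cball]) auto
      moreover have "(1 - t) *\<^sub>R x + t *\<^sub>R y = p t" by (simp add: p_def algebra_simps)
      ultimately show "q \<in> ?K" using t(3) K by auto
    qed
    have p0: "p 0 = x" by (simp add: p_def)
    have c: "((g \<circ> p) has_derivative (D \<circ> (\<lambda>t. t *\<^sub>R (y - x)))) (at 0 within {0..1})"
      "((g \<circ> p) has_derivative (D' \<circ> (\<lambda>t. t *\<^sub>R (y - x)))) (at 0 within {0..1})"
      using diff_chain_within[OF p has_derivative_subset[OF D[folded p0] im]]
        diff_chain_within[OF p has_derivative_subset[OF D'[folded p0] im]] by auto
    have "(D \<circ> (\<lambda>t. t *\<^sub>R (y - x))) = (D' \<circ> (\<lambda>t. t *\<^sub>R (y - x)))"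
      by (rule frechet_derivative_unique_within_closed_interval[of 0 1 0 "g \<circ> p"]) (use c in auto)
    from fun_cong[OF this, of 1] show ?thesis by simp
  qed
  show ?thesis
  proof
    fix u :: "real^2"
    obtain t where t: "0 < t" "norm (t *\<^sub>R u) \<le> r"
    proof (cases "u = 0")
      case True
      then show ?thesis using r that[of 1] by simp
    next
      case False
      then show ?thesis using r that[of "r / norm u"] by simp
    qed
    \<comment> \<open>Every direction is a multiple of a difference of two points of the ball. Both
      derivatives agree on the vectors from \<open>x\<close> to these points, so linearity
      finishes.\<close>
    have "D (z + t *\<^sub>R u - x) = D' (z + t *\<^sub>R u - x)" "D (z - x) = D' (z - x)"
      using t r by (auto intro!: eq simp: dist_norm)
    then have "D ((z + t *\<^sub>R u - x) - (z - x)) = D' ((z + t *\<^sub>R u - x) - (z - x))"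
      by (simp only: D.diff D'.diff)
    then have "D (t *\<^sub>R u) = D' (t *\<^sub>R u)" by (simp add: algebra_simps)
    then show "D u = D' u" using t(1) by (simp add: D.scaleR D'.scaleR)
  qed
qed

text \<open>Uniqueness of the relative derivative allows an induction along the list of directions.
  From here on norms on neighbourhoods are computed on extensions, where the calculus of
  \<open>bd\<close> applies.\<close>

lemma pderivs_nbhd:
  assumes r: "0 < r" and f: "bd {} m 0 0 F" "\<And>x. x \<in> closed_nbhd \<omega> r \<Longrightarrow> F x = f x"
  shows "length js \<le> m \<Longrightarrow> x \<in> closed_nbhd \<omega> r \<Longrightarrow> pderivs (closed_nbhd \<omega> r) js f x = pderivs UNIV js F x"
proof (induction js arbitrary: x)
  case Nil
  then show ?case using f(2) by simp
next
  case (Cons i js)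
  let ?K = "closed_nbhd \<omega> r"
  let ?D = "frechet_derivative (pderivs UNIV js F) (at x)"
  have "pderivs UNIV js F differentiable (at x)"
    using bd_diff[OF bd_pderivs[OF f(1), of js]] Cons.prems by simp
  then have "(pderivs UNIV js F has_derivative ?D) (at x within ?K)"
    using frechet_derivative_works has_derivative_at_withinI by blast
  then have D: "(pderivs ?K js f has_derivative ?D) (at x within ?K)"
    by (rule has_derivative_transform[OF Cons.prems(2), rotated]) (use Cons in auto)
  then have "(pderivs ?K js f has_derivative frechet_derivative (pderivs ?K js f) (at x within ?K)) (at x within ?K)"
    using differentiable_def frechet_derivative_works by blast
  from nbhd_derivative_unique[OF r Cons.prems(2) this D] show ?case by simp
qed

lemma compact_nbhd: "bounded \<omega> \<Longrightarrow> compact (closed_nbhd \<omega> r)"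
proof -
  assume "bounded \<omega>"
  then have "compact {x + y | x y. x \<in> closure \<omega> \<and> y \<in> cball 0 r}"
    by (intro compact_sums) auto
  then show ?thesis by (simp add: closed_nbhd_def)
qed

lemma finite_lists_2: "finite {js :: 2 list. length js = j}"
  using finite_lists_length_eq[of "UNIV :: 2 set" j] by simp

lemma card_lists_2: "card {js :: 2 list. length js = j} = 2 ^ j"
  using card_lists_length_eq[of "UNIV :: 2 set" j] by simp

lemma abs_le_L2_set: "finite A \<Longrightarrow> i \<in> A \<Longrightarrow> \<bar>f i\<bar> \<le> L2_set f A"
  using member_le_L2_set[of A i "\<lambda>i. \<bar>f i\<bar>"] by (simp add: L2_set_def)

lemma L2_set_le_card:
  fixes b :: real
  assumes "finite A" "\<And>i. i \<in> A \<Longrightarrow> \<bar>f i\<bar> \<le> b"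
  shows "L2_set f A \<le> card A * b"
  using order_trans[OF L2_set_le_sum_abs sum_bounded_above[of A "\<lambda>i. \<bar>f i\<bar>" b]] assms by simp

text \<open>The factor is the number of entries of the j-th gradient; the Euclidean norm is bounded
  crudely by a sum over entries.\<close>

lemma sup_nabla_le:
  fixes b :: real
  assumes r: "0 < r" and I: "finite I" and ne: "\<omega> \<noteq> {}"
    and F: "\<And>i. i \<in> I \<Longrightarrow> bd {} j 0 0 (F i)" "\<And>i x. i \<in> I \<Longrightarrow> x \<in> closed_nbhd \<omega> r \<Longrightarrow> F i x = f i x"
    and b: "\<And>i js x. i \<in> I \<Longrightarrow> length js = j \<Longrightarrow> x \<in> closed_nbhd \<omega> r \<Longrightarrow> \<bar>pderivs UNIV js (F i) x\<bar> \<le> b"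
  shows "sup_nabla j (closed_nbhd \<omega> r) I f \<le> real (card I) * 2 ^ j * b"
proof -
  obtain z where "z \<in> \<omega>" using ne by blast
  then have "z \<in> closed_nbhd \<omega> r"
    unfolding in_closed_nbhd using r closure_subset by (intro bexI[of _ z]) auto
  moreover have "L2_set (\<lambda>(i, js). pderivs (closed_nbhd \<omega> r) js (f i) x) (I \<times> {js. length js = j}) \<le> card I * 2 ^ j * b"
    if x: "x \<in> closed_nbhd \<omega> r" for x
  proof -
    have "L2_set (\<lambda>(i, js). pderivs (closed_nbhd \<omega> r) js (f i) x) (I \<times> {js. length js = j})
       \<le> card (I \<times> {js :: 2 list. length js = j}) * b"
    proof (rule L2_set_le_card)
      show "finite (I \<times> {js :: 2 list. length js = j})" using I finite_lists_2 by simp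
      fix p assume "p \<in> I \<times> {js :: 2 list. length js = j}"
      then obtain i js where p: "p = (i, js)" "i \<in> I" "length js = j" by auto
      have "pderivs (closed_nbhd \<omega> r) js (f i) x = pderivs UNIV js (F i) x"
        by (rule pderivs_nbhd[OF r F]) (use p x in auto)
      then show "\<bar>case p of (i, js) \<Rightarrow> pderivs (closed_nbhd \<omega> r) js (f i) x\<bar> \<le> b"
        using b[OF p(2,3) x] p(1) by simp
    qed
    then show ?thesis by (simp add: card_cartesian_product card_lists_2)
  qed
  ultimately show ?thesis unfolding sup_nabla_def by (intro cSUP_least) auto
qed

text \<open>A supremum of reals bounds its set only when the set is bounded above. This comes from
  compactness of the neighbourhood and continuity of the derivatives of the extensions.\<close>

lemma sup_nabla_ge:
  assumes r: "0 < r" and I: "finite I" and om: "bounded \<omega>"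
    and F: "\<And>i. i \<in> I \<Longrightarrow> bd {} j 0 0 (F i)" "\<And>i x. i \<in> I \<Longrightarrow> x \<in> closed_nbhd \<omega> r \<Longrightarrow> F i x = f i x"
    and i: "i \<in> I" "length js = j" "x \<in> closed_nbhd \<omega> r"
  shows "\<bar>pderivs UNIV js (F i) x\<bar> \<le> sup_nabla j (closed_nbhd \<omega> r) I f"
proof -
  let ?K = "closed_nbhd \<omega> r"
  let ?A = "I \<times> {js :: 2 list. length js = j}"
  let ?g = "\<lambda>x. L2_set (\<lambda>(i, js). pderivs ?K js (f i) x) ?A"
  let ?h = "\<lambda>x. L2_set (\<lambda>p. pderivs UNIV (snd p) (F (fst p)) x) ?A"
  have eq: "?g x = ?h x" if "x \<in> ?K" for x
    by (rule L2_set_cong) (use pderivs_nbhd[OF r F] that in auto)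
  have "continuous_on ?K (\<lambda>x. pderivs UNIV (snd p) (F (fst p)) x)" if "p \<in> ?A" for p
    using bd_cont[OF bd_pderivs[OF F(1)], of "fst p" "snd p"] that by (auto intro: continuous_on_subset)
  then have "continuous_on ?K ?h"
    unfolding L2_set_def by (intro continuous_intros) auto
  then have "compact (?h ` ?K)" using compact_nbhd[OF om] by (rule compact_continuous_image)
  moreover have "?h ` ?K = ?g ` ?K" using eq by (intro image_cong) auto
  ultimately have "bdd_above (?g ` ?K)" by (simp add: compact_imp_bounded bounded_imp_bdd_above)
  then have "?g x \<le> sup_nabla j ?K I f" unfolding sup_nabla_def using i(3) by (intro cSUP_upper) auto
  moreover have "\<bar>(\<lambda>p. pderivs UNIV (snd p) (F (fst p)) x) (i, js)\<bar> \<le> ?h x"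
    by (rule abs_le_L2_set) (use I finite_lists_2 i in auto)
  ultimately show ?thesis using eq[OF i(3)] by simp
qed

lemma sup_nabla_nonneg:
  assumes r: "0 < r" and I: "finite I" "I \<noteq> {}" and om: "bounded \<omega>" "\<omega> \<noteq> {}"
    and F: "\<And>i. i \<in> I \<Longrightarrow> bd {} j 0 0 (F i)" "\<And>i x. i \<in> I \<Longrightarrow> x \<in> closed_nbhd \<omega> r \<Longrightarrow> F i x = f i x"
  shows "0 \<le> sup_nabla j (closed_nbhd \<omega> r) I f"
proof -
  obtain z i where z: "z \<in> \<omega>" "i \<in> I" using om I by blast
  then have "z \<in> closed_nbhd \<omega> r"
    unfolding in_closed_nbhd using r closure_subset by (intro bexI[of _ z]) auto
  then have "\<bar>pderivs UNIV (replicate j 1) (F i) z\<bar> \<le> sup_nabla j (closed_nbhd \<omega> r) I f"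
    by (intro sup_nabla_ge[OF r I(1) om(1) F z(2)]) auto
  then show ?thesis by (rule order_trans[OF abs_ge_zero])
qed

text \<open>The quotients are bounded above by the sum of the Hoelder constants of the extensions,
  so the supremum is a genuine upper bound.\<close>

lemma Hoelder_seminorm_ge:
  assumes r: "0 < r" and I: "finite I" and al: "0 < \<alpha>"
    and F: "\<And>i. i \<in> I \<Longrightarrow> C_Hoelder m \<alpha> (F i)" "\<And>i x. i \<in> I \<Longrightarrow> x \<in> closed_nbhd \<omega> r \<Longrightarrow> F i x = f i x"
    and i: "i \<in> I" "length js = m" "x \<in> closed_nbhd \<omega> r" "y \<in> closed_nbhd \<omega> r"
  shows "\<bar>pderivs UNIV js (F i) x - pderivs UNIV js (F i) y\<bar>
    \<le> Hoelder_seminorm m \<alpha> (closed_nbhd \<omega> r) I f * dist x y powr \<alpha>"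
proof (cases "x = y")
  case False
  let ?K = "closed_nbhd \<omega> r"
  let ?A = "I \<times> {js :: 2 list. length js = m}"
  let ?g = "\<lambda>x y. L2_set (\<lambda>(i, js). pderivs ?K js (f i) x - pderivs ?K js (f i) y) ?A / dist x y powr \<alpha>"
  have bF: "bd {} m 0 0 (F i)" if "i \<in> I" for i
    using F(1)[OF that] C_diff_iff_bd by (simp add: C_Hoelder_def)
  have eq: "pderivs ?K js (f i) x = pderivs UNIV js (F i) x" if "i \<in> I" "length js = m" "x \<in> ?K" for i js x
    by (rule pderivs_nbhd[OF r bF F(2)]) (use that in auto)
  have finA: "finite ?A" using I finite_lists_2 by simp
  have "\<exists>H. \<forall>x y. \<bar>pderivs UNIV (snd p) (F (fst p)) x - pderivs UNIV (snd p) (F (fst p)) y\<bar> \<le> H * dist x y powr \<alpha>" if "p \<in> ?A" for p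
    using F(1)[of "fst p"] that by (auto simp: C_Hoelder_def)
  then obtain H where H: "\<And>p x y. p \<in> ?A \<Longrightarrow> \<bar>pderivs UNIV (snd p) (F (fst p)) x - pderivs UNIV (snd p) (F (fst p)) y\<bar> \<le> H p * dist x y powr \<alpha>"
    by metis
  have up: "?g x y \<le> (\<Sum>p\<in>?A. H p)" if "x \<in> ?K" "y \<in> ?K" "x \<noteq> y" for x y
  proof -
    have "L2_set (\<lambda>(i, js). pderivs ?K js (f i) x - pderivs ?K js (f i) y) ?A
      \<le> (\<Sum>p\<in>?A. \<bar>(\<lambda>(i, js). pderivs ?K js (f i) x - pderivs ?K js (f i) y) p\<bar>)"
      by (rule L2_set_le_sum_abs)
    also have "\<dots> \<le> (\<Sum>p\<in>?A. H p * dist x y powr \<alpha>)"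
      by (rule sum_mono) (use H eq that in fastforce)
    also have "\<dots> = (\<Sum>p\<in>?A. H p) * dist x y powr \<alpha>" by (simp add: sum_distrib_right)
    finally show ?thesis using that(3) by (simp add: divide_le_eq)
  qed
  have "?g x y \<le> Hoelder_seminorm m \<alpha> ?K I f"
    unfolding Hoelder_seminorm_def
  proof (rule cSup_upper)
    show "?g x y \<in> {?g x y |x y. x \<in> ?K \<and> y \<in> ?K \<and> x \<noteq> y}" using i False by blast
    show "bdd_above {?g x y |x y. x \<in> ?K \<and> y \<in> ?K \<and> x \<noteq> y}"
      using up by (intro bdd_aboveI[of _ "\<Sum>p\<in>?A. H p"]) auto
  qed
  then have "L2_set (\<lambda>(i, js). pderivs ?K js (f i) x - pderivs ?K js (f i) y) ?A \<le> Hoelder_seminorm m \<alpha> ?K I f * dist x y powr \<alpha>"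
    using False by (simp add: divide_le_eq)
  moreover have "\<bar>(\<lambda>(i, js). pderivs ?K js (f i) x - pderivs ?K js (f i) y) (i, js)\<bar>
     \<le> L2_set (\<lambda>(i, js). pderivs ?K js (f i) x - pderivs ?K js (f i) y) ?A"
    by (rule abs_le_L2_set[OF finA]) (use i in auto)
  ultimately show ?thesis using eq[OF i(1,2)] i(3,4) by simp
qed simp

lemma lipschitz_of_pd:
  fixes f :: "real^2 \<Rightarrow> real"
  assumes f: "\<And>z. f differentiable (at z)" and M: "\<And>z i. dist x z \<le> r \<Longrightarrow> \<bar>pd i f z\<bar> \<le> M" and y: "dist x y \<le> r"
  shows "\<bar>f y - f x\<bar> \<le> 2 * M * dist x y"
proof -
  have "norm (f y - f x) \<le> 2 * M * norm (y - x)"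
  proof (rule differentiable_bound[of "cball x r" f "\<lambda>z h. \<Sum>i\<in>UNIV. pd i f z * h $ i" "2 * M" y x])
    fix z assume z: "z \<in> cball x r"
    show "(f has_derivative (\<lambda>h. \<Sum>i\<in>UNIV. pd i f z * h $ i)) (at z within cball x r)"
      by (rule has_derivative_at_withinI[OF has_derivative_pd[OF f]])
    show "onorm (\<lambda>h. \<Sum>i\<in>UNIV. pd i f z * h $ i) \<le> 2 * M"
    proof (rule onorm_le)
      fix h :: "real^2"
      have "\<bar>pd i f z * h $ i\<bar> \<le> M * norm h" for i
        using M[of z i] z component_le_norm_cart[of h i] by (auto simp: abs_mult intro!: mult_mono)
      from this[of 1] this[of 2] show "norm (\<Sum>i\<in>UNIV. pd i f z * h $ i) \<le> 2 * M * norm h"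
        by (simp add: sum_2)
    qed
  qed (use y order_trans[OF zero_le_dist y] in auto)
  then show ?thesis by (simp add: dist_norm norm_minus_commute)
qed

text \<open>The mean value theorem is applied to the sum of the values at opposite points. Its
  derivative is the difference of two values of \<open>pd i f\<close> at distance at most 2h, so the
  second difference gains the exponent 1 + \<alpha>.\<close>

lemma second_difference:
  fixes f :: "real^2 \<Rightarrow> real"
  assumes f: "\<And>z. f differentiable (at z)" and H: "0 \<le> H" and al: "0 < \<alpha>" "\<alpha> \<le> 1" and h: "0 < h" "\<bar>t\<bar> \<le> h"
    and Ho: "\<And>a b. dist y a \<le> h \<Longrightarrow> dist y b \<le> h \<Longrightarrow> \<bar>pd i f a - pd i f b\<bar> \<le> H * dist a b powr \<alpha>"
  shows "\<bar>f (y + t *\<^sub>R axis i 1) + f (y - t *\<^sub>R axis i 1) - 2 * f y\<bar> \<le> 2 * (H * h powr (1 + \<alpha>))"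
proof -
  have pos: "\<bar>f (y + t *\<^sub>R axis i 1) + f (y - t *\<^sub>R axis i 1) - 2 * f y\<bar> \<le> 2 * (H * h powr (1 + \<alpha>))"
    if t: "0 < t" "t \<le> h" for t
  proof -
    define \<phi> where "\<phi> s = f (y + s *\<^sub>R axis i 1) + f (y + (-s) *\<^sub>R axis i 1)" for s
    have d: "(\<phi> has_real_derivative pd i f (y + s *\<^sub>R axis i 1) - pd i f (y + (-s) *\<^sub>R axis i 1)) (at s)" for s
    proof -
      have "((\<lambda>s. - s) has_real_derivative - 1) (at s)" by (auto intro!: derivative_eq_intros)
      from DERIV_add[OF DERIV_line[OF f] DERIV_chain2[OF DERIV_line[OF f] this]]
      show ?thesis unfolding \<phi>_def by simp
    qed
    obtain \<xi> where xi: "0 < \<xi>" "\<xi> < t" "\<phi> t - \<phi> 0 = (t - 0) * (pd i f (y + \<xi> *\<^sub>R axis i 1) - pd i f (y + (-\<xi>) *\<^sub>R axis i 1))"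
      using MVT2[OF t(1) d] by blast
    have "(y + \<xi> *\<^sub>R axis i 1) - (y + (-\<xi>) *\<^sub>R axis i 1) = (2 * \<xi>) *\<^sub>R axis i (1::real)"
      by (simp add: vec_eq_iff)
    then have di: "dist (y + \<xi> *\<^sub>R axis i 1) (y + (-\<xi>) *\<^sub>R axis i 1) = 2 * \<xi>"
      using xi(1) by (simp only: dist_norm) simp
    have "(2 * \<xi>) powr \<alpha> \<le> (2 * h) powr \<alpha>" using xi t al by (intro powr_mono2) auto
    also have "(2 * h) powr \<alpha> = 2 powr \<alpha> * h powr \<alpha>" using h by (simp add: powr_mult)
    also have "\<dots> \<le> 2 powr 1 * h powr \<alpha>" using al by (intro mult_right_mono powr_mono) auto
    finally have p: "(2 * \<xi>) powr \<alpha> \<le> 2 * h powr \<alpha>" by simp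
    have "\<bar>pd i f (y + \<xi> *\<^sub>R axis i 1) - pd i f (y + (-\<xi>) *\<^sub>R axis i 1)\<bar> \<le> H * (2 * \<xi>) powr \<alpha>"
      unfolding di[symmetric] by (rule Ho) (use xi t in \<open>auto simp: dist_norm\<close>)
    also have "\<dots> \<le> H * (2 * h powr \<alpha>)" by (rule mult_left_mono[OF p H])
    finally have b: "\<bar>pd i f (y + \<xi> *\<^sub>R axis i 1) - pd i f (y + (-\<xi>) *\<^sub>R axis i 1)\<bar> \<le> H * (2 * h powr \<alpha>)" .
    have "\<bar>\<phi> t - \<phi> 0\<bar> \<le> h * (H * (2 * h powr \<alpha>))"
      unfolding xi(3) abs_mult using t b by (intro mult_mono) auto
    also have "\<dots> = 2 * (H * h powr (1 + \<alpha>))" using h by (simp add: powr_add)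
    finally show ?thesis by (simp add: \<phi>_def)
  qed
  have nn: "0 \<le> 2 * (H * h powr (1 + \<alpha>))" using H by simp
  consider "t = 0" | "0 < t" | "t < 0" by linarith
  then show ?thesis
  proof cases
    case 1
    then show ?thesis using nn by simp
  next
    case 2
    then show ?thesis using pos[of t] h by simp
  next
    case 3
    then show ?thesis using pos[of "- t"] h by (simp add: add.commute)
  qed
qed

text \<open>After subtraction of \<open>c\<close> the sup bound on the reach of the average is
  zero.\<close>

lemma mol_pow_eq_const:
  assumes h: "0 < h" and f: "continuous_on UNIV f" and c: "\<And>y. dist x y \<le> 2 * h * n \<Longrightarrow> f y = c"
  shows "(mol h ^^ n) f x = c"
proof -
  have "(mol h ^^ n) (\<lambda>y. 1 * f y + (- c) * 1) x = 1 * (mol h ^^ n) f x + (- c) * 1"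
    by (subst mol_pow_lin[OF f]) (auto simp: mol_pow_const)
  moreover have "\<bar>(mol h ^^ n) (\<lambda>y. 1 * f y + (- c) * 1) x\<bar> \<le> 0"
    by (rule mol_pow_bound[OF h]) (use f c in \<open>auto intro!: continuous_intros\<close>)
  ultimately show ?thesis by simp
qed

lemma mol_pow_sum:
  assumes "finite I" "\<And>a. a \<in> I \<Longrightarrow> continuous_on UNIV (f a)"
  shows "(mol h ^^ n) (\<lambda>x. \<Sum>a\<in>I. f a x) = (\<lambda>x. \<Sum>a\<in>I. (mol h ^^ n) (f a) x)"
  using assms
proof (induction I rule: finite_induct)
  case empty
  then show ?case by (simp add: mol_pow_const)
next
  case (insert a I)
  have "(mol h ^^ n) (\<lambda>x. 1 * f a x + 1 * (\<Sum>a\<in>I. f a x)) = (\<lambda>x. 1 * (mol h ^^ n) (f a) x + 1 * (mol h ^^ n) (\<lambda>x. \<Sum>a\<in>I. f a x) x)"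
    by (rule mol_pow_lin) (use insert.prems in \<open>auto intro!: continuous_on_sum\<close>)
  then show ?case using insert by simp
qed

lemma nbhd_infdist:
  assumes "bounded \<omega>" "\<omega> \<noteq> {}"
  shows "x \<in> closed_nbhd \<omega> r \<longleftrightarrow> infdist x (closure \<omega>) \<le> r"
proof
  assume "x \<in> closed_nbhd \<omega> r"
  then obtain z where "z \<in> closure \<omega>" "dist z x \<le> r" using in_closed_nbhd by blast
  then show "infdist x (closure \<omega>) \<le> r" using infdist_le[of z "closure \<omega>" x] by (simp add: dist_commute)
next
  assume r: "infdist x (closure \<omega>) \<le> r"
  obtain z where "z \<in> closure \<omega>" "infdist x (closure \<omega>) = dist x z"
    using infdist_attains_inf[of "closure \<omega>" x] assms by auto
  then show "x \<in> closed_nbhd \<omega> r" using r in_closed_nbhd by (auto simp: dist_commute)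
qed

section \<open>Mollified data, cutoff and starting defect\<close>

locale mollification =
  fixes \<omega> :: "(real^2) set" and R0 :: real and k n :: nat and l M D0 G :: real
    and Fv :: "nat \<Rightarrow> real^2 \<Rightarrow> real" and Fw :: "2 \<Rightarrow> real^2 \<Rightarrow> real" and FA :: "2 \<Rightarrow> 2 \<Rightarrow> real^2 \<Rightarrow> real"
  assumes om: "\<omega> \<subseteq> cball 0 R0" "\<omega> \<noteq> {}" and R0: "0 \<le> R0"
    and k: "1 \<le> k" and n: "1 \<le> n" and l: "0 < l" "l \<le> 1" and M: "1 \<le> M" and D0: "0 \<le> D0" and G: "0 \<le> G"
    and Fv: "\<And>a. a < k \<Longrightarrow> bd {} 2 0 0 (Fv a)" and Fw: "\<And>j. bd {} 2 0 0 (Fw j)"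
    and FA: "\<And>i j. continuous_on UNIV (FA i j)" "\<And>i j. FA i j = FA j i"
    and v1: "\<And>a i x. a < k \<Longrightarrow> x \<in> closed_nbhd \<omega> (2 * l) \<Longrightarrow> \<bar>pd i (Fv a) x\<bar> \<le> M"
    and vG: "\<And>a i x. a < k \<Longrightarrow> x \<in> closed_nbhd \<omega> (2 * l) \<Longrightarrow> \<bar>pd i (Fv a) x\<bar> \<le> G"
    and v2: "\<And>a i j x. a < k \<Longrightarrow> x \<in> closed_nbhd \<omega> (2 * l) \<Longrightarrow> \<bar>pd i (pd j (Fv a)) x\<bar> \<le> M"
    and w1: "\<And>j i x. x \<in> closed_nbhd \<omega> (2 * l) \<Longrightarrow> \<bar>pd i (Fw j) x\<bar> \<le> M"
    and w2: "\<And>j i i' x. x \<in> closed_nbhd \<omega> (2 * l) \<Longrightarrow> \<bar>pd i' (pd i (Fw j)) x\<bar> \<le> M"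
    and D: "\<And>i j x. x \<in> closed_nbhd \<omega> (2 * l) \<Longrightarrow> \<bar>FA i j x - vk k Fv Fw i j x\<bar> \<le> D0"
begin

text \<open>The 2n averages of radius \<open>h\<close> reach as far as l/10. This leaves room
  between the l-neighbourhood and the 2l-neighbourhood for mollifying both the cutoff and the
  data.\<close>

definition h where "h = l / (20 * n)"
abbreviation P where "P \<equiv> mol h ^^ n"
abbreviation d where "d x \<equiv> infdist x (closure \<omega>)"
definition E where "E = sqrt D0 + l * M"
text \<open>Since \<open>P\<close> sees only points at distance at most \<open>l/10\<close>, the cutoff is \<open>1\<close> for \<open>d x \<le> 1.15 l\<close> and \<open>0\<close> for
  \<open>d x \<ge> 1.45 l\<close>.\<close>
definition ch where "ch = P (\<lambda>x. max 0 (min 1 (13.5 - 10 * d x / l)))"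
definition v0 where "v0 a = P (Fv a)"
definition w0 where "w0 j = P (Fw j)"
definition H0 where "H0 a i j = (\<lambda>x. ch x * pd i (pd j (v0 a)) x)"
definition F0 where "F0 i j = (\<lambda>x. ch x * (P (\<lambda>x. FA i j x - vk k Fv Fw i j x) x
   + 1/2 * (\<Sum>a<k. P (\<lambda>x. pd i (Fv a) x * pd j (Fv a) x) x - P (pd i (Fv a)) x * P (pd j (Fv a)) x)))"
text \<open>A closed set just beyond the support of the cutoff: \<open>ch\<close> vanishes on the
  open complement, where products with it may be continued by zero. All points within l/10 of it
  still belong to the 2l-neighbourhood, so mollified data are controlled on it.\<close>

definition \<Omega> where "\<Omega> = {x. d x \<le> 1.46 * l}"
text \<open>The factors come from \<open>n\<close> derivatives of \<open>P\<close>, each costing \<open>1/h = 20 n/l\<close>, from the Leibniz rule with the cutoff, and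
  from the commutator in \<open>F0\<close>.\<close>
definition Z where "Z = (20 * real n) ^ n * 2 ^ n * (1 + k * (1 + 2 ^ n))"

lemma h0: "0 < h" and reach: "2 * h * n = l / 10" and hl: "h \<le> l / 10" and h1: "1 \<le> (1 / h) * h"
  using l n by (auto simp: h_def field_simps)

lemma bom: "bounded \<omega>" using om(1) bounded_subset bounded_cball by blast

lemma K: "x \<in> closed_nbhd \<omega> r \<longleftrightarrow> d x \<le> r"
  by (rule nbhd_infdist[OF bom om(2)])

lemma d_tri: "d y \<le> d x + dist x y"
  using infdist_triangle[of y "closure \<omega>" x] by (simp add: dist_commute)

lemma Om_K2: "x \<in> \<Omega> \<Longrightarrow> dist x y \<le> l / 10 \<Longrightarrow> y \<in> closed_nbhd \<omega> (2 * l)"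
  unfolding K \<Omega>_def using d_tri[of y x] l by simp

lemma X_Om: "x \<in> closed_nbhd \<omega> l \<Longrightarrow> x \<in> \<Omega>"
  unfolding K \<Omega>_def using l by simp

lemma P_bd:
  assumes f: "bd {} m 0 0 f"
  shows "bd {} (m + n) 0 0 (P f)"
  by (rule bd_smooth[OF mol_pow_bd[OF h0 h1 order_refl bd_smooth'[OF f]]]) auto

lemma P_Om:
  assumes "continuous_on UNIV f" "\<And>x. x \<in> closed_nbhd \<omega> (2 * l) \<Longrightarrow> \<bar>f x\<bar> \<le> K" "0 \<le> K"
  shows "bd \<Omega> n K (1 / h) (P f)"
proof -
  have "bd \<Omega> (0 + n) K (1 / h) (P f)"
  proof (rule mol_pow_bd[OF h0 h1 assms(3)])
    show "bd (closed_nbhd \<omega> (2 * l)) 0 K (1 / h) f" using assms by simp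
    show "cball x (2 * h * n) \<subseteq> closed_nbhd \<omega> (2 * l)" if "x \<in> \<Omega>" for x
      using Om_K2[OF that] by (auto simp: reach)
  qed
  then show ?thesis by simp
qed

lemma cutoff_cont: "continuous_on UNIV (\<lambda>x. max 0 (min 1 (13.5 - 10 * d x / l)))"
  using l by (intro continuous_intros) auto

lemma ch_bd: "bd UNIV n 1 (1 / h) ch"
proof -
  have "bd UNIV (0 + n) 1 (1 / h) ch"
    unfolding ch_def by (rule mol_pow_bd[OF h0 h1, of 1 UNIV]) (use cutoff_cont in auto)
  then show ?thesis by simp
qed

lemma ch_one: "x \<in> closed_nbhd \<omega> l \<Longrightarrow> ch x = 1"
  unfolding ch_def
proof (rule mol_pow_eq_const[OF h0 cutoff_cont])
  fix y assume x: "x \<in> closed_nbhd \<omega> l" and y: "dist x y \<le> 2 * h * n"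
  have "d y \<le> 1.1 * l" using x y d_tri[of y x] unfolding K reach by simp
  then have "10 * d y / l \<le> 11" using l by (simp add: field_simps)
  then show "max 0 (min 1 (13.5 - 10 * d y / l)) = 1" by simp
qed

lemma ch_zero: "x \<notin> \<Omega> \<Longrightarrow> ch x = 0"
  unfolding ch_def
proof (rule mol_pow_eq_const[OF h0 cutoff_cont])
  fix y assume x: "x \<notin> \<Omega>" and y: "dist x y \<le> 2 * h * n"
  have "d y \<ge> 1.36 * l" using x y d_tri[of x y] unfolding reach \<Omega>_def by (simp add: dist_commute)
  then have "10 * d y / l \<ge> 13.6" using l by (simp add: field_simps)
  then show "max 0 (min 1 (13.5 - 10 * d y / l)) = 0" by simp
qed

lemma scale: "bd U n C (1 / h) f \<Longrightarrow> 0 \<le> C \<Longrightarrow> bd U n ((20 * real n) ^ n * C) (1 / l) f"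
proof -
  assume f: "bd U n C (1 / h) f" and C: "0 \<le> C"
  have "1 / h = (20 * real n) * (1 / l)" by (simp add: h_def)
  then show ?thesis using bd_scale_freq[of U n C "20 * real n" "1 / l" f] f C n l by simp
qed

text \<open>On \<open>\<Omega>\<close> this is the Leibniz rule. On the open complement the product
  is zero together with its derivatives, although \<open>g\<close> is not controlled there.\<close>

lemma cut_bd:
  assumes g: "bd \<Omega> n C (1 / h) g" and C: "0 \<le> C"
  shows "bd UNIV n ((20 * real n) ^ n * (2 ^ n * C)) (1 / l) (\<lambda>x. ch x * g x)"
proof -
  have 1: "bd \<Omega> n (2 ^ n * 1 * C) (1 / h) (\<lambda>x. ch x * g x)"
    by (rule bd_mult[OF bd_mono[OF ch_bd] g]) (use h0 in auto)
  have op: "open (- \<Omega>)"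
  proof -
    have "closed \<Omega>" unfolding \<Omega>_def by (intro closed_Collect_le continuous_intros) auto
    then show ?thesis by (simp add: open_Compl)
  qed
  have 2: "bd (- \<Omega>) n (2 ^ n * 1 * C) (1 / h) (\<lambda>x. ch x * g x)"
    by (rule bd_mono[OF bd_zero_open[where \<mu> = "1 / h", OF op _ bd_smooth[OF 1]]]) (use h0 C ch_zero in auto)
  have "\<Omega> \<union> - \<Omega> = UNIV" by auto
  with bd_Un[OF 1 2] have "bd UNIV n (2 ^ n * 1 * C) (1 / h) (\<lambda>x. ch x * g x)" by simp
  from scale[OF this] show ?thesis using C by simp
qed

lemma E_facts: "0 < E" "l * M \<le> E" "D0 \<le> E^2" "(l * M)^2 \<le> E^2" "M \<le> E / l" "E^2 \<le> 2 * (D0 + (l * M)^2)"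
proof -
  have lM: "0 < l * M" using l M by simp
  have s: "0 \<le> sqrt D0" using D0 by simp
  show "0 < E" unfolding E_def by (rule add_nonneg_pos[OF s lM])
  show e: "l * M \<le> E" using s by (simp add: E_def)
  have "sqrt D0 ^ 2 \<le> E^2" using s lM by (intro power_mono) (auto simp: E_def)
  then show "D0 \<le> E^2" using D0 by simp
  show "(l * M)^2 \<le> E^2" using e lM by (intro power_mono) auto
  show "M \<le> E / l" using e l by (simp add: field_simps)
  have "E^2 + (sqrt D0 - l * M)^2 = 2 * (sqrt D0 ^ 2 + (l * M)^2)" by (simp add: E_def power2_eq_square algebra_simps)
  moreover have "E^2 \<le> E^2 + (sqrt D0 - l * M)^2" by simp
  ultimately show "E^2 \<le> 2 * (D0 + (l * M)^2)" by (simp only: real_sqrt_pow2[OF D0])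
qed

lemma F_C1:
  "a < k \<Longrightarrow> bd {} (Suc 1) 0 0 (Fv a)" "bd {} (Suc 1) 0 0 (Fw j)"
  "a < k \<Longrightarrow> bd {} (Suc 0) 0 0 (pd i (Fv a))" "bd {} (Suc 0) 0 0 (pd i (Fw j))"
proof -
  show v: "bd {} (Suc 1) 0 0 (Fv a)" if "a < k" for a using Fv[OF that] by (simp only: Suc_1)
  show w: "bd {} (Suc 1) 0 0 (Fw j)" for j using Fw by (simp only: Suc_1)
  show "bd {} (Suc 0) 0 0 (pd i (Fv a))" if "a < k"
    using bd_pd[OF v[OF that]] by (simp only: One_nat_def mult_zero_left)
  show "bd {} (Suc 0) 0 0 (pd i (Fw j))"
    using bd_pd[OF w] by (simp only: One_nat_def mult_zero_left)
qed

lemma pdF_cont: "a < k \<Longrightarrow> continuous_on UNIV (pd i (Fv a))" "continuous_on UNIV (pd i (Fw j))"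
  "a < k \<Longrightarrow> continuous_on UNIV (pd i (pd i' (Fv a)))" "continuous_on UNIV (pd i (pd i' (Fw j)))"
  using bd_cont[OF F_C1(3)] bd_cont[OF F_C1(4)] bd_cont[OF bd_pd[OF F_C1(3)]] bd_cont[OF bd_pd[OF F_C1(4)]]
  by blast+

lemma pd_v0: "a < k \<Longrightarrow> pd i (v0 a) = P (pd i (Fv a))" "a < k \<Longrightarrow> pd i (pd j (v0 a)) = P (pd i (pd j (Fv a)))"
  and pd_w0: "pd i (w0 j) = P (pd i (Fw j))" "pd i (pd i' (w0 j)) = P (pd i (pd i' (Fw j)))"
proof -
  show v: "pd i (v0 a) = P (pd i (Fv a))" if "a < k" for i
    unfolding v0_def by (rule mol_pow_pd(2)[OF F_C1(1)[OF that]])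
  show "pd i (pd j (v0 a)) = P (pd i (pd j (Fv a)))" if "a < k"
    unfolding v[OF that] by (rule mol_pow_pd(2)[OF F_C1(3)[OF that]])
  show w: "pd i (w0 j) = P (pd i (Fw j))" for i
    unfolding w0_def by (rule mol_pow_pd(2)[OF F_C1(2)])
  show "pd i (pd i' (w0 j)) = P (pd i (pd i' (Fw j)))"
    unfolding w by (rule mol_pow_pd(2)[OF F_C1(4)])
qed

text \<open>The Lipschitz bound moves each of the 2n averages by at most 2Mh, in total M
  l/5.\<close>

lemma P_err:
  assumes f: "bd {} (Suc m) 0 0 f" and b: "\<And>x i. x \<in> closed_nbhd \<omega> (2 * l) \<Longrightarrow> \<bar>pd i f x\<bar> \<le> M" and x: "x \<in> closed_nbhd \<omega> l"
  shows "\<bar>P f x - f x\<bar> \<le> l * M"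
proof -
  define V where "V = {y. d y \<le> 1.1 * l}"
  have fd: "f differentiable (at z)" for z using f by auto
  have VK: "z \<in> closed_nbhd \<omega> (2 * l)" if "y \<in> V" "dist y z \<le> h" for y z
    using that d_tri[of z y] hl l unfolding K V_def by simp
  have lip: "\<bar>f z - f y\<bar> \<le> 2 * M * h" if "y \<in> V" "dist y z \<le> h" for y z
  proof -
    have "\<bar>f z - f y\<bar> \<le> 2 * M * dist y z"
      by (rule lipschitz_of_pd[OF fd _ that(2)]) (use b VK[OF that(1)] in auto)
    also have "\<dots> \<le> 2 * M * h" using that(2) M by (intro mult_left_mono) auto
    finally show ?thesis .
  qed
  have "\<bar>P f x - f x\<bar> \<le> 2 * real n * (2 * M * h)"
  proof (rule mol_pow_err[OF bd_cont[OF f] h0, of V])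
    fix y i assume y: "y \<in> V"
    show "\<bar>av (\<lambda>_. 1) i (- h) (2 * h) f y - f y\<bar> \<le> 2 * M * h"
    proof (rule av_err[OF bd_cont[OF f] h0])
      fix t :: real assume t: "\<bar>t\<bar> \<le> h"
      show "\<bar>f (y + t *\<^sub>R axis i 1) + f (y - t *\<^sub>R axis i 1) - 2 * f y\<bar> \<le> 2 * (2 * M * h)"
        using lip[OF y, of "y + t *\<^sub>R axis i 1"] lip[OF y, of "y - t *\<^sub>R axis i 1"] t by (simp add: dist_norm)
    qed
  next
    show "cball x (2 * h * n) \<subseteq> V"
    proof
      fix y assume "y \<in> cball x (2 * h * n)"
      then show "y \<in> V" using x d_tri[of y x] unfolding K V_def reach by simp
    qed
  qed
  also have "\<dots> = 2 * M * (2 * h * n)" by simp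
  also have "\<dots> \<le> l * M" unfolding reach using l M by simp
  finally show ?thesis .
qed

lemma Z1: "1 \<le> Z"
proof -
  have "1 * 1 * 1 \<le> (20 * real n) ^ n * 2 ^ n * (1 + k * (1 + 2 ^ n))"
    using n by (intro mult_mono one_le_power) auto
  then show ?thesis by (simp add: Z_def)
qed

lemma Zge: "(20 * real n) ^ n \<le> Z" "(20 * real n) ^ n * 2 ^ n \<le> Z"
proof -
  have p: "0 \<le> (20 * real n) ^ n * 2 ^ n" by simp
  have "(20 * real n) ^ n * 2 ^ n * 1 \<le> Z"
    unfolding Z_def by (intro mult_left_mono p) simp
  then show "(20 * real n) ^ n * 2 ^ n \<le> Z" by simp
  moreover have "(20 * real n) ^ n * 1 \<le> (20 * real n) ^ n * 2 ^ n" by (intro mult_left_mono) auto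
  ultimately show "(20 * real n) ^ n \<le> Z" by linarith
qed

lemma hess_bd: "bd \<Omega> n M (1 / h) (pd i (pd j (v0 a)))" if a: "a < k"
  unfolding pd_v0(2)[OF a] using v2[OF a] M by (intro P_Om pdF_cont a) auto

text \<open>The radius \<open>R0 + 2\<close> serves two purposes: as \<open>l \<le> 1\<close>, the
  l-neighbourhood lies inside, and beyond it the distance to the closure of \<omega> is at least 2,
  past the support of the cutoff.\<close>

lemma data:
  assumes sg: "1 \<le> \<sigma>"
  shows "corrugation_data k (closed_nbhd \<omega> l) (R0 + 2) l \<sigma> E G n Z v0 w0 H0 ch"
proof
  let ?p = "(20 * real n) ^ n"
  have p0: "0 \<le> ?p" by simp
  have pM: "?p * M \<le> Z * E / l"
  proof -
    have "?p * M \<le> Z * (E / l)" using Zge(1) E_facts(5) M p0 Z1 by (intro mult_mono) auto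
    then show ?thesis by simp
  qed
  show "norm x \<le> R0 + 2" if xl: "x \<in> closed_nbhd \<omega> l" for x
  proof -
    obtain z where z: "z \<in> closure \<omega>" "dist z x \<le> l" using iffD1[OF in_closed_nbhd xl] by blast
    have "closure \<omega> \<subseteq> cball 0 R0" using om(1) by (simp add: closure_minimal)
    then have "norm z \<le> R0" using z(1) by auto
    then show ?thesis using z(2) l norm_triangle_sub[of x z] by (simp add: dist_norm norm_minus_commute)
  qed
  show "bd {} 3 0 0 (v0 a)" if "a < k" for a
    unfolding v0_def by (rule bd_le[OF P_bd[OF Fv[OF that]]]) (use n in simp)
  show "bd {} 2 0 0 (w0 j)" for j
    unfolding w0_def by (rule bd_le[OF P_bd[OF Fw]]) simp
  show "\<bar>pd j (v0 a) x\<bar> \<le> G" if "a < k" "x \<in> closed_nbhd \<omega> l" for a j x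
    unfolding pd_v0(1)[OF that(1)]
    by (rule mol_pow_bound[OF h0 pdF_cont(1)[OF that(1)]]) (use vG that Om_K2[OF X_Om] in \<open>auto simp: reach\<close>)
  show "bd (closed_nbhd \<omega> l) 1 (Z * E / l) (1 / l) (pd i (pd j (v0 a)))" if "a < k" for a i j
    by (rule bd_mono[OF bd_le[OF scale[OF hess_bd[OF that]] n]]) (use pM p0 M l X_Om Z1 E_facts in auto)
  show "bd UNIV n (Z * E / l) (1 / l) (H0 a i j)" if "a < k" for a i j
    unfolding H0_def
  proof (rule bd_mono[OF cut_bd[OF hess_bd[OF that]]])
    have "?p * 2 ^ n * M \<le> Z * (E / l)" using Zge(2) E_facts(5) M Z1 by (intro mult_mono) auto
    then show "?p * (2 ^ n * M) \<le> Z * E / l" by (simp add: mult.assoc)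
  qed (use M l Z1 E_facts in auto)
  show "H0 a i j x = pd i (pd j (v0 a)) x" if "a < k" "x \<in> closed_nbhd \<omega> l" for a i j x
    using ch_one[OF that(2)] by (simp add: H0_def)
  show "bd UNIV n Z (1 / l) ch"
    by (rule bd_mono[OF scale[OF ch_bd]]) (use Zge Z1 l in auto)
  show "ch x = 0" if "R0 + 2 \<le> norm x" for x
  proof (rule ch_zero)
    have "closure \<omega> \<subseteq> cball 0 R0" using om(1) by (simp add: closure_minimal)
    moreover obtain z where "z \<in> closure \<omega>" "d x = dist x z"
      using infdist_attains_inf[of "closure \<omega>" x] om(2) by auto
    ultimately have "2 \<le> d x" using that norm_triangle_sub[of x z] by (force simp: dist_norm)
    then show "x \<notin> \<Omega>" using l by (simp add: \<Omega>_def)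
  qed
qed (use k l sg E_facts G R0 Z1 ch_one in auto)

lemma vk_cont: "continuous_on UNIV (vk k Fv Fw i j)"
  unfolding vk_def[abs_def] by (intro continuous_intros pdF_cont) auto

text \<open>The mollified defect is bounded by \<open>D0\<close>. The gradient of \<open>v\<close>
  oscillates by at most \<open>l * M\<close> over the reach of the average, so each commutator is of
  order (l M)^2. Both are at most E^2.\<close>

lemma start: "start_defect n (R0 + 2) (Z * E^2) l F0"
proof -
  let ?g = "\<lambda>i j x. P (\<lambda>x. FA i j x - vk k Fv Fw i j x) x
   + 1/2 * (\<Sum>a<k. P (\<lambda>x. pd i (Fv a) x * pd j (Fv a) x) x - P (pd i (Fv a)) x * P (pd j (Fv a)) x)"
  have c: "bd \<Omega> n ((1 + 2 ^ n) * (l * M) * (l * M)) (1 / h)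
     (\<lambda>x. P (\<lambda>x. pd i (Fv a) x * pd j (Fv a) x) x - P (pd i (Fv a)) x * P (pd j (Fv a)) x)" (is "bd \<Omega> n ?C _ ?f") if a: "a < k" for a i j
  proof (rule bd_pointwise)
    have lip: "\<bar>pd i (Fv a) y - pd i (Fv a) x\<bar> \<le> l * M" if x: "x \<in> \<Omega>" and y: "dist x y \<le> 2 * h * n" for x y i
    proof -
      have y': "dist x y \<le> l / 10" using y unfolding reach .
      have "\<bar>pd i (Fv a) y - pd i (Fv a) x\<bar> \<le> 2 * M * dist x y"
        by (rule lipschitz_of_pd[OF _ _ y']) (use F_C1(3)[OF a] v2[OF a] Om_K2[OF x] in auto)
      also have "\<dots> \<le> 2 * M * (l / 10)" using y' M by (intro mult_left_mono) auto
      also have "\<dots> \<le> l * M" using l M by simp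
      finally show ?thesis .
    qed
    show x: "bd {x} n ?C (1 / h) ?f" if "x \<in> \<Omega>" for x
      using commutator_bd[OF h0 pdF_cont(1)[OF a] pdF_cont(1)[OF a], of x n i "l * M" j "l * M"] lip[OF that] by simp
    \<comment> \<open>The bound at any single point of \<open>\<Omega>\<close> already contains the
      regularity on the whole plane.\<close>
    obtain z where "z \<in> \<omega>" using om(2) by blast
    then have "d z = 0" using closure_subset by (intro infdist_zero) blast
    then have "z \<in> \<Omega>" using l by (simp add: \<Omega>_def)
    from bd_smooth'[OF bd_smooth[OF x[OF this]]] show "bd {} n ?C (1 / h) ?f" .
  qed
  have g: "bd \<Omega> n (D0 + \<bar>1/2\<bar> * (\<Sum>a<k. (1 + 2 ^ n) * (l * M) * (l * M))) (1 / h) (?g i j)" for i j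
  proof (intro bd_add bd_cmult bd_sum c)
    show "bd \<Omega> n D0 (1 / h) (P (\<lambda>x. FA i j x - vk k Fv Fw i j x))"
      using D D0 by (intro P_Om continuous_intros FA vk_cont) auto
  qed (use h0 in auto)
  have K0: "0 \<le> D0 + \<bar>1/2\<bar> * (\<Sum>a<k. (1 + 2 ^ n) * (l * M) * (l * M))"
    using D0 l M by (intro add_nonneg_nonneg mult_nonneg_nonneg sum_nonneg) auto
  have KE: "D0 + \<bar>1/2\<bar> * (\<Sum>a<k. (1 + 2 ^ n) * (l * M) * (l * M)) \<le> (1 + k * (1 + 2 ^ n)) * E^2"
  proof -
    have "k * (1 + 2 ^ n) * (l * M)^2 \<le> k * (1 + 2 ^ n) * E^2" using E_facts(4) by (intro mult_left_mono) auto
    moreover have "0 \<le> k * (1 + 2 ^ n) * (l * M)^2" by simp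
    moreover have "\<bar>1/2\<bar> * (\<Sum>a<k. (1 + 2 ^ n) * (l * M) * (l * M)) = 1/2 * (k * (1 + 2 ^ n) * (l * M)^2)"
      by (simp add: power2_eq_square algebra_simps)
    moreover have "(1 + k * (1 + 2 ^ n)) * E^2 = E^2 + k * (1 + 2 ^ n) * E^2" by (simp add: distrib_right)
    ultimately show ?thesis using E_facts(3) by linarith
  qed
  have b: "bd UNIV n (Z * E^2) (1 / l) (F0 i j)" for i j
    unfolding F0_def
  proof (rule bd_mono[OF cut_bd[OF g K0]])
    have "(20 * real n) ^ n * 2 ^ n * (D0 + \<bar>1/2\<bar> * (\<Sum>a<k. (1 + 2 ^ n) * (l * M) * (l * M)))
       \<le> (20 * real n) ^ n * 2 ^ n * ((1 + k * (1 + 2 ^ n)) * E^2)"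
      by (intro mult_left_mono KE) simp
    then show "(20 * real n) ^ n * (2 ^ n * (D0 + \<bar>1/2\<bar> * (\<Sum>a<k. (1 + 2 ^ n) * (l * M) * (l * M)))) \<le> Z * E^2"
      by (simp only: Z_def mult.assoc)
  qed (use l Z1 in auto)
  have vks: "vk k Fv Fw i j = vk k Fv Fw j i" for i j
    by (rule ext) (simp add: vk_def mult.commute add.commute)
  have s: "F0 i j = F0 j i" for i j
    unfolding F0_def FA(2)[of i j] vks[of i j] by (simp add: mult.commute)
  have z: "F0 i j x = 0" if "R0 + 2 \<le> norm x" for i j x
  proof -
    interpret corrugation_data k "closed_nbhd \<omega> l" "R0 + 2" l 1 E G 0 n Z v0 w0 H0 ch by (rule data) simp
    show ?thesis using chi_zero[OF that] by (simp add: F0_def)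
  qed
  show ?thesis unfolding start_defect_def using b s z by blast
qed

text \<open>Mollification commutes with the linear part of the strain. The quadratic part leaves
  exactly the commutators collected in \<open>F0\<close>, and the cutoff is 1 on the
  l-neighbourhood.\<close>

lemma defect_split:
  assumes x: "x \<in> closed_nbhd \<omega> l"
  shows "FA i j x - vk k v0 w0 i j x = (FA i j x - P (FA i j) x) + F0 i j x"
proof -
  let ?s = "\<lambda>x. \<Sum>a<k. pd i (Fv a) x * pd j (Fv a) x"
  let ?t = "\<lambda>x. 1 * pd i (Fw j) x + 1 * pd j (Fw i) x"
  have sc: "continuous_on UNIV ?s" by (intro continuous_intros pdF_cont) auto
  have tc: "continuous_on UNIV ?t" by (intro continuous_intros pdF_cont)
  have "(\<lambda>x. FA i j x - vk k Fv Fw i j x) = (\<lambda>x. 1 * FA i j x + 1 * ((- 1/2) * ?s x + (- 1/2) * ?t x))"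
    by (auto simp: vk_def fun_eq_iff)
  then have "P (\<lambda>x. FA i j x - vk k Fv Fw i j x) = P (\<lambda>x. 1 * FA i j x + 1 * ((- 1/2) * ?s x + (- 1/2) * ?t x))" by simp
  also have "\<dots> = (\<lambda>x. 1 * P (FA i j) x + 1 * P (\<lambda>x. (- 1/2) * ?s x + (- 1/2) * ?t x) x)"
    by (rule mol_pow_lin[OF FA(1)]) (intro continuous_intros sc tc)
  also have "P (\<lambda>x. (- 1/2) * ?s x + (- 1/2) * ?t x) = (\<lambda>x. (- 1/2) * P ?s x + (- 1/2) * P ?t x)"
    by (rule mol_pow_lin[OF sc tc])
  also have "P ?s = (\<lambda>x. \<Sum>a<k. P (\<lambda>x. pd i (Fv a) x * pd j (Fv a) x) x)"
    by (rule mol_pow_sum) (auto intro!: continuous_intros pdF_cont)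
  also have "P ?t = (\<lambda>x. 1 * P (pd i (Fw j)) x + 1 * P (pd j (Fw i)) x)"
    by (rule mol_pow_lin[OF pdF_cont(2) pdF_cont(2)])
  finally have 1: "P (\<lambda>x. FA i j x - vk k Fv Fw i j x) x = P (FA i j) x
      - (\<Sum>a<k. P (\<lambda>x. pd i (Fv a) x * pd j (Fv a) x) x) / 2 - (P (pd i (Fw j)) x + P (pd j (Fw i)) x) / 2"
    by simp
  have "(\<Sum>a<k. pd i (v0 a) x * pd j (v0 a) x) = (\<Sum>a<k. P (pd i (Fv a)) x * P (pd j (Fv a)) x)"
    by (intro sum.cong) (auto simp: pd_v0)
  then have 2: "vk k v0 w0 i j x = (\<Sum>a<k. P (pd i (Fv a)) x * P (pd j (Fv a)) x) / 2 + (P (pd i (Fw j)) x + P (pd j (Fw i)) x) / 2"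
    by (simp add: vk_def pd_w0)
  show ?thesis
    unfolding F0_def ch_one[OF x] 1 2 sum_subtractf by (simp add: field_simps)
qed

lemma FA_err:
  assumes b: "0 < \<beta>" and e: "\<And>y t. d y \<le> 1.1 * l \<Longrightarrow> \<bar>t\<bar> \<le> h \<Longrightarrow>
      \<forall>i'. \<bar>FA i j (y + t *\<^sub>R axis i' 1) + FA i j (y - t *\<^sub>R axis i' 1) - 2 * FA i j y\<bar> \<le> 2 * (H * h powr \<beta>)"
    and H: "0 \<le> H" and x: "x \<in> closed_nbhd \<omega> l"
  shows "\<bar>FA i j x - P (FA i j) x\<bar> \<le> 2 * real n * (H * l powr \<beta>)"
proof -
  have "\<bar>P (FA i j) x - FA i j x\<bar> \<le> 2 * real n * (H * h powr \<beta>)"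
  proof (rule mol_pow_err[OF FA(1) h0, of "{y. d y \<le> 1.1 * l}"])
    fix y i' assume "y \<in> {y. d y \<le> 1.1 * l}"
    then show "\<bar>av (\<lambda>_. 1) i' (- h) (2 * h) (FA i j) y - FA i j y\<bar> \<le> H * h powr \<beta>"
      using e by (intro av_err[OF FA(1) h0]) auto
  next
    show "cball x (2 * h * n) \<subseteq> {y. d y \<le> 1.1 * l}"
    proof
      fix y assume "y \<in> cball x (2 * h * n)"
      then show "y \<in> {y. d y \<le> 1.1 * l}" using x d_tri[of y x] unfolding K reach by simp
    qed
  qed
  also have "\<dots> \<le> 2 * real n * (H * l powr \<beta>)"
    using H h0 hl b l by (intro mult_left_mono powr_mono2) auto
  finally show ?thesis by (simp add: abs_minus_commute)
qed

end

section \<open>From norms on neighbourhoods to pointwise bounds for extensions\<close>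

lemma pderivs_1: "pderivs UNIV [i] f = pd i f"
  by (metis pderivs.simps(1) pderivs_UNIV)

lemma pderivs_2: "pderivs UNIV [i, j] f = pd i (pd j f)"
  by (metis pderivs_1 pderivs_UNIV)

lemma defect_entries:
  assumes r: "0 < r" and v: "\<And>a. a < k \<Longrightarrow> bd {} 1 0 0 (Fv a)" "\<And>a x. a < k \<Longrightarrow> x \<in> closed_nbhd \<omega> r \<Longrightarrow> Fv a x = v a x"
    and w: "\<And>j. bd {} 1 0 0 (Fw j)" "\<And>j x. x \<in> closed_nbhd \<omega> r \<Longrightarrow> Fw j x = w x $ j"
    and A: "FA i j x = A x $ i $ j" and x: "x \<in> closed_nbhd \<omega> r"
  shows "entries (defect k (closed_nbhd \<omega> r) v w A) (i, j) x = FA i j x - vk k Fv Fw i j x"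
proof -
  let ?K = "closed_nbhd \<omega> r"
  have pv: "pderivs ?K [i] (v a) x = pd i (Fv a) x" if "a < k" for i a
  proof -
    have "pderivs ?K [i] (v a) x = pderivs UNIV [i] (Fv a) x"
      by (rule pderivs_nbhd[OF r v(1)[OF that] v(2)[OF that] _ x]) auto
    then show ?thesis by (simp only: pderivs_1)
  qed
  have pw: "pderivs ?K [i] (comps w j) x = pd i (Fw j) x" for i j
  proof -
    have "pderivs ?K [i] (comps w j) x = pderivs UNIV [i] (Fw j) x"
      by (rule pderivs_nbhd[OF r w(1) _ _ x]) (auto simp: comps_def w(2))
    then show ?thesis by (simp only: pderivs_1)
  qed
  have "(\<Sum>a<k. pderivs ?K [i] (v a) x * pderivs ?K [j] (v a) x) = (\<Sum>a<k. pd i (Fv a) x * pd j (Fv a) x)"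
    by (intro sum.cong refl) (simp only: pv lessThan_iff)
  then show ?thesis
    unfolding entries_def defect_def sym_grad_def
    by (simp only: prod.case vector_minus_component vector_add_component vector_scaleR_component
        gram_def grad_def transpose_def vec_lambda_beta pw vk_def A) simp
qed

lemma C_norm_simps:
  "C_norm 0 K I f = sup_nabla 0 K I f"
  "C_norm 1 K I f = sup_nabla 0 K I f + sup_nabla 1 K I f"
  "C_norm 2 K I f = sup_nabla 0 K I f + sup_nabla 1 K I f + sup_nabla 2 K I f"
  by (simp_all add: C_norm_def eval_nat_numeral)

lemma pderivs_cases:
  assumes "length js = j"
  shows "j = 0 \<Longrightarrow> pderivs UNIV js f = f" "j = 1 \<Longrightarrow> \<exists>i. pderivs UNIV js f = pd i f"
    "j = 2 \<Longrightarrow> \<exists>i i'. pderivs UNIV js f = pd i (pd i' f)"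
proof -
  show "j = 0 \<Longrightarrow> pderivs UNIV js f = f" using assms by simp
  show "\<exists>i. pderivs UNIV js f = pd i f" if "j = 1"
  proof -
    from assms that obtain i where "js = [i]" by (auto simp: length_Suc_conv)
    then show ?thesis using pderivs_1 pderivs_2 by blast
  qed
  show "\<exists>i i'. pderivs UNIV js f = pd i (pd i' f)" if "j = 2"
  proof -
    from assms that obtain i i' where "js = [i, i']" by (auto simp: length_Suc_conv eval_nat_numeral)
    then show ?thesis using pderivs_1 pderivs_2 by blast
  qed
qed

lemma sup_nabla_ge_pd:
  assumes r: "0 < r" and I: "finite I" and om: "bounded \<omega>"
    and F: "\<And>i. i \<in> I \<Longrightarrow> bd {} 2 0 0 (F i)" "\<And>i x. i \<in> I \<Longrightarrow> x \<in> closed_nbhd \<omega> r \<Longrightarrow> F i x = f i x"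
    and i: "i \<in> I" "x \<in> closed_nbhd \<omega> r"
  shows "\<bar>pd j (F i) x\<bar> \<le> sup_nabla 1 (closed_nbhd \<omega> r) I f"
    "\<bar>pd j (pd j' (F i)) x\<bar> \<le> sup_nabla 2 (closed_nbhd \<omega> r) I f"
proof -
  have F1: "bd {} 1 0 0 (F i)" if "i \<in> I" for i using bd_le[OF F(1)[OF that], of 1] by simp
  have "\<bar>pderivs UNIV [j] (F i) x\<bar> \<le> sup_nabla 1 (closed_nbhd \<omega> r) I f"
    by (rule sup_nabla_ge[OF r I om F1 F(2) i(1) _ i(2)]) auto
  then show "\<bar>pd j (F i) x\<bar> \<le> sup_nabla 1 (closed_nbhd \<omega> r) I f" by (simp only: pderivs_1)
  have "\<bar>pderivs UNIV [j, j'] (F i) x\<bar> \<le> sup_nabla 2 (closed_nbhd \<omega> r) I f"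
    by (rule sup_nabla_ge[OF r I om F i(1) _ i(2)]) auto
  then show "\<bar>pd j (pd j' (F i)) x\<bar> \<le> sup_nabla 2 (closed_nbhd \<omega> r) I f" by (simp only: pderivs_2)
qed

lemma C_on_choice:
  assumes "C_on m S I f"
  obtains F where "\<And>i. i \<in> I \<Longrightarrow> bd {} m 0 0 (F i)" "\<And>i x. i \<in> I \<Longrightarrow> x \<in> S \<Longrightarrow> F i x = f i x"
proof -
  have "\<forall>i\<in>I. \<exists>F. bd {} m 0 0 F \<and> (\<forall>x\<in>S. F x = f i x)"
    using assms unfolding C_on_def C_diff_iff_bd .
  then obtain F where "\<forall>i\<in>I. bd {} m 0 0 (F i) \<and> (\<forall>x\<in>S. F i x = f i x)" by (rule bchoice[THEN exE])
  then show ?thesis using that by blast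
qed

lemma C0_Hoelder_on_eq:
  "C0_Hoelder_on \<beta> S I f \<longleftrightarrow> C_Hoelder_on (if \<beta> \<le> 1 then 0 else 1) (if \<beta> \<le> 1 then \<beta> else \<beta> - 1) S I f"
  by (cases "\<beta> \<le> 1") (simp_all add: C0_Hoelder_on_def)

text \<open>Extensions chosen entry by entry may differ off the diagonal outside \<open>S\<close>.
  Using the extension of entry (1, 2) for (2, 1) as well makes them symmetric on the plane, as
  \<open>start_defect\<close> requires.\<close>

lemma C0_Hoelder_choice:
  assumes A: "C0_Hoelder_on \<beta> S UNIV (entries A)" and sym: "\<And>x. x \<in> S \<Longrightarrow> transpose (A x) = A x"
  obtains F :: "2 \<times> 2 \<Rightarrow> real^2 \<Rightarrow> real" where
    "\<And>p. C_Hoelder (if \<beta> \<le> 1 then 0 else 1) (if \<beta> \<le> 1 then \<beta> else \<beta> - 1) (F p)"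
    "\<And>p x. x \<in> S \<Longrightarrow> F p x = entries A p x" "\<And>i j. F (i, j) = F (j, i)"
proof -
  define m where "m = (if \<beta> \<le> 1 then 0 else 1 :: nat)"
  define \<alpha> where "\<alpha> = (if \<beta> \<le> 1 then \<beta> else \<beta> - 1)"
  have H: "C_Hoelder_on m \<alpha> S UNIV (entries A)" using A unfolding C0_Hoelder_on_eq m_def \<alpha>_def .
  have "\<forall>p. \<exists>F. C_Hoelder m \<alpha> F \<and> (\<forall>x\<in>S. F x = entries A p x)"
    using H unfolding C_Hoelder_on_def by simp
  from choice[OF this] obtain F where F0: "\<forall>p. C_Hoelder m \<alpha> (F p) \<and> (\<forall>x\<in>S. F p x = entries A p x)" ..
  have F: "C_Hoelder m \<alpha> (F p)" "x \<in> S \<Longrightarrow> F p x = entries A p x" for p x using spec[OF F0, of p] by blast+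
  define F' where "F' p = (if p = (2, 1) then F (1, 2) else F p)" for p
  have tr: "entries A (2, 1) x = entries A (1, 2) x" if x: "x \<in> S" for x
  proof -
    have "transpose (A x) $ 1 $ 2 = A x $ 1 $ 2" by (simp only: sym[OF x])
    then show ?thesis by (simp add: entries_def transpose_def)
  qed
  have 1: "F' p x = entries A p x" if x: "x \<in> S" for p x
    by (cases "p = (2, 1)") (simp_all add: F'_def F(2)[OF x] tr[OF x])
  have 2: "F' (i, j) = F' (j, i)" for i j
    using exhaust_2[of i] exhaust_2[of j] unfolding F'_def by (elim disjE) simp_all
  have 3: "C_Hoelder m \<alpha> (F' p)" for p unfolding F'_def using F(1) by (cases "p = (2, 1)") simp_all
  show ?thesis by (rule that[OF 3[unfolded m_def \<alpha>_def] 1 2])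
qed

lemma C_Hoelder_cont: "C_Hoelder m \<alpha> f \<Longrightarrow> continuous_on UNIV f"
  unfolding C_Hoelder_def C_diff_iff_bd using bd_cont by blast

lemma C0_Hoelder_norm_nonneg:
  assumes r: "0 < r" and om: "bounded \<omega>" "\<omega> \<noteq> {}" and b: "0 < \<beta>"
    and F: "\<And>p. C_Hoelder (if \<beta> \<le> 1 then 0 else 1) (if \<beta> \<le> 1 then \<beta> else \<beta> - 1) (F p)"
      "\<And>p x. x \<in> closed_nbhd \<omega> r \<Longrightarrow> F p x = entries A p x"
  defines "m \<equiv> if \<beta> \<le> 1 then 0 else 1 :: nat" and "\<alpha> \<equiv> if \<beta> \<le> 1 then \<beta> else \<beta> - 1"
  shows "0 \<le> C0_Hoelder_norm \<beta> (closed_nbhd \<omega> r) UNIV (entries A)"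
    and "Hoelder_seminorm m \<alpha> (closed_nbhd \<omega> r) UNIV (entries A) \<le> C0_Hoelder_norm \<beta> (closed_nbhd \<omega> r) UNIV (entries A)"
proof -
  let ?K = "closed_nbhd \<omega> r"
  have H: "C_Hoelder m \<alpha> (F p)" for p using F(1) by (simp add: m_def \<alpha>_def)
  have bF: "bd {} j 0 0 (F p)" if "j \<le> m" for p j
    using bd_le[OF _ that] H[of p] unfolding C_Hoelder_def C_diff_iff_bd by blast
  have al: "0 < \<alpha>" using b by (simp add: \<alpha>_def)
  have "0 \<le> sup_nabla j ?K UNIV (entries A)" if "j \<le> m" for j
    by (rule sup_nabla_nonneg[OF r _ _ om bF[OF that] F(2)]) auto
  then have C: "0 \<le> C_norm m ?K UNIV (entries A)" unfolding C_norm_def by (intro sum_nonneg) auto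
  have N: "C0_Hoelder_norm \<beta> ?K UNIV (entries A) = C_norm m ?K UNIV (entries A) + Hoelder_seminorm m \<alpha> ?K UNIV (entries A)"
    by (simp add: C0_Hoelder_norm_def Hoelder_norm_def m_def \<alpha>_def)
  show "Hoelder_seminorm m \<alpha> ?K UNIV (entries A) \<le> C0_Hoelder_norm \<beta> ?K UNIV (entries A)"
    using C N by simp
  \<comment> \<open>The seminorm is a supremum over pairs of distinct points; one such pair, with
    its nonnegative quotient, gives the sign.\<close>
  obtain z where "z \<in> \<omega>" using om by blast
  then have z: "z \<in> ?K" "z + r *\<^sub>R axis 1 1 \<in> ?K"
    unfolding in_closed_nbhd using r closure_subset by (auto intro!: bexI[of _ z] simp: dist_norm)
  have "0 \<le> Hoelder_seminorm m \<alpha> ?K UNIV (entries A) * dist z (z + r *\<^sub>R axis 1 1) powr \<alpha>"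
    by (rule order_trans[OF abs_ge_zero Hoelder_seminorm_ge[OF r _ al H F(2) _ _ z, where js = "replicate m 1"]]) auto
  moreover have "0 < dist z (z + r *\<^sub>R axis 1 1) powr \<alpha>" using r by (simp add: dist_norm)
  ultimately have "0 \<le> Hoelder_seminorm m \<alpha> ?K UNIV (entries A)" by (simp add: zero_le_mult_iff)
  then show "0 \<le> C0_Hoelder_norm \<beta> ?K UNIV (entries A)" using C N by simp
qed

text \<open>For \<open>\<beta> \<le> 1\<close> two first differences suffice. For
  \<open>\<beta> > 1\<close> the Hoelder bound of exponent \<open>\<beta> - 1\<close> on the
  gradient enters through \<open>second_difference\<close>. Both cases end in the same power of
  \<open>h\<close>.\<close>

lemma Hoelder_second_difference:
  assumes r: "0 < r" and om: "bounded \<omega>" "\<omega> \<noteq> {}" and b: "0 < \<beta>" "\<beta> < 2"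
    and F: "\<And>p. C_Hoelder (if \<beta> \<le> 1 then 0 else 1) (if \<beta> \<le> 1 then \<beta> else \<beta> - 1) (F p)"
      "\<And>p x. x \<in> closed_nbhd \<omega> r \<Longrightarrow> F p x = entries A p x"
    and h: "0 < h" "\<bar>t\<bar> \<le> h" and y: "cball y h \<subseteq> closed_nbhd \<omega> r"
  shows "\<bar>F p (y + t *\<^sub>R axis i 1) + F p (y - t *\<^sub>R axis i 1) - 2 * F p y\<bar>
    \<le> 2 * (C0_Hoelder_norm \<beta> (closed_nbhd \<omega> r) UNIV (entries A) * h powr \<beta>)"
proof -
  let ?H = "C0_Hoelder_norm \<beta> (closed_nbhd \<omega> r) UNIV (entries A)"
  note nn = C0_Hoelder_norm_nonneg[OF r om b(1) F]
  have yK: "x \<in> closed_nbhd \<omega> r" if "dist y x \<le> h" for x using y that by auto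
  show ?thesis
  proof (cases "\<beta> \<le> 1")
    case True
    have C: "C_Hoelder 0 \<beta> (F p)" for p using F(1) True by simp
    have "\<bar>F p x - F p y\<bar> \<le> ?H * h powr \<beta>" if x: "dist y x \<le> h" for x
    proof -
      have "\<bar>pderivs UNIV [] (F p) x - pderivs UNIV [] (F p) y\<bar>
          \<le> Hoelder_seminorm 0 \<beta> (closed_nbhd \<omega> r) UNIV (entries A) * dist x y powr \<beta>"
        by (rule Hoelder_seminorm_ge[OF r _ b(1) C F(2)]) (use yK[OF x] yK[of y] h(1) in auto)
      then have "\<bar>F p x - F p y\<bar> \<le> Hoelder_seminorm 0 \<beta> (closed_nbhd \<omega> r) UNIV (entries A) * dist x y powr \<beta>"
        by simp
      also have "\<dots> \<le> ?H * h powr \<beta>"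
        using nn True x b h(1) by (intro mult_mono powr_mono2) (auto simp: dist_commute)
      finally show ?thesis .
    qed
    from this[of "y + t *\<^sub>R axis i 1"] this[of "y - t *\<^sub>R axis i 1"] show ?thesis using h by (simp add: dist_norm)
  next
    case False
    have C: "C_Hoelder 1 (\<beta> - 1) (F p)" for p using F(1) False by simp
    have d: "F p differentiable (at z)" for z
      using C[of p] unfolding C_Hoelder_def C_diff_iff_bd by simp
    have "\<bar>F p (y + t *\<^sub>R axis i 1) + F p (y - t *\<^sub>R axis i 1) - 2 * F p y\<bar> \<le> 2 * (?H * h powr (1 + (\<beta> - 1)))"
    proof (rule second_difference[OF d nn(1) _ _ h])
      fix a b' assume ab: "dist y a \<le> h" "dist y b' \<le> h"
      have "\<bar>pderivs UNIV [i] (F p) a - pderivs UNIV [i] (F p) b'\<bar>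
          \<le> Hoelder_seminorm 1 (\<beta> - 1) (closed_nbhd \<omega> r) UNIV (entries A) * dist a b' powr (\<beta> - 1)"
        by (rule Hoelder_seminorm_ge[OF r _ _ C F(2)]) (use yK[OF ab(1)] yK[OF ab(2)] False in auto)
      then have "\<bar>pd i (F p) a - pd i (F p) b'\<bar> \<le> Hoelder_seminorm 1 (\<beta> - 1) (closed_nbhd \<omega> r) UNIV (entries A) * dist a b' powr (\<beta> - 1)"
        by (simp only: pderivs_1)
      also have "\<dots> \<le> ?H * dist a b' powr (\<beta> - 1)"
        using nn(2) False by (intro mult_right_mono) auto
      finally show "\<bar>pd i (F p) a - pd i (F p) b'\<bar> \<le> ?H * dist a b' powr (\<beta> - 1)" .
    qed (use False b in auto)
    then show ?thesis by simp
  qed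
qed

lemma C_norm_1_le:
  fixes b :: real
  assumes r: "0 < r" and I: "finite I" and om: "\<omega> \<noteq> {}"
    and F: "\<And>i. i \<in> I \<Longrightarrow> bd {} 2 0 0 (F i)" "\<And>i x. i \<in> I \<Longrightarrow> x \<in> closed_nbhd \<omega> r \<Longrightarrow> F i x = f i x"
    and b: "\<And>i x. i \<in> I \<Longrightarrow> x \<in> closed_nbhd \<omega> r \<Longrightarrow> \<bar>F i x\<bar> \<le> b"
      "\<And>i j x. i \<in> I \<Longrightarrow> x \<in> closed_nbhd \<omega> r \<Longrightarrow> \<bar>pd j (F i) x\<bar> \<le> b"
  shows "C_norm 1 (closed_nbhd \<omega> r) I f \<le> 3 * card I * b"
proof -
  have F': "bd {} j 0 0 (F i)" if "i \<in> I" "j \<le> 2" for i j using bd_le[OF F(1)[OF that(1)] that(2)] .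
  have "sup_nabla 0 (closed_nbhd \<omega> r) I f \<le> real (card I) * 2 ^ 0 * b"
    by (rule sup_nabla_le[OF r I om F' F(2)]) (use b(1) in auto)
  moreover have "sup_nabla 1 (closed_nbhd \<omega> r) I f \<le> real (card I) * 2 ^ 1 * b"
  proof (rule sup_nabla_le[OF r I om F' F(2)])
    fix i and js :: "2 list" and x assume a: "i \<in> I" "length js = (1::nat)" "x \<in> closed_nbhd \<omega> r"
    obtain j where "pderivs UNIV js (F i) = pd j (F i)" using pderivs_cases(2)[OF a(2) refl] by blast
    then show "\<bar>pderivs UNIV js (F i) x\<bar> \<le> b" using b(2)[OF a(1,3)] by simp
  qed auto
  ultimately show ?thesis unfolding C_norm_simps by (simp only: power_0 power_one_right mult_1_right)
qed

lemma sup_nabla_2_le: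
  fixes b :: real
  assumes r: "0 < r" and I: "finite I" and om: "\<omega> \<noteq> {}"
    and F: "\<And>i. i \<in> I \<Longrightarrow> bd {} 2 0 0 (F i)" "\<And>i x. i \<in> I \<Longrightarrow> x \<in> closed_nbhd \<omega> r \<Longrightarrow> F i x = f i x"
    and b: "\<And>i j j' x. i \<in> I \<Longrightarrow> x \<in> closed_nbhd \<omega> r \<Longrightarrow> \<bar>pd j (pd j' (F i)) x\<bar> \<le> b"
  shows "sup_nabla 2 (closed_nbhd \<omega> r) I f \<le> 4 * card I * b"
proof -
  have "sup_nabla 2 (closed_nbhd \<omega> r) I f \<le> real (card I) * 2 ^ 2 * b"
  proof (rule sup_nabla_le[OF r I om F(1) F(2)])
    fix i and js :: "2 list" and x assume a: "i \<in> I" "length js = (2::nat)" "x \<in> closed_nbhd \<omega> r"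
    obtain j j' where "pderivs UNIV js (F i) = pd j (pd j' (F i))" using pderivs_cases(3)[OF a(2) refl] by blast
    then show "\<bar>pderivs UNIV js (F i) x\<bar> \<le> b" using b[OF a(1,3)] by simp
  qed auto
  then show ?thesis by simp
qed

lemma vk_continuous:
  assumes "\<And>a. a < k \<Longrightarrow> bd {} 1 0 0 (v a)" "\<And>j. bd {} 1 0 0 (w j)"
  shows "continuous_on UNIV (vk k v w i j)"
proof -
  have "continuous_on UNIV (pd i (v a))" if "a < k" for i a using assms(1)[OF that] by simp
  moreover have "continuous_on UNIV (pd i (w j))" for i j using assms(2) by simp
  ultimately show ?thesis unfolding vk_def[abs_def] by (intro continuous_intros) auto
qed

text \<open>In the lower bound for \<open>C\<close>, the multiple of \<open>C0\<close> covers the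
  corrugation bounds times the numbers of entries in the norms, namely 6k, 12, 8k, 16 and 8. The
  term 8n is the mollification error 2n of each of the four entries of \<open>A\<close>. The
  iteration result is a premise with \<open>C0\<close> already fixed, which makes \<open>C\<close>
  uniform in the data.\<close>

lemma stage_estimate:
  fixes \<omega> :: "(real^2) set" and v :: "nat \<Rightarrow> real^2 \<Rightarrow> real" and w :: "real^2 \<Rightarrow> real^2" and A :: "real^2 \<Rightarrow> real^2^2" and M :: real
  assumes R0: "0 \<le> R0" "\<omega> \<subseteq> cball 0 R0" and ne: "\<omega> \<noteq> {}" and k: "1 \<le> k"
    and SJ: "2 * S = k * J" and g: "0 < \<gamma>" and n: "n = 3 * S + 1"
    and Z: "Z = (20 * real n) ^ n * 2 ^ n * (1 + k * (1 + 2 ^ n))" and C0: "1 \<le> C0"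
    and stages: "\<And>X l E G v0 w0 H0 ch F0 lam.
      corrugation_data k X (R0 + 2) l (sqrt (lam * l)) E G n Z v0 w0 H0 ch \<Longrightarrow>
      start_defect n (R0 + 2) (Z * E^2) l F0 \<Longrightarrow> 1 / l < lam \<Longrightarrow>
      \<exists>V W F. corrugation_data.stage k X (R0 + 2) l (sqrt (lam * l)) E G J v0 w0 F0 1 (C0 * lam powr (\<gamma> / 2)) S V W F"
    and C: "24 * (real k + 1) * C0 + 8 * real n \<le> C"
    and l: "0 < l" "l \<le> 1" and b: "0 < \<beta>" "\<beta> < 2" and lam: "1 / l < lam"
  defines "K2 \<equiv> closed_nbhd \<omega> (2 * l)" and "K1 \<equiv> closed_nbhd \<omega> l"
  defines "D0 \<equiv> C_norm 0 K2 UNIV (entries (defect k K2 v w A))"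
  defines "E \<equiv> sqrt D0 + l * M"
  assumes hv: "C_on 2 K2 {..<k} v" and hw: "C_on 2 K2 UNIV (comps w)" and hA: "C0_Hoelder_on \<beta> K2 UNIV (entries A)"
    and sym: "\<And>x. x \<in> K2 \<Longrightarrow> transpose (A x) = A x"
    and M: "C_norm 2 K2 {..<k} v \<le> M" "C_norm 2 K2 UNIV (comps w) \<le> M" "1 \<le> M"
  shows "\<exists>(v' :: nat \<Rightarrow> real^2 \<Rightarrow> real) (w' :: real^2 \<Rightarrow> real^2).
              C_on 2 K1 {..<k} v' \<and>
              C_on 2 K1 UNIV (comps w') \<and>
              C_norm 1 K1 {..<k} (\<lambda>a x. v' a x - v a x) \<le> C * lam powr (\<gamma> / 2) * E \<and>
              C_norm 1 K1 UNIV (comps (\<lambda>x. w' x - w x))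
                \<le> C * lam powr \<gamma> * E * (1 + E + sup_nabla 1 K2 {..<k} v) \<and>
              sup_nabla 2 K1 {..<k} v' \<le> C * ((lam * l) ^ J / l) * lam powr (\<gamma> / 2) * E \<and>
              sup_nabla 2 K1 UNIV (comps w')
                \<le> C * ((lam * l) ^ J / l) * lam powr \<gamma> * E * (1 + E + sup_nabla 1 K2 {..<k} v) \<and>
              C_norm 0 K1 UNIV (entries (defect k K1 v' w' A))
                \<le> C * (l powr \<beta> * C0_Hoelder_norm \<beta> K2 UNIV (entries A)
                       + 1 / (lam * l) ^ S * lam powr \<gamma> * (D0 + (l * M)\<^sup>2))"
proof -
  have om: "bounded \<omega>" using R0(2) bounded_subset bounded_cball by blast
  have l2: "0 < 2 * l" using l by simp
  define G where "G = sup_nabla 1 K2 {..<k} v"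
  define H where "H = C0_Hoelder_norm \<beta> K2 UNIV (entries A)"
  obtain Fv where Fv: "\<And>a. a < k \<Longrightarrow> bd {} 2 0 0 (Fv a)" "\<And>a x. a < k \<Longrightarrow> x \<in> K2 \<Longrightarrow> Fv a x = v a x"
    using C_on_choice[OF hv] by auto
  obtain Fw where Fw: "\<And>j. bd {} 2 0 0 (Fw j)" "\<And>j x. x \<in> K2 \<Longrightarrow> Fw j x = comps w j x"
    using C_on_choice[OF hw] by auto
  obtain FA :: "2 \<times> 2 \<Rightarrow> real^2 \<Rightarrow> real" where
    FA: "\<And>p. C_Hoelder (if \<beta> \<le> 1 then 0 else 1) (if \<beta> \<le> 1 then \<beta> else \<beta> - 1) (FA p)"
      "\<And>p x. x \<in> K2 \<Longrightarrow> FA p x = entries A p x" "\<And>i j. FA (i, j) = FA (j, i)"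
    using C0_Hoelder_choice[OF hA sym] by blast
  have Fv': "bd {} 2 0 0 (Fv a)" "x \<in> closed_nbhd \<omega> (2 * l) \<Longrightarrow> Fv a x = v a x" if "a \<in> {..<k}" for a x
    using Fv that by (simp_all add: K2_def)
  have Fv1: "bd {} 1 0 0 (Fv a)" if "a < k" for a by (rule bd_le[OF Fv(1)[OF that]]) simp
  have Fw1: "bd {} 1 0 0 (Fw j)" for j by (rule bd_le[OF Fw(1)]) simp
  have FAc: "continuous_on UNIV (FA p)" for p by (rule C_Hoelder_cont[OF FA(1)])
  have vkc: "continuous_on UNIV (vk k Fv Fw i j)" for i j by (rule vk_continuous[OF Fv1 Fw1])
  have D_eq: "entries (defect k K2 v w A) (i, j) x = FA (i, j) x - vk k Fv Fw i j x" if "x \<in> K2" for i j x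
    unfolding K2_def
    by (rule defect_entries[OF l2, where FA = "\<lambda>i j. FA (i, j)"])
      (use Fv1 Fv(2) Fw1 Fw(2) FA(2) that in \<open>auto simp: K2_def comps_def entries_def\<close>)
  have Dc: "bd {} 0 0 0 ((\<lambda>(i, j) x. FA (i, j) x - vk k Fv Fw i j x) p)" for p
    by (cases p) (auto intro!: continuous_intros FAc vkc)
  have D_b: "\<bar>FA (i, j) x - vk k Fv Fw i j x\<bar> \<le> D0" if "x \<in> K2" for i j x
  proof -
    have e: "((\<lambda>(i, j) x. FA (i, j) x - vk k Fv Fw i j x) p) y = entries (defect k K2 v w A) p y" if "y \<in> closed_nbhd \<omega> (2 * l)" for p y
      using D_eq[of y "fst p" "snd p"] that by (cases p) (simp add: K2_def)
    have "\<bar>pderivs UNIV [] ((\<lambda>(i, j) x. FA (i, j) x - vk k Fv Fw i j x) (i, j)) x\<bar> \<le> sup_nabla 0 K2 UNIV (entries (defect k K2 v w A))"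
      unfolding K2_def by (rule sup_nabla_ge[OF l2 _ om Dc e[unfolded K2_def]]) (use that in \<open>auto simp: K2_def\<close>)
    then show ?thesis unfolding D0_def C_norm_simps by simp
  qed
  obtain z0 where z0: "z0 \<in> K2"
  proof -
    obtain z where "z \<in> \<omega>" using ne by blast
    then have "z \<in> K2" unfolding K2_def in_closed_nbhd using l closure_subset by (auto intro!: bexI[of _ z])
    then show ?thesis using that by blast
  qed
  have D0n: "0 \<le> D0" using D_b[OF z0, of 1 1] by simp
  have I0: "{..<k} \<noteq> {}" using k by (auto simp: lessThan_empty_iff)
  have sv: "0 \<le> sup_nabla j K2 {..<k} v" "0 \<le> sup_nabla j K2 UNIV (comps w)" if "j \<le> 2" for j
    unfolding K2_def
    by (rule sup_nabla_nonneg[OF l2 _ I0 om ne bd_le[OF Fv'(1) that] Fv'(2)]; simp)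
      (rule sup_nabla_nonneg[OF l2 _ _ om ne bd_le[OF Fw(1) that] Fw(2)[unfolded K2_def]]; simp)
  have svM: "sup_nabla 1 K2 {..<k} v \<le> M" "sup_nabla 2 K2 {..<k} v \<le> M"
    "sup_nabla 1 K2 UNIV (comps w) \<le> M" "sup_nabla 2 K2 UNIV (comps w) \<le> M"
    using M(1,2) sv[of 0] sv[of 1] sv[of 2] unfolding C_norm_simps by auto
  have pv: "\<bar>pd j (Fv a) x\<bar> \<le> G" "\<bar>pd j (pd j' (Fv a)) x\<bar> \<le> M" if "a < k" "x \<in> K2" for a x j j'
  proof -
    have "\<bar>pd j (Fv a) x\<bar> \<le> sup_nabla 1 K2 {..<k} v" "\<bar>pd j (pd j' (Fv a)) x\<bar> \<le> sup_nabla 2 K2 {..<k} v"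
      unfolding K2_def by (rule sup_nabla_ge_pd[OF l2 _ om Fv']; use that in \<open>simp add: K2_def\<close>)+
    then show "\<bar>pd j (Fv a) x\<bar> \<le> G" "\<bar>pd j (pd j' (Fv a)) x\<bar> \<le> M" using svM unfolding G_def by linarith+
  qed
  have pw: "\<bar>pd j (Fw i) x\<bar> \<le> M" "\<bar>pd j (pd j' (Fw i)) x\<bar> \<le> M" if "x \<in> K2" for i x j j'
  proof -
    have "\<bar>pd j (Fw i) x\<bar> \<le> sup_nabla 1 K2 UNIV (comps w)" "\<bar>pd j (pd j' (Fw i)) x\<bar> \<le> sup_nabla 2 K2 UNIV (comps w)"
      unfolding K2_def by (rule sup_nabla_ge_pd[OF l2 _ om Fw(1) Fw(2)[unfolded K2_def]]; use that in \<open>simp add: K2_def\<close>)+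
    then show "\<bar>pd j (Fw i) x\<bar> \<le> M" "\<bar>pd j (pd j' (Fw i)) x\<bar> \<le> M" using svM by linarith+
  qed
  have GM: "G \<le> M" "0 \<le> G" using svM(1) sv(1)[of 1] by (auto simp: G_def)
  interpret m: mollification \<omega> R0 k n l M D0 G Fv Fw "\<lambda>i j. FA (i, j)"
    by standard (use R0 ne k n l M D0n GM Fv Fw FAc FA(3) pv pw D_b in \<open>auto simp: K2_def intro: order_trans[OF pv(1)[unfolded K2_def]]\<close>)
  have EE: "m.E = E" by (simp add: m.E_def E_def)
  have ZZ: "m.Z = Z" by (simp add: m.Z_def Z)
  define \<sigma> where "\<sigma> = sqrt (lam * l)"
  have laml: "1 < lam * l" using lam l by (simp add: field_simps)
  have lam1: "1 \<le> lam" using laml l lam by (smt (verit) le_divide_eq_1_pos)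
  have sg: "1 \<le> \<sigma>" using laml by (simp add: \<sigma>_def)
  have sg2: "\<sigma> ^ (2 * i) = (lam * l) ^ i" for i using laml by (simp add: \<sigma>_def power_mult)
  have dat: "corrugation_data k K1 (R0 + 2) l \<sigma> E G n Z m.v0 m.w0 m.H0 m.ch"
    using m.data[OF sg] unfolding EE ZZ K1_def .
  interpret c: corrugation_data k K1 "R0 + 2" l \<sigma> E G J n Z m.v0 m.w0 m.H0 m.ch by (rule dat)
  have std: "start_defect n (R0 + 2) (Z * E^2) l m.F0"
    using m.start unfolding EE ZZ .
  define B where "B = C0 * lam powr (\<gamma> / 2)"
  obtain V W F where st: "c.stage m.F0 1 B S V W F"
    using stages[OF dat[unfolded \<sigma>_def] std lam] unfolding B_def \<sigma>_def by blast
  \<comment> \<open>The bounds of the iteration are linear in \<open>B\<close> and so carry the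
    exponent \<gamma>/2. Where the claim has \<gamma> they are weakened, \<open>lam\<close> being at
    least 1.\<close>
  have lp: "1 \<le> lam powr (\<gamma> / 2)" "lam powr (\<gamma> / 2) \<le> lam powr \<gamma>"
    using lam1 g by (auto intro: ge_one_powr_ge_zero powr_mono)
  have B1: "1 \<le> B" unfolding B_def using mult_mono[OF C0 lp(1)] C0 by simp
  have E0: "0 < E" using c.E0 .
  from st have VW: "c.VW 1 B (2 * S) V W"
    and Fb: "\<And>i j x. \<bar>F i j x\<bar> \<le> B * (E / \<sigma> ^ S)^2"
    and id: "\<And>i j x. x \<in> K1 \<Longrightarrow> vk k m.v0 m.w0 i j x + m.F0 i j x
        = vk k (\<lambda>a x. m.v0 a x + V a x) (\<lambda>j x. m.w0 j x + W j x) i j x + F i j x"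
    unfolding c.stage_def using bd_bound[where U = UNIV] by blast+
  \<comment> \<open>After 2S = kJ cyclic steps no component has been used more than \<open>J\<close>
    times. This turns the growth of the Hessians into (lam l)^J.\<close>
  have us: "uses k (2 * S) a \<le> J" for a
  proof -
    have "2 * S + k - 1 - a \<le> k * J + (k - 1)" using SJ k by linarith
    then have "uses k (2 * S) a \<le> (k * J + (k - 1)) div k" unfolding uses_def by (rule div_le_mono)
    also have "\<dots> = J" by (rule div_nat_eqI) (use k in auto)
    finally show ?thesis .
  qed
  from VW have V: "\<And>a x. a < k \<Longrightarrow> V a differentiable (at x)" "\<And>a j x. a < k \<Longrightarrow> pd j (V a) differentiable (at x)"
    "\<And>a x. a < k \<Longrightarrow> \<bar>V a x\<bar> \<le> B * E" "\<And>a j x. a < k \<Longrightarrow> \<bar>pd j (V a) x\<bar> \<le> B * E"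
    "\<And>a j j'. a < k \<Longrightarrow> bd UNIV 1 (B * E * \<sigma> ^ (2 * uses k (2 * S) a) / l) (c.fr (2 * S)) (pd j (pd j' (V a)))"
    and W: "\<And>j. bd {} 2 0 0 (W j)" "\<And>j x. x \<in> K1 \<Longrightarrow> \<bar>W j x\<bar> \<le> B * E * (1 + E + G)"
    "\<And>j i x. x \<in> K1 \<Longrightarrow> \<bar>pd i (W j) x\<bar> \<le> B * E * (1 + E + G)"
    "\<And>j i i' x. x \<in> K1 \<Longrightarrow> \<bar>pd i' (pd i (W j)) x\<bar> \<le> B * E * (1 + E + G) * \<sigma> ^ (2 * J) / l"
    unfolding vw_bounds_def by blast+
  define L where "L = (lam * l) ^ J / l"
  have L1: "1 / l \<le> L" unfolding L_def using laml l by (intro divide_right_mono one_le_power) auto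
  have V2: "\<bar>pd j (pd j' (V a)) x\<bar> \<le> B * E * L" if "a < k" for a j j' x
  proof -
    have "\<bar>pd j (pd j' (V a)) x\<bar> \<le> B * E * \<sigma> ^ (2 * uses k (2 * S) a) / l" using bd_bound[OF V(5)[OF that]] by simp
    also have "\<dots> \<le> B * E * \<sigma> ^ (2 * J) / l"
      using B1 E0 l us sg by (intro divide_right_mono mult_left_mono power_increasing) auto
    finally show ?thesis by (simp add: sg2 L_def)
  qed
  have Vs: "bd {} 2 0 0 (V a)" if "a < k" for a by (rule bd_le[OF c.V_smooth[OF VW _ that]]) simp_all
  have v0s: "bd {} 2 0 0 (m.v0 a)" if "a < k" for a by (rule bd_le[OF c.v0_smooth[OF that]]) simp
  define v' where "v' a = (\<lambda>x. m.v0 a x + V a x)" for a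
  define w1 where "w1 j = (\<lambda>x. m.w0 j x + W j x)" for j
  define w' where "w' x = (\<chi> j. w1 j x)" for x
  have v's: "bd {} 2 0 0 (v' a)" if "a < k" for a
    unfolding v'_def using bd_add[OF v0s[OF that] Vs[OF that]] by simp
  have w1s: "bd {} 2 0 0 (w1 j)" for j
    unfolding w1_def using bd_add[OF c.w0_smooth W(1)] by simp
  have v's1: "bd {} 1 0 0 (v' a)" if "a < k" for a by (rule bd_le[OF v's[OF that]]) simp
  have w1s1: "bd {} 1 0 0 (w1 j)" for j by (rule bd_le[OF w1s]) simp
  have w'c: "comps w' = w1" by (simp add: comps_def w'_def fun_eq_iff)
  have K12: "x \<in> K2" if "x \<in> K1" for x
    using that l unfolding K1_def K2_def m.K by simp
  have df: "f differentiable (at x)" "pd i f differentiable (at x)" if "bd {} 2 0 0 f" for f i x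
    using that by (auto simp: numeral_2_eq_2)
  have lME: "l * M \<le> E" "M \<le> E / l" using m.E_facts(2,5) unfolding EE by auto
  have BE: "E \<le> B * E" using B1 E0 by simp
  have Y1: "1 \<le> 1 + E + G" using E0 GM by simp
  have EY: "E \<le> B * E * (1 + E + G)"
    using mult_mono[OF BE Y1] E0 B1 by simp
  \<comment> \<open>The Hessian of the mollified map is dominated by the corrugation bound, because
    M is at most E/l and \<open>L\<close> is at least 1/l.\<close>
  have Mle: "M \<le> B * E * L"
  proof -
    have "M \<le> E * (1 / l)" using lME by simp
    also have "\<dots> \<le> B * E * L" using BE L1 E0 l B1 by (intro mult_mono) auto
    finally show ?thesis .
  qed
  have L0: "0 \<le> L" using L1 l by (smt (verit) divide_nonneg_pos)
  have Cb: "c * C0 \<le> C" if "c \<le> 24 * (real k + 1)" for c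
  proof -
    have "c * C0 \<le> 24 * (real k + 1) * C0" using that C0 by (intro mult_right_mono) auto
    then show ?thesis using C by linarith
  qed
  have C_pos: "0 \<le> C" using Cb[of 0] by simp
  have "C_on 2 K1 {..<k} v'"
    unfolding C_on_def C_diff_iff_bd using v's by blast
  moreover have "C_on 2 K1 UNIV (comps w')"
    unfolding C_on_def C_diff_iff_bd w'c using w1s by blast
  moreover have "C_norm 1 K1 {..<k} (\<lambda>a x. v' a x - v a x) \<le> C * lam powr (\<gamma> / 2) * E"
  proof -
    have "C_norm 1 K1 {..<k} (\<lambda>a x. v' a x - v a x) \<le> 3 * card {..<k} * (2 * (B * E))"
      unfolding K1_def
    proof (rule C_norm_1_le[OF l(1) _ ne, where F = "\<lambda>a x. v' a x - Fv a x"])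
      fix a x assume a: "a \<in> {..<k}" and x: "x \<in> closed_nbhd \<omega> l"
      have ak: "a < k" using a by simp
      show "v' a x - Fv a x = v' a x - v a x" using Fv(2)[OF ak K12] x by (simp add: K1_def)
      have "\<bar>m.v0 a x - Fv a x\<bar> \<le> l * M"
        unfolding m.v0_def by (rule m.P_err[OF m.F_C1(1)[OF ak] m.v1[OF ak] x])
      then show "\<bar>v' a x - Fv a x\<bar> \<le> 2 * (B * E)"
        unfolding v'_def using V(3)[OF ak, of x] lME BE by linarith
      fix j
      have "\<bar>pd j (m.v0 a) x - pd j (Fv a) x\<bar> \<le> l * M"
        unfolding m.pd_v0(1)[OF ak] by (rule m.P_err[OF m.F_C1(3)[OF ak] m.v2[OF ak] x])
      moreover have "pd j (\<lambda>x. v' a x - Fv a x) x = pd j (m.v0 a) x + pd j (V a) x - pd j (Fv a) x"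
        unfolding v'_def using pd_diff[OF differentiable_add[OF df(1)[OF v0s[OF ak]] V(1)[OF ak]] df(1)[OF Fv(1)[OF ak]]]
          pd_add[OF df(1)[OF v0s[OF ak]] V(1)[OF ak]] by simp
      ultimately show "\<bar>pd j (\<lambda>x. v' a x - Fv a x) x\<bar> \<le> 2 * (B * E)"
        using V(4)[OF ak, of j x] lME BE by linarith
    next
      show "bd {} 2 0 0 (\<lambda>x. v' a x - Fv a x)" if "a \<in> {..<k}" for a
        using bd_minus[OF v's Fv(1)] that by simp
    qed simp
    also have "\<dots> = (6 * k * C0) * (lam powr (\<gamma> / 2) * E)" by (simp add: B_def)
    also have "\<dots> \<le> C * (lam powr (\<gamma> / 2) * E)"
      using Cb[of "6 * k"] E0 lp by (intro mult_right_mono) auto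
    finally show ?thesis by (simp add: mult.assoc)
  qed
  moreover have "C_norm 1 K1 UNIV (comps (\<lambda>x. w' x - w x)) \<le> C * lam powr \<gamma> * E * (1 + E + G)"
  proof -
    have "C_norm 1 K1 UNIV (comps (\<lambda>x. w' x - w x)) \<le> 3 * card (UNIV :: 2 set) * (2 * (B * E * (1 + E + G)))"
      unfolding K1_def
    proof (rule C_norm_1_le[OF l(1) _ ne, where F = "\<lambda>j x. w1 j x - Fw j x"])
      fix j x assume x: "x \<in> closed_nbhd \<omega> l"
      then have x1: "x \<in> K1" by (simp add: K1_def)
      show "w1 j x - Fw j x = comps (\<lambda>x. w' x - w x) j x"
        using Fw(2)[OF K12[OF x1], of j] by (simp add: comps_def w'_def)
      have "\<bar>m.w0 j x - Fw j x\<bar> \<le> l * M"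
        unfolding m.w0_def by (rule m.P_err[OF m.F_C1(2) m.w1 x])
      then show "\<bar>w1 j x - Fw j x\<bar> \<le> 2 * (B * E * (1 + E + G))"
        unfolding w1_def using W(2)[OF x1, of j] lME EY by linarith
      fix i
      have "\<bar>pd i (m.w0 j) x - pd i (Fw j) x\<bar> \<le> l * M"
        unfolding m.pd_w0(1) by (rule m.P_err[OF m.F_C1(4) m.w2 x])
      moreover have "pd i (\<lambda>x. w1 j x - Fw j x) x = pd i (m.w0 j) x + pd i (W j) x - pd i (Fw j) x"
        unfolding w1_def using pd_diff[OF differentiable_add[OF df(1)[OF c.w0_smooth] df(1)[OF W(1)]] df(1)[OF Fw(1)]]
          pd_add[OF df(1)[OF c.w0_smooth] df(1)[OF W(1)]] by simp
      ultimately show "\<bar>pd i (\<lambda>x. w1 j x - Fw j x) x\<bar> \<le> 2 * (B * E * (1 + E + G))"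
        using W(3)[OF x1, of i j] lME EY by linarith
    next
      show "bd {} 2 0 0 (\<lambda>x. w1 j x - Fw j x)" for j
        using bd_minus[OF w1s Fw(1)] by simp
    qed simp
    also have "\<dots> = (12 * C0) * (lam powr (\<gamma> / 2) * (E * (1 + E + G)))" by (simp add: B_def)
    also have "\<dots> \<le> C * (lam powr \<gamma> * (E * (1 + E + G)))"
      using Cb[of 12] C_pos E0 GM lp by (intro mult_mono mult_right_mono) auto
    finally show ?thesis by (simp add: mult.assoc)
  qed
  moreover have "sup_nabla 2 K1 {..<k} v' \<le> C * L * lam powr (\<gamma> / 2) * E"
  proof -
    have "sup_nabla 2 K1 {..<k} v' \<le> 4 * card {..<k} * (2 * (B * E * L))"
      unfolding K1_def
    proof (rule sup_nabla_2_le[OF l(1) _ ne, where F = v'])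
      fix a i j x assume a: "a \<in> {..<k}" and x: "x \<in> closed_nbhd \<omega> l"
      have ak: "a < k" using a by simp
      have p: "pd j (v' a) = (\<lambda>x. pd j (m.v0 a) x + pd j (V a) x)" for j
        unfolding v'_def by (rule ext) (rule pd_add[OF df(1)[OF v0s[OF ak]] V(1)[OF ak]])
      have "\<bar>pd i (pd j (m.v0 a)) x\<bar> \<le> M" using bd_bound[OF m.hess_bd[OF ak] m.X_Om[OF x]] .
      moreover have "pd i (pd j (v' a)) x = pd i (pd j (m.v0 a)) x + pd i (pd j (V a)) x"
        unfolding p by (rule pd_add[OF df(2)[OF v0s[OF ak]] V(2)[OF ak]])
      ultimately show "\<bar>pd i (pd j (v' a)) x\<bar> \<le> 2 * (B * E * L)"
        using V2[OF ak, of i j x] Mle by linarith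
    qed (use v's in auto)
    also have "\<dots> = (8 * k * C0) * (L * lam powr (\<gamma> / 2) * E)" by (simp add: B_def)
    also have "\<dots> \<le> C * (L * lam powr (\<gamma> / 2) * E)"
      using Cb[of "8 * k"] E0 lp L0 by (intro mult_right_mono) auto
    finally show ?thesis by (simp add: mult.assoc)
  qed
  moreover have "sup_nabla 2 K1 UNIV (comps w') \<le> C * L * lam powr \<gamma> * E * (1 + E + G)"
  proof -
    have "sup_nabla 2 K1 UNIV (comps w') \<le> 4 * card (UNIV :: 2 set) * (2 * (B * E * (1 + E + G) * L))"
      unfolding K1_def
    proof (rule sup_nabla_2_le[OF l(1) _ ne, where F = w1])
      fix j i i' x assume x: "x \<in> closed_nbhd \<omega> l"
      then have x1: "x \<in> K1" by (simp add: K1_def)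
      have p: "pd i (w1 j) = (\<lambda>x. pd i (m.w0 j) x + pd i (W j) x)" for i
        unfolding w1_def by (rule ext) (rule pd_add[OF df(1)[OF c.w0_smooth] df(1)[OF W(1)]])
      have "\<bar>pd i' (pd i (m.w0 j)) x\<bar> \<le> M"
        unfolding m.pd_w0(2)
        by (rule mol_pow_bound[OF m.h0 m.pdF_cont(4)]) (use m.w2 m.Om_K2[OF m.X_Om[OF x]] in \<open>auto simp: m.reach\<close>)
      moreover have "pd i' (pd i (w1 j)) x = pd i' (pd i (m.w0 j)) x + pd i' (pd i (W j)) x"
        unfolding p by (rule pd_add[OF df(2)[OF c.w0_smooth] df(2)[OF W(1)]])
      moreover have "\<bar>pd i' (pd i (W j)) x\<bar> \<le> B * E * (1 + E + G) * L"
        using W(4)[OF x1, of i' i j] by (simp add: sg2 L_def)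
      moreover have "M \<le> B * E * (1 + E + G) * L"
      proof -
        have "B * E * 1 * L \<le> B * E * (1 + E + G) * L"
          using B1 E0 L0 Y1 by (intro mult_right_mono mult_left_mono) auto
        then show ?thesis using Mle by simp
      qed
      ultimately show "\<bar>pd i' (pd i (w1 j)) x\<bar> \<le> 2 * (B * E * (1 + E + G) * L)" by linarith
    qed (use w1s w'c in auto)
    also have "\<dots> = (16 * C0) * (L * lam powr (\<gamma> / 2) * (E * (1 + E + G)))" by (simp add: B_def)
    also have "\<dots> \<le> C * (L * lam powr \<gamma> * (E * (1 + E + G)))"
      using Cb[of 16] C_pos E0 GM lp L0 by (intro mult_mono mult_right_mono mult_left_mono) auto
    finally show ?thesis by (simp add: mult.assoc)
  qed
  moreover have "C_norm 0 K1 UNIV (entries (defect k K1 v' w' A))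
     \<le> C * (l powr \<beta> * H + 1 / (lam * l) ^ S * lam powr \<gamma> * (D0 + (l * M)\<^sup>2))"
  proof -
    define T where "T = 1 / (lam * l) ^ S * lam powr \<gamma> * (D0 + (l * M)\<^sup>2)"
    have T0: "0 \<le> T" using laml D0n by (simp add: T_def)
    have H0: "0 \<le> H"
      unfolding H_def K2_def using C0_Hoelder_norm_nonneg(1)[OF l2 om ne b(1) FA(1)] FA(2) by (simp add: K2_def)
    have vk1c: "continuous_on UNIV (vk k v' w1 i j)" for i j
      by (rule vk_continuous[OF v's1 w1s1])
    have Dc': "bd {} 0 0 0 ((\<lambda>(i, j) x. FA (i, j) x - vk k v' w1 i j x) p)" for p
      by (cases p) (auto intro!: continuous_intros FAc vk1c)
    have "sup_nabla 0 K1 UNIV (entries (defect k K1 v' w' A)) \<le> real (card (UNIV :: (2 \<times> 2) set)) * 2 ^ 0 * (2 * real n * (H * l powr \<beta>) + 2 * C0 * T)"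
      unfolding K1_def
    proof (rule sup_nabla_le[OF l(1) _ ne Dc'])
      fix p :: "2 \<times> 2" and x assume x: "x \<in> closed_nbhd \<omega> l"
      then have x1: "x \<in> K1" by (simp add: K1_def)
      obtain i j where p: "p = (i, j)" by (cases p)
      have "entries (defect k (closed_nbhd \<omega> l) v' w' A) (i, j) x = FA (i, j) x - vk k v' w1 i j x"
        by (rule defect_entries[OF l(1), where FA = "\<lambda>i j. FA (i, j)"])
          (use v's1 w1s1 FA(2)[OF K12[OF x1]] x in \<open>auto simp: w'_def entries_def\<close>)
      then show "(\<lambda>(i, j) x. FA (i, j) x - vk k v' w1 i j x) p x = entries (defect k (closed_nbhd \<omega> l) v' w' A) p x"
        using p by simp
      fix js :: "2 list" assume "length js = 0"
      have "\<bar>FA (i, j) x - m.P (FA (i, j)) x\<bar> \<le> 2 * real n * (H * l powr \<beta>)"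
      proof (rule m.FA_err[OF b(1) _ H0 x], intro allI)
        fix y t i' assume y: "m.d y \<le> 1.1 * l" and t: "\<bar>t\<bar> \<le> m.h"
        have "cball y m.h \<subseteq> closed_nbhd \<omega> (2 * l)"
        proof
          fix q assume "q \<in> cball y m.h"
          then show "q \<in> closed_nbhd \<omega> (2 * l)" using m.d_tri[of q y] y m.hl l unfolding m.K by simp
        qed
        then show "\<bar>FA (i, j) (y + t *\<^sub>R axis i' 1) + FA (i, j) (y - t *\<^sub>R axis i' 1) - 2 * FA (i, j) y\<bar> \<le> 2 * (H * m.h powr \<beta>)"
          unfolding H_def K2_def
          by (intro Hoelder_second_difference[OF l2 om ne b FA(1) FA(2)[unfolded K2_def] m.h0 t])
      qed
      \<comment> \<open>The splitting of the mollified defect and the invariant of the iteration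
        cancel \<open>m.F0\<close>. Only the mollification error of \<open>A\<close> and the last
        remainder \<open>F\<close> are left.\<close>
      moreover have "FA (i, j) x - vk k v' w1 i j x = (FA (i, j) x - m.P (FA (i, j)) x) + F i j x"
        using id[OF x1, of i j] m.defect_split[OF x, of i j] unfolding v'_def[symmetric] w1_def[symmetric] by linarith
      moreover have "\<bar>F i j x\<bar> \<le> 2 * C0 * T"
      proof -
        have "(E / \<sigma> ^ S)^2 = E^2 / (lam * l) ^ S"
          using sg2[of S] by (simp add: power_divide power_mult mult.commute flip: power_mult)
        then have "B * (E / \<sigma> ^ S)^2 = (C0 * lam powr (\<gamma> / 2) / (lam * l) ^ S) * E^2" by (simp add: B_def)
        also have "\<dots> \<le> (C0 * lam powr \<gamma> / (lam * l) ^ S) * (2 * (D0 + (l * M)^2))"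
          using m.E_facts(6) lp C0 laml D0n unfolding EE
          by (intro mult_mono divide_right_mono mult_left_mono) auto
        also have "\<dots> = 2 * C0 * T" by (simp add: T_def)
        finally show ?thesis using Fb[of i j x] by linarith
      qed
      ultimately show "\<bar>pderivs UNIV js ((\<lambda>(i, j) x. FA (i, j) x - vk k v' w1 i j x) p) x\<bar> \<le> 2 * real n * (H * l powr \<beta>) + 2 * C0 * T"
        using \<open>length js = 0\<close> p by simp
    qed simp
    also have "\<dots> = 8 * real n * (l powr \<beta> * H) + 8 * C0 * T" by simp
    also have "\<dots> \<le> C * (l powr \<beta> * H) + C * T"
    proof (intro add_mono mult_right_mono)
      have "0 \<le> 24 * (real k + 1) * C0" using C0 by simp
      then show "8 * real n \<le> C" using C by linarith
      show "8 * C0 \<le> C" using Cb[of 8] by simp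
    qed (use H0 T0 in auto)
    finally show ?thesis by (simp add: C_norm_simps T_def distrib_left)
  qed
  ultimately show ?thesis unfolding G_def[symmetric] H_def[symmetric] L_def[symmetric] by blast
qed

theorem theorem1p3:
  fixes \<omega> :: "(real^2) set"
  assumes "smooth_domain \<omega>"
  shows "\<exists>l0. 0 < l0 \<and> l0 < 1 \<and>
    (\<forall>(k::nat) (\<gamma>::real). k \<ge> 1 \<and> 0 < \<gamma> \<and> \<gamma> < 1 \<longrightarrow>
      (\<exists>C::real. \<forall>(l::real) (\<beta>::real) (lam::real) (M::real) (S::nat) (J::nat)
          (v :: nat \<Rightarrow> real^2 \<Rightarrow> real) (w :: real^2 \<Rightarrow> real^2) (A :: real^2 \<Rightarrow> real^2^2).
        (let K2 = closed_nbhd \<omega> (2 * l);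
             K1 = closed_nbhd \<omega> l;
             D = defect k K2 v w A;
             D0 = C_norm 0 K2 UNIV (entries D);
             E = sqrt D0 + l * M
         in
           0 < l \<and> l < l0 \<and> 0 < \<beta> \<and> \<beta> < 2 \<and>
           C_on 2 K2 {..<k} v \<and>
           C_on 2 K2 UNIV (comps w) \<and>
           C0_Hoelder_on \<beta> K2 UNIV (entries A) \<and> (\<forall>x\<in>K2. transpose (A x) = A x) \<and>
           lam > 1 / l \<and>
           M \<ge> Max {C_norm 2 K2 {..<k} v, C_norm 2 K2 UNIV (comps w), 1} \<and>
           lcm 2 k = 2 * S \<and> lcm 2 k = k * J
           \<longrightarrow>
           (\<exists>(v' :: nat \<Rightarrow> real^2 \<Rightarrow> real) (w' :: real^2 \<Rightarrow> real^2).
              C_on 2 K1 {..<k} v' \<and>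
              C_on 2 K1 UNIV (comps w') \<and>
              C_norm 1 K1 {..<k} (\<lambda>a x. v' a x - v a x) \<le> C * lam powr (\<gamma> / 2) * E \<and>
              C_norm 1 K1 UNIV (comps (\<lambda>x. w' x - w x))
                \<le> C * lam powr \<gamma> * E * (1 + E + sup_nabla 1 K2 {..<k} v) \<and>
              sup_nabla 2 K1 {..<k} v' \<le> C * ((lam * l) ^ J / l) * lam powr (\<gamma> / 2) * E \<and>
              sup_nabla 2 K1 UNIV (comps w')
                \<le> C * ((lam * l) ^ J / l) * lam powr \<gamma> * E * (1 + E + sup_nabla 1 K2 {..<k} v) \<and>
              C_norm 0 K1 UNIV (entries (defect k K1 v' w' A))
                \<le> C * (l powr \<beta> * C0_Hoelder_norm \<beta> K2 UNIV (entries A)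
                       + 1 / (lam * l) ^ S * lam powr \<gamma> * (D0 + (l * M)\<^sup>2))))))"
proof -
  have om: "bounded \<omega>" "\<omega> \<noteq> {}" using assms by (auto simp: smooth_domain_def)
  obtain R where R: "\<And>x. x \<in> \<omega> \<Longrightarrow> norm x \<le> R" using om(1) bounded_iff by blast
  define R0 where "R0 = max R 0"
  have R0: "0 \<le> R0" "\<omega> \<subseteq> cball 0 R0" using R by (auto simp: R0_def le_max_iff_disj)
  show ?thesis
  \<comment> \<open>The estimates ask of \<open>l\<close> only that it be at most 1, so 1/2 serves
    as the threshold.\<close>
  proof (rule exI[of _ "1/2"], intro conjI allI impI, simp, simp, elim conjE, goal_cases)
    case (1 k \<gamma>)
    note k = 1(1) and g = 1(2)
    \<comment> \<open>The constant has to be fixed before the exponents of the statement are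
      introduced. They are computed from \<open>k\<close> here, and the given ones are identified
      with them afterwards.\<close>
    define S J where "S = lcm 2 k div 2" and "J = lcm 2 k div k"
    have SJ: "lcm 2 k = 2 * S" "lcm 2 k = k * J" by (simp_all add: S_def J_def)
    define n where "n = 3 * S + 1"
    define Z where "Z = (20 * real n) ^ n * 2 ^ n * (1 + k * (1 + 2 ^ n))"
    have Z1: "1 \<le> Z"
    proof -
      have "1 * 1 * 1 \<le> (20 * real n) ^ n * 2 ^ n * (1 + k * (1 + 2 ^ n))"
        by (intro mult_mono one_le_power) (auto simp: n_def)
      then show ?thesis by (simp add: Z_def)
    qed
    \<comment> \<open>Even the last corrugation of round \<open>s\<close> has index below 2S = kJ,
      so the component in use has at most \<open>J\<close> uses, including this one.\<close>
    have J: "(2 * s + 1) div k + 1 \<le> J" if "s < S" for s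
    proof -
      have "2 * s + 1 < J * k" using that SJ by (simp add: mult.commute)
      then have "(2 * s + 1) div k < J" by (rule less_mult_imp_div_less)
      then show ?thesis by simp
    qed
    have R2: "0 \<le> R0 + 2" using R0 by simp
    obtain C0 where C0: "1 \<le> C0" and st: "\<And>X l E G v0 w0 H0 ch F0 lam.
      corrugation_data k X (R0 + 2) l (sqrt (lam * l)) E G n Z v0 w0 H0 ch \<Longrightarrow>
      start_defect n (R0 + 2) (Z * E^2) l F0 \<Longrightarrow> 1 / l < lam \<Longrightarrow>
      \<exists>V W F. corrugation_data.stage k X (R0 + 2) l (sqrt (lam * l)) E G J v0 w0 F0 1 (C0 * lam powr (\<gamma> / 2)) S V W F"
    proof -
      have "3 * S + 1 \<le> n" by (simp add: n_def)
      then have "\<exists>C\<ge>1. \<forall>X l E G v0 w0 H0 ch F0 lam. corrugation_data k X (R0 + 2) l (sqrt (lam * l)) E G n Z v0 w0 H0 ch \<longrightarrow>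
          start_defect (3 * S + 1) (R0 + 2) (Z * E^2) l F0 \<longrightarrow> 1 / l < lam \<longrightarrow>
          (\<exists>V W F. corrugation_data.stage k X (R0 + 2) l (sqrt (lam * l)) E G J v0 w0 F0 1 (C * lam powr (\<gamma> / 2)) S V W F)"
        by (rule corrugation_stages[OF k R2 Z1 _ J g])
      then obtain C where C: "C \<ge> 1" and *: "\<forall>X l E G v0 w0 H0 ch F0 lam. corrugation_data k X (R0 + 2) l (sqrt (lam * l)) E G n Z v0 w0 H0 ch \<longrightarrow>
          start_defect (3 * S + 1) (R0 + 2) (Z * E^2) l F0 \<longrightarrow> 1 / l < lam \<longrightarrow>
          (\<exists>V W F. corrugation_data.stage k X (R0 + 2) l (sqrt (lam * l)) E G J v0 w0 F0 1 (C * lam powr (\<gamma> / 2)) S V W F)"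
        by (elim exE conjE)
      show ?thesis by (rule that[OF C *[folded n_def, rule_format]])
    qed
    show ?case
      unfolding Let_def
    proof (rule exI[of _ "24 * (real k + 1) * C0 + 8 * real n"], intro allI impI, elim conjE, goal_cases)
      case (1 l \<beta> lam M S' J' v w A)
      have S': "S' = S" using 1 SJ(1) by simp
      have "k * J' = k * J" using 1 SJ(2) by simp
      then have J': "J' = J" using k by simp
      have l1: "l \<le> 1" using 1 by simp
      have sym: "\<And>x. x \<in> closed_nbhd \<omega> (2 * l) \<Longrightarrow> transpose (A x) = A x" using 1 by blast
      have M: "C_norm 2 (closed_nbhd \<omega> (2 * l)) {..<k} v \<le> M" "C_norm 2 (closed_nbhd \<omega> (2 * l)) UNIV (comps w) \<le> M" "1 \<le> M"
        using 1 by auto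
      have SJ': "2 * S = k * J" using SJ by simp
      show ?case
        unfolding S' J'
        by (rule stage_estimate[OF R0 om(2) k SJ' g n_def Z_def C0 st order_refl 1(1) l1 1(3,4,9,5-7) sym M])
    qed
  qed
qed

end
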